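(* Let $\mathcal{R}$ be any (commutative, unital) ring of coefficients. For every link diagram $D$ and all $i,j$ there is a short exact sequence of Khovanov homology (with coefficients in $\mathcal{R}$) $$0\to H_{i+2,j+4}(D)\xrightarrow{\alpha_h}H_{i,j}(D\#D_h)\xrightarrow{\beta_h}H_{i-2,j-4}(D)\to 0,$$ where $D\#D_h$ is the connected sum of $D$ with the Hopf link diagram $D_h$, and $\alpha_h,\beta_h$ are induced by the following maps on enhanced states. $\alpha_h$ sends an enhanced state $S$ of $D$ to the enhanced state of $D\#D_h$ which has negative markers at both crossings of the added Hopf link, agrees with $S$ at the crossings of $D$ and on the circles coming from $D_S$, and has negative sign on the one extra circle. $\beta_h$ sends an enhanced state of $D\#D_h$ having positive markers at both crossings of the added Hopf link and positive sign on the extra circle to the enhanced state of $D$ obtained by deleting the extra circle, and sends all other enhanced states to $0$.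
   Context: Khovanov homology (framed unoriented version). A link diagram $D$ is a diagram on the disc of an unoriented framed link in the 3-ball. A Kauffman state $s$ of $D$ assigns to each crossing a marker $+1$ or $-1$. The smoothing of a crossing given by a positive marker joins the two regions swept out when the over-strand is rotated counterclockwise towards the under-strand (Kauffman's $A$-smoothing); a negative marker gives the other smoothing. $D_s$ is the system of circles obtained by smoothing all crossings according to $s$, and $\sigma(s)$ is the number of positive markers minus the number of negative markers. An enhanced state $S$ is a Kauffman state $s$ with a sign $+$ or $-$ assigned to each circle of $D_s$; $D_S=D_s$, $\sigma(S)=\sigma(s)$, and $\tau(S)$ is the number of positive circles minus the number of negative circles. $\mathcal{C}_{i,j}(D)$ is the free abelian group (with coefficients in $\mathcal{R}$: the free $\mathcal{R}$-module) on the enhanced states $S$ with $\sigma(S)=i$ and $\sigma(S)+2\tau(S)=j$. After ordering the crossings, $d_{i,j}:\mathcal{C}_{i,j}(D)\to\mathcal{C}_{i-2,j}(D)$ is $d(S)=\sum_{S'}(-1)^{t(S:S')}[S:S']S'$, summed over enhanced states $S'$ generating $\mathcal{C}_{i-2,j}(D)$, where $[S:S']=1$ if the markers of $S$ and $S'$ differ at exactly one crossing $c$ and all circles of $D_S$ and $D_{S'}$ not touching $c$ have the same signs in $S$ and $S'$, and $[S:S']=0$ otherwise; $t(S:S')$ is the number of negative markers of $S$ at crossings bigger than $c$. $H_{i,j}(D)=\ker(d_{i,j})/d_{i+2,j}(\mathcal{C}_{i+2,j}(D))$. Hopf link addition. $D_h$ is the standard 2-crossing diagram of the Hopf link. $D\#D_h$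 is obtained from $D$ by choosing a non-crossing point of $D$ and adding a new small circle component meeting a short arc of $D$ around this point in exactly two crossings, passing over the arc at one of them and under it at the other. The two new crossings come first in the ordering of crossings, followed by the crossings of $D$ in their order. If the markers at the two new crossings are both positive or both negative, then the circles of the resulting smoothing of $D\#D_h$ are those of the corresponding smoothing of $D$ together with exactly one extra circle. *)

theory Defs
  imports "HOL-Algebra.Module" "HOL-Algebra.AbelCoset"
begin

section \<open>Link diagrams\<close>

text \<open>
  A diagram is given by its planar diagram code.  The crossings cut the diagram into arcs (edges of
  the underlying 4-valent plane graph), each of which has a label.  A crossing is the list
  \<open>[a, b, c, d]\<close> of the labels of the four edge ends around it, read counterclockwise, where \<open>a, c\<close>
  belong to the under-strand and \<open>b, d\<close> to the over-strand (so \<open>[a, b, c, d]\<close> and \<open>[c, d, a, b]\<close>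
  describe the same unoriented crossing).  A label which occurs at no crossing stands for a
  component of the diagram without crossings.  The position in the list \<open>crossings D\<close> is the ordering of
  the crossings.
\<close>

record 'a diagram =
  arcs :: "'a set"
  crossings :: "'a list list"

definition edge_ends :: "'a diagram \<Rightarrow> (nat \<times> nat) set" where
  "edge_ends D = {..<length (crossings D)} \<times> {..<4}"

definition label :: "'a diagram \<Rightarrow> nat \<times> nat \<Rightarrow> 'a" where
  "label D x = crossings D ! fst x ! snd x"

definition diagram_code :: "'a diagram \<Rightarrow> bool" where
  "diagram_code D \<longleftrightarrow>
     finite (arcs D) \<and>
     (\<forall>x\<in>set (crossings D). length x = 4 \<and> set x \<subseteq> arcs D) \<and>
     (\<forall>a\<in>arcs D. card {x \<in> edge_ends D. label D x = a} \<in> {0, 2})"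

definition generated_classes :: "'b set \<Rightarrow> ('b \<times> 'b) set \<Rightarrow> 'b set set" where
  "generated_classes A r = A // (r \<union> r\<inverse>)\<^sup>*"

text \<open>
  Walking from an edge end \<open>x\<close> along its arc to the other end \<open>(c, k)\<close>, and turning there to the next
  edge end of the crossing \<open>c\<close>, follows the boundary of a face.
\<close>

definition faces :: "'a diagram \<Rightarrow> (nat \<times> nat) set set" where
  "faces D = generated_classes (edge_ends D)
     {(x, (c, Suc k mod 4)) | x c k. x \<in> edge_ends D \<and> (c, k) \<in> edge_ends D \<and>
        x \<noteq> (c, k) \<and> label D x = label D (c, k)}"

definition graph_components :: "'a diagram \<Rightarrow> nat set set" where
  "graph_components D = generated_classes {..<length (crossings D)}
     {(c, c'). c < length (crossings D) \<and> c' < length (crossings D) \<and>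
        set (crossings D ! c) \<inter> set (crossings D ! c') \<noteq> {}}"

text \<open>
  The code comes from a diagram on the disc iff all components of the 4-valent graph with the
  prescribed cyclic orders at the crossings have genus 0.  The faces are counted for each
  component separately, so Euler's formula reads V - E + F = 2K.  The outer region and the relative
  position of disjoint components are not recorded; the Khovanov complex does not depend on them.
\<close>

definition planar :: "'a diagram \<Rightarrow> bool" where
  "planar D \<longleftrightarrow>
     int (length (crossings D)) - int (card (label D ` edge_ends D)) + int (card (faces D))
       = 2 * int (card (graph_components D))"

definition link_diagram :: "'a diagram \<Rightarrow> bool" where
  "link_diagram D \<longleftrightarrow> diagram_code D \<and> planar D"


section \<open>Enhanced Kauffman states\<close>

text \<open>
  A Kauffman state is a list of markers, one per crossing, with \<open>True\<close> for a positive and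
  \<open>False\<close> for a negative marker.  Rotating the over-strand \<open>b - d\<close> of \<open>[a, b, c, d]\<close> counterclockwise
  sweeps out the regions between \<open>b, c\<close> and between \<open>d, a\<close>; joining these connects \<open>a\<close> with \<open>b\<close>
  and \<open>c\<close> with \<open>d\<close>.  A circle of the smoothed diagram is represented by the set of its arcs.
\<close>

definition kauffman_states :: "'a diagram \<Rightarrow> bool list set" where
  "kauffman_states D = {s. length s = length (crossings D)}"

fun smoothing :: "'a list \<Rightarrow> bool \<Rightarrow> ('a \<times> 'a) set" where
  "smoothing [a, b, c, d] True = {(a, b), (c, d)}"
| "smoothing [a, b, c, d] False = {(a, d), (b, c)}"
| "smoothing _ _ = {}"

definition circles :: "'a diagram \<Rightarrow> bool list \<Rightarrow> 'a set set" where
  "circles D s = generated_classes (arcs D) (\<Union>c<length (crossings D). smoothing (crossings D ! c) (s ! c))"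

text \<open>An enhanced state is a Kauffman state together with the set of its positive circles.\<close>

type_synonym 'a enhanced_state = "bool list \<times> 'a set set"

definition enhanced_states :: "'a diagram \<Rightarrow> 'a enhanced_state set" where
  "enhanced_states D = {(s, P). s \<in> kauffman_states D \<and> P \<subseteq> circles D s}"

definition state_sigma :: "'a enhanced_state \<Rightarrow> int" where
  "state_sigma S = int (length (filter (\<lambda>m. m) (fst S))) - int (length (filter Not (fst S)))"

definition state_tau :: "'a diagram \<Rightarrow> 'a enhanced_state \<Rightarrow> int" where
  "state_tau D S = int (card (snd S)) - int (card (circles D (fst S) - snd S))"

definition generators :: "'a diagram \<Rightarrow> int \<Rightarrow> int \<Rightarrow> 'a enhanced_state set" where
  "generators D i j =
     {S \<in> enhanced_states D. state_sigma S = i \<and> state_sigma S + 2 * state_tau D S = j}"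


section \<open>Modules\<close>

definition free_module :: "('r, 'm) ring_scheme \<Rightarrow> 'b set \<Rightarrow> ('r, 'b \<Rightarrow> 'r) module" where
  "free_module R G =
     \<lparr>carrier = {f. (\<forall>S\<in>G. f S \<in> carrier R) \<and> (\<forall>S. S \<notin> G \<longrightarrow> f S = \<zero>\<^bsub>R\<^esub>)},
      mult = undefined, one = undefined,
      zero = (\<lambda>_. \<zero>\<^bsub>R\<^esub>),
      add = (\<lambda>f g S. f S \<oplus>\<^bsub>R\<^esub> g S),
      smult = (\<lambda>r f S. r \<otimes>\<^bsub>R\<^esub> f S)\<rparr>"

text \<open>
  The \<open>R\<close>-linear map from the free module on \<open>G\<close> to the free module on \<open>G'\<close> which sends each
  \<open>S \<in> G\<close> to the sum of all \<open>q S S'\<close> times \<open>S'\<close>.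
\<close>

definition linear_extension ::
  "('r, 'm) ring_scheme \<Rightarrow> 'b set \<Rightarrow> 'c set \<Rightarrow> ('b \<Rightarrow> 'c \<Rightarrow> int) \<Rightarrow> ('b \<Rightarrow> 'r) \<Rightarrow> 'c \<Rightarrow> 'r" where
  "linear_extension R G G' q f =
     (\<lambda>S'. if S' \<in> G' then (\<Oplus>\<^bsub>R\<^esub>S\<in>G. [q S S'] \<cdot>\<^bsub>R\<^esub> f S) else \<zero>\<^bsub>R\<^esub>)"

definition quotient_module :: "('r, 'b) module \<Rightarrow> 'b set \<Rightarrow> ('r, 'b set) module" where
  "quotient_module M N =
     \<lparr>carrier = a_rcosets\<^bsub>M\<^esub> N,
      mult = undefined, one = undefined,
      zero = N,
      add = (\<lambda>X Y. X <+>\<^bsub>M\<^esub> Y),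
      smult = (\<lambda>r X. \<Union>x\<in>X. N +>\<^bsub>M\<^esub> (r \<odot>\<^bsub>M\<^esub> x))\<rparr>"

definition module_hom :: "('r, 'm) ring_scheme \<Rightarrow> ('r, 'b) module \<Rightarrow> ('r, 'c) module \<Rightarrow> ('b \<Rightarrow> 'c) set" where
  "module_hom R M N =
     {f \<in> hom (add_monoid M) (add_monoid N).
        \<forall>r\<in>carrier R. \<forall>x\<in>carrier M. f (r \<odot>\<^bsub>M\<^esub> x) = r \<odot>\<^bsub>N\<^esub> f x}"

definition short_exact_sequence ::
  "('r, 'm) ring_scheme \<Rightarrow> ('r, 'b) module \<Rightarrow> ('b \<Rightarrow> 'c) \<Rightarrow> ('r, 'c) module \<Rightarrow> ('c \<Rightarrow> 'd) \<Rightarrow> ('r, 'd) module \<Rightarrow> bool" where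
  "short_exact_sequence R L f M g N \<longleftrightarrow>
     module R L \<and> module R M \<and> module R N \<and>
     f \<in> module_hom R L M \<and> g \<in> module_hom R M N \<and>
     inj_on f (carrier L) \<and>
     f ` carrier L = a_kernel M N g \<and>
     g ` carrier M = carrier N"


section \<open>Khovanov homology\<close>

definition touches :: "'a diagram \<Rightarrow> 'a set \<Rightarrow> nat \<Rightarrow> bool" where
  "touches D C c \<longleftrightarrow> C \<inter> set (crossings D ! c) \<noteq> {}"

definition differ_exactly_at :: "'a diagram \<Rightarrow> nat \<Rightarrow> 'a enhanced_state \<Rightarrow> 'a enhanced_state \<Rightarrow> bool" where
  "differ_exactly_at D c S S' \<longleftrightarrow> {k. k < length (crossings D) \<and> fst S ! k \<noteq> fst S' ! k} = {c}"

text \<open>The integers \<open>[S:S']\<close> and \<open>t(S:S')\<close>; the latter only matters if \<open>[S:S'] = 1\<close>.\<close>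

definition incidence :: "'a diagram \<Rightarrow> 'a enhanced_state \<Rightarrow> 'a enhanced_state \<Rightarrow> int" where
  "incidence D S S' =
     (if \<exists>c. differ_exactly_at D c S S' \<and>
            (\<forall>C \<in> circles D (fst S) \<union> circles D (fst S'). \<not> touches D C c \<longrightarrow> (C \<in> snd S \<longleftrightarrow> C \<in> snd S'))
      then 1 else 0)"

definition sign_exponent :: "'a diagram \<Rightarrow> 'a enhanced_state \<Rightarrow> 'a enhanced_state \<Rightarrow> nat" where
  "sign_exponent D S S' =
     card {k. (THE c. differ_exactly_at D c S S') < k \<and> k < length (crossings D) \<and> \<not> fst S ! k}"

definition chain_module ::
  "('r, 'm) ring_scheme \<Rightarrow> 'a diagram \<Rightarrow> int \<Rightarrow> int \<Rightarrow> ('r, 'a enhanced_state \<Rightarrow> 'r) module" where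
  "chain_module R D i j = free_module R (generators D i j)"

definition differential ::
  "('r, 'm) ring_scheme \<Rightarrow> 'a diagram \<Rightarrow> int \<Rightarrow> int \<Rightarrow> ('a enhanced_state \<Rightarrow> 'r) \<Rightarrow> ('a enhanced_state \<Rightarrow> 'r)" where
  "differential R D i j =
     linear_extension R (generators D i j) (generators D (i - 2) j)
       (\<lambda>S S'. (-1) ^ sign_exponent D S S' * incidence D S S')"

definition cycles ::
  "('r, 'm) ring_scheme \<Rightarrow> 'a diagram \<Rightarrow> int \<Rightarrow> int \<Rightarrow> ('a enhanced_state \<Rightarrow> 'r) set" where
  "cycles R D i j =
     a_kernel (chain_module R D i j) (chain_module R D (i - 2) j) (differential R D i j)"

definition boundaries ::
  "('r, 'm) ring_scheme \<Rightarrow> 'a diagram \<Rightarrow> int \<Rightarrow> int \<Rightarrow> ('a enhanced_state \<Rightarrow> 'r) set" where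
  "boundaries R D i j = differential R D (i + 2) j ` carrier (chain_module R D (i + 2) j)"

definition khovanov_homology ::
  "('r, 'm) ring_scheme \<Rightarrow> 'a diagram \<Rightarrow> int \<Rightarrow> int \<Rightarrow> ('r, ('a enhanced_state \<Rightarrow> 'r) set) module" where
  "khovanov_homology R D i j =
     quotient_module ((chain_module R D i j)\<lparr>carrier := cycles R D i j\<rparr>) (boundaries R D i j)"

text \<open>
  The map on homology classes induced by a map \<open>f\<close> of chains, where the target is \<open>H\<^sub>i\<^sub>,\<^sub>j(D)\<close>.  If \<open>f\<close>
  is additive and maps boundaries to boundaries, the union is over a single coset.
\<close>

definition induced_map ::
  "('r, 'm) ring_scheme \<Rightarrow> 'a diagram \<Rightarrow> int \<Rightarrow> int \<Rightarrow> ('c \<Rightarrow> ('a enhanced_state \<Rightarrow> 'r)) \<Rightarrow>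
     'c set \<Rightarrow> ('a enhanced_state \<Rightarrow> 'r) set" where
  "induced_map R D i j f X =
     (\<Union>x\<in>X. boundaries R D i j +>\<^bsub>chain_module R D i j\<^esub> f x)"


section \<open>Adding a Hopf link\<close>

text \<open>
  \<open>cut_arc D e r xs\<close>: at a point of the arc \<open>e\<close> the diagram \<open>D\<close> is cut open.  The two arcs ending at
  the cut are labelled \<open>e\<close> and \<open>r\<close>, and \<open>xs\<close> are the relabelled crossings: one of the two
  ends of \<open>e\<close> at crossings gets the fresh label \<open>r\<close>.  Cutting a component without crossings leaves
  one arc.
\<close>

inductive cut_arc :: "'a diagram \<Rightarrow> 'a \<Rightarrow> 'a \<Rightarrow> 'a list list \<Rightarrow> bool" for D where
  at_crossing: "\<lbrakk>(c, k) \<in> edge_ends D; label D (c, k) = e; r \<notin> arcs D\<rbrakk> \<Longrightarrow>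
     cut_arc D e r ((crossings D)[c := (crossings D ! c)[k := r]])"
| crossingless: "\<lbrakk>e \<in> arcs D; e \<notin> label D ` edge_ends D\<rbrakk> \<Longrightarrow> cut_arc D e e (crossings D)"

text \<open>
  \<open>hopf_addition D D'\<close>: \<open>D'\<close> is a diagram \<open>D # D\<^sub>h\<close>.  Draw the cut arc from left (\<open>e\<close>) to right
  (\<open>r\<close>).  The part of it inside the new circle is \<open>m\<close>, and the top and bottom halves of the new
  circle are \<open>t\<close> and \<open>b\<close>.  The circle passes over the arc at the left crossing and under it at the
  right crossing; the opposite choice is the same picture rotated by a half turn, i.e. with the roles of the
  two ends of the cut arc exchanged.  The two new crossings may come in either order.
\<close>

definition hopf_addition :: "'a diagram \<Rightarrow> 'a diagram \<Rightarrow> bool" where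
  "hopf_addition D D' \<longleftrightarrow>
     (\<exists>e r m t b xs. cut_arc D e r xs \<and>
        distinct [m, t, b] \<and> {m, t, b} \<inter> insert r (arcs D) = {} \<and>
        arcs D' = arcs D \<union> {r, m, t, b} \<and>
        (crossings D' = [e, b, m, t] # [b, r, t, m] # xs \<or>
         crossings D' = [b, r, t, m] # [e, b, m, t] # xs))"

text \<open>
  If the markers at the two new crossings agree, intersecting with \<open>arcs D\<close> turns a circle of a
  smoothing of \<open>D # D\<^sub>h\<close> into the corresponding circle of \<open>D\<close>, while the extra circle becomes
  empty.
\<close>

definition alpha_state :: "'a diagram \<Rightarrow> 'a diagram \<Rightarrow> 'a enhanced_state \<Rightarrow> 'a enhanced_state" where
  "alpha_state D D' S =
     (let s' = False # False # fst S
      in (s', {C \<in> circles D' s'. C \<inter> arcs D \<noteq> {} \<and> C \<inter> arcs D \<in> snd S}))"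

text \<open>\<open>None\<close> stands for the value 0.\<close>

definition beta_state :: "'a diagram \<Rightarrow> 'a enhanced_state \<Rightarrow> 'a enhanced_state option" where
  "beta_state D S' =
     (if take 2 (fst S') = [True, True] \<and> (\<exists>C\<in>snd S'. C \<inter> arcs D = {})
      then Some (drop 2 (fst S'), {C \<inter> arcs D | C. C \<in> snd S' \<and> C \<inter> arcs D \<noteq> {}})
      else None)"

definition alpha_chain ::
  "('r, 'm) ring_scheme \<Rightarrow> 'a diagram \<Rightarrow> 'a diagram \<Rightarrow> int \<Rightarrow> int \<Rightarrow>
     ('a enhanced_state \<Rightarrow> 'r) \<Rightarrow> ('a enhanced_state \<Rightarrow> 'r)" where
  "alpha_chain R D D' i j =
     linear_extension R (generators D (i + 2) (j + 4)) (generators D' i j)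
       (\<lambda>S S'. if alpha_state D D' S = S' then 1 else 0)"

definition beta_chain ::
  "('r, 'm) ring_scheme \<Rightarrow> 'a diagram \<Rightarrow> 'a diagram \<Rightarrow> int \<Rightarrow> int \<Rightarrow>
     ('a enhanced_state \<Rightarrow> 'r) \<Rightarrow> ('a enhanced_state \<Rightarrow> 'r)" where
  "beta_chain R D D' i j =
     linear_extension R (generators D' i j) (generators D (i - 2) (j - 4))
       (\<lambda>S' S. if beta_state D S' = Some S then 1 else 0)"

end

theory Submission
  imports Defs
begin

text \<open>
  Fix the markers \<open>m1\<close>, \<open>m2\<close> of the two new crossings.  The circles of the smoothed diagram \<open>D # D\<^sub>h\<close> are those of \<open>D\<close>, and one extra
  circle if \<open>m1 = m2\<close>; the arc to which the Hopf link is added stays on one circle.  So a chain of \<open>D # D\<^sub>h\<close> consists of six chains of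
  \<open>D\<close>: two for the markers \<open>++\<close> (extra circle positive or negative), one each for \<open>-+\<close> and \<open>+-\<close>, and two for \<open>--\<close>.
  Let \<open>X\<close> be the action of the circle through the chosen arc on the chains of \<open>D\<close>, where the chains are seen as a tensor power of the algebra with the
  basis \<open>1\<close> (negative sign) and \<open>X\<close> (positive sign), \<open>X\<^sup>2 = 0\<close>.  A change of one new marker from \<open>++\<close>
  merges the extra circle with the circle of the arc, and a change to \<open>--\<close> splits it off.  Both merges are the same surjective map, and both splits are the same
  injective map, up to sign.  The kernel of the merge is a copy of the chains of \<open>D\<close>, on which \<open>\<beta>\<^sub>h\<close> is an isomorphism; the cokernel of the split is
  another copy, to which \<open>\<alpha>\<^sub>h\<close> is an isomorphism; between them everything cancels.

  This is made precise by explicit chain maps \<open>\<gamma>\<close> and \<open>\<delta>\<close> with \<open>\<beta>\<gamma> = 1\<close>, \<open>\<delta>\<alpha> = 1\<close> and \<open>\<beta>\<alpha> = 0\<close>, and by a homotopy \<open>h\<close> with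
  \<open>1 = \<alpha>\<delta> + \<gamma>\<beta> + dh + hd\<close> (lemma \<open>homotopy\<close>).  The lift \<open>\<gamma>\<close> is a chain map because \<open>X\<close> commutes with the differential of \<open>D\<close>, and this is
  why the connecting homomorphism vanishes.  All maps have integer matrices, so the identities are proved over the integers and carried over to the coefficient ring
  (\<open>linear_extension_comp\<close>).

  The calculations rest on a description of the differential without the signs of circles.  A chain with a fixed Kauffman state is encoded as a function of sets \<open>T\<close> of
  arcs: its value is the coefficient of the enhanced state whose negative circles are those that meet \<open>T\<close>, if \<open>T\<close> meets every circle at most once, and 0
  otherwise.  Then splitting a circle is the identity, and merging two circles through the arcs \<open>a\<close> and \<open>c\<close> is \<open>X\<^sub>a + X\<^sub>c\<close>, where
  \<open>X\<^sub>p\<close> sends a function \<open>\<phi>\<close> to \<open>T \<mapsto> \<phi> (T \<union> {p})\<close>, and to 0 if \<open>p \<in> T\<close> (\<open>evaluation_differential\<close>).  Since these operators commute, so do changes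
  of different markers, and the square of the differential is 0 (\<open>differential_square\<close>); the differential of \<open>D # D\<^sub>h\<close> is read off in blocks
  (\<open>component_differential\<close>).

  Planarity enters through the fact that a change of one marker always merges two circles or splits one.  It follows from an orientation of the arcs that alternates
  around each crossing and therefore orients the circles of all smoothings (\<open>resmoothing\<close>).  Such an orientation comes from a checkerboard colouring of
  the faces.  A colouring exists because the set of all edges is even, and because Euler's formula
  implies that every even set of edges bounds a set of faces modulo 2 (\<open>even_subgraphs_boundary\<close>).
\<close>

section \<open>A planar diagram has a checkerboard orientation\<close>

lemma equiv_generated: "equiv UNIV ((r \<union> r\<inverse>)\<^sup>*)"
  by (intro equivI) (auto simp: refl_on_def sym_Un_converse sym_rtrancl trans_rtrancl)

lemma generated_least:
  assumes "r \<subseteq> Q" "equiv UNIV Q"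
  shows "(r \<union> r\<inverse>)\<^sup>* \<subseteq> Q"
proof -
  have "r \<union> r\<inverse> \<subseteq> Q"
    using assms by (auto simp: equiv_def sym_def)
  then have "(r \<union> r\<inverse>)\<^sup>* \<subseteq> Q\<^sup>*" by (rule rtrancl_mono)
  also have "Q\<^sup>* = Q"
    using assms(2)
  proof -
    have "Id \<subseteq> Q" "trans Q" using assms(2) by (auto simp: equiv_def refl_on_def)
    then show ?thesis by (simp add: rtrancl_trancl_reflcl sup.absorb1)
  qed
  finally show ?thesis .
qed

text \<open>
  An orientation of the edge ends that alternates around each crossing and is reversed from one end of an
  arc to the other, so that it orients the arcs.  It is given by the crossings \<open>c\<close> with \<open>u c\<close>, at which the
  ends \<open>0\<close> and \<open>2\<close> point to the crossing.  In a checkerboard colouring of the faces the boundaries of the black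
  faces are oriented in this way.
\<close>

definition inward :: "(nat \<Rightarrow> bool) \<Rightarrow> nat \<times> nat \<Rightarrow> bool" where
  "inward u x \<longleftrightarrow> (even (snd x) \<longleftrightarrow> u (fst x))"

definition checkerboard :: "'a diagram \<Rightarrow> (nat \<Rightarrow> bool) \<Rightarrow> bool" where
  "checkerboard D u \<longleftrightarrow>
     (\<forall>x\<in>edge_ends D. \<forall>y\<in>edge_ends D. x \<noteq> y \<longrightarrow> label D x = label D y \<longrightarrow> inward u x \<noteq> inward u y)"

lemma two_ends:
  assumes "diagram_code D" "x \<in> edge_ends D"
  shows "\<exists>y\<in>edge_ends D. y \<noteq> x \<and> label D y = label D x \<and>
    (\<forall>z\<in>edge_ends D. label D z = label D x \<longrightarrow> z = x \<or> z = y)"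
proof -
  let ?A = "{z \<in> edge_ends D. label D z = label D x}"
  obtain c k where x: "x = (c, k)" "c < length (crossings D)" "k < 4"
    using assms(2) by (auto simp: edge_ends_def)
  then have "crossings D ! c \<in> set (crossings D)" by simp
  then have "length (crossings D ! c) = 4" "set (crossings D ! c) \<subseteq> arcs D"
    using assms(1) by (auto simp: diagram_code_def)
  then have "label D x \<in> arcs D" using x by (auto simp: label_def)
  then have "card ?A \<in> {0, 2}" using assms(1) by (auto simp: diagram_code_def)
  moreover have "finite ?A" by (auto simp: edge_ends_def)
  moreover have "x \<in> ?A" using assms(2) by auto
  ultimately have "card ?A = 2" using card_0_eq[of ?A] by blast
  then obtain a b where ab: "?A = {a, b}" "a \<noteq> b" by (auto simp: card_2_iff)
  then have "x = a \<or> x = b" using \<open>x \<in> ?A\<close> by blast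
  then obtain y where y: "?A = {x, y}" "y \<noteq> x" using ab by blast
  then have "y \<in> ?A" "\<forall>z\<in>?A. z = x \<or> z = y" by blast+
  with y(2) show ?thesis by blast
qed

locale plane_code =
  fixes D :: "'a diagram"
  assumes code: "diagram_code D" and planar: "planar D"
begin

abbreviation "n \<equiv> length (crossings D)"
abbreviation "edges \<equiv> label D ` edge_ends D"

definition mate :: "nat \<times> nat \<Rightarrow> nat \<times> nat" where
  "mate x = (SOME y. y \<in> edge_ends D \<and> y \<noteq> x \<and> label D y = label D x)"

lemma mate:
  assumes "x \<in> edge_ends D"
  shows "mate x \<in> edge_ends D" "mate x \<noteq> x" "label D (mate x) = label D x"
    "z \<in> edge_ends D \<Longrightarrow> label D z = label D x \<Longrightarrow> z = x \<or> z = mate x"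
proof -
  obtain y where y: "y \<in> edge_ends D" "y \<noteq> x" "label D y = label D x"
    "\<forall>z\<in>edge_ends D. label D z = label D x \<longrightarrow> z = x \<or> z = y"
    using two_ends[OF code assms] by blast
  have *: "mate x \<in> edge_ends D \<and> mate x \<noteq> x \<and> label D (mate x) = label D x"
    unfolding mate_def by (rule someI[of _ y]) (use y(1-3) in simp)
  then show "mate x \<in> edge_ends D" "mate x \<noteq> x" "label D (mate x) = label D x" by auto
  show "z = x \<or> z = mate x" if "z \<in> edge_ends D" "label D z = label D x"
    using y(4) * that by blast
qed

definition face_rel where
  "face_rel = {(x, (c, Suc k mod 4)) | x c k. x \<in> edge_ends D \<and> (c, k) \<in> edge_ends D \<and>
        x \<noteq> (c, k) \<and> label D x = label D (c, k)}"

definition face :: "nat \<times> nat \<Rightarrow> (nat \<times> nat) set" where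
  "face x = (face_rel \<union> face_rel\<inverse>)\<^sup>* `` {x}"

lemma faces_image: "faces D = face ` edge_ends D"
  by (auto simp: faces_def generated_classes_def quotient_def face_def[abs_def] face_rel_def)

text \<open>
  Walking along an arc and then turning to the next end of the crossing stays in the same face.  So the
  faces on the two sides of an arc are the face of an end and the face of the next end around the crossing.
\<close>

lemma face_step:
  assumes "(c, k) \<in> edge_ends D"
  shows "face (mate (c, k)) = face (c, Suc k mod 4)"
proof -
  have "(mate (c, k), (c, Suc k mod 4)) \<in> face_rel"
    using mate[OF assms] assms unfolding face_rel_def by blast
  then show ?thesis
    unfolding face_def by (intro equiv_class_eq[OF equiv_generated]) auto
qed

text \<open>
  Chains modulo 2 are sets of faces, of edges and of crossings.  A crossing lies in the boundary of a set
  \<open>g\<close> of edges if an odd number of its four ends belong to \<open>g\<close>; the fourfold exclusive or makes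
  additivity a matter of propositional logic.  An edge lies in the boundary of a set of faces if exactly one of
  its two sides does.
\<close>

definition boundary_vertices :: "'a set \<Rightarrow> nat set" where
  "boundary_vertices g = {v. v < n \<and>
     ((label D (v, 0) \<in> g) \<noteq> ((label D (v, 1) \<in> g) \<noteq> ((label D (v, 2) \<in> g) \<noteq> (label D (v, 3) \<in> g))))}"

definition boundary_edges :: "(nat \<times> nat) set set \<Rightarrow> 'a set" where
  "boundary_edges W = {label D x | x. x \<in> edge_ends D \<and> face x \<in> W \<and> face (mate x) \<notin> W}"

definition even_subgraphs :: "'a set set" where
  "even_subgraphs = {g. g \<subseteq> edges \<and> boundary_vertices g = {}}"

definition component_rel where
  "component_rel = {(c, c'). c < n \<and> c' < n \<and> set (crossings D ! c) \<inter> set (crossings D ! c') \<noteq> {}}"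

definition component where
  "component v = (component_rel \<union> component_rel\<inverse>)\<^sup>* `` {v}"

lemma components_image: "graph_components D = component ` {..<n}"
  by (auto simp: graph_components_def generated_classes_def quotient_def component_def[abs_def] component_rel_def)

definition base where "base v = (SOME w. w < n \<and> component w = component v)"

lemma base: "v < n \<Longrightarrow> base v < n \<and> component (base v) = component v"
  unfolding base_def by (rule someI_ex) auto

lemma base_base: "component v = component w \<Longrightarrow> base v = base w"
  by (simp add: base_def)

lemma card_bases: "card (base ` {..<n}) = card (graph_components D)"
proof -
  have "inj_on component (base ` {..<n})"
  proof (rule inj_onI, clarsimp)
    fix v w assume "v < n" "w < n" "component (base v) = component (base w)"
    then show "base v = base w" using base[of v] base[of w] base_base[of v w] by simp
  qed
  moreover have "component ` base ` {..<n} = graph_components D"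
    using base by (simp add: components_image image_image cong: image_cong_simp)
  ultimately have "bij_betw component (base ` {..<n}) (graph_components D)"
    by (simp add: bij_betw_def)
  then show ?thesis by (rule bij_betw_same_card)
qed

lemma edge_end_iff [simp]: "(c, k) \<in> edge_ends D \<longleftrightarrow> c < n \<and> k < 4"
  by (auto simp: edge_ends_def)

lemma label_boundary_edges:
  assumes "x \<in> edge_ends D"
  shows "label D x \<in> boundary_edges W \<longleftrightarrow> (face x \<in> W) \<noteq> (face (mate x) \<in> W)"
proof -
  have mm: "mate (mate x) = x"
    using mate[OF assms] mate[OF mate(1)[OF assms]] by metis
  show ?thesis
    unfolding boundary_edges_def mem_Collect_eq
    using assms mate[OF assms] mm mate by metis
qed

text \<open>
  Once around a crossing, membership in \<open>W\<close> of the current face changes an even number of times.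
\<close>

lemma boundary_edges_even: "boundary_edges W \<in> even_subgraphs"
proof -
  have "v \<notin> boundary_vertices (boundary_edges W)" for v
  proof
    assume v: "v \<in> boundary_vertices (boundary_edges W)"
    then have n: "v < n" by (auto simp: boundary_vertices_def)
    have "label D (v, k) \<in> boundary_edges W \<longleftrightarrow> (face (v, k) \<in> W) \<noteq> (face (v, l) \<in> W)"
      if "k < 4" "l = Suc k mod 4" for k l
      using label_boundary_edges[of "(v, k)" W] face_step[of v k] n that by simp
    from this[of 0 1] this[of 1 2] this[of 2 3] this[of 3 0] v show False
      by (simp add: boundary_vertices_def) argo
  qed
  moreover have "boundary_edges W \<subseteq> edges" by (auto simp: boundary_edges_def)
  ultimately show ?thesis by (auto simp: even_subgraphs_def)
qed

lemma adjacent_mate: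
  assumes "(v, w) \<in> component_rel"
  obtains k l where "k < 4" "l < 4" "label D (v, k) = label D (w, l)" "v < n" "w < n"
proof -
  obtain x where x: "x \<in> set (crossings D ! v)" "x \<in> set (crossings D ! w)" "v < n" "w < n"
    using assms by (auto simp: component_rel_def)
  then have "length (crossings D ! v) = 4" "length (crossings D ! w) = 4"
    using code by (auto simp: diagram_code_def)
  with x that show thesis by (auto simp: in_set_conv_nth label_def)
qed

text \<open>
  Two sets of faces with the same boundary differ by a union of whole components, because whether they agree
  at a face does not change when an arc is crossed.
\<close>

lemma agreement_spreads:
  assumes eq: "boundary_edges W = boundary_edges W'"
    and "face (v, 0) \<in> W \<longleftrightarrow> face (v, 0) \<in> W'" "v < n" "w \<in> component v" "k < 4"
  shows "w < n \<and> (face (w, k) \<in> W \<longleftrightarrow> face (w, k) \<in> W')"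
proof -
  define Z where "Z = {x \<in> edge_ends D. face x \<in> W \<longleftrightarrow> face x \<in> W'}"
  have m: "mate x \<in> Z" if "x \<in> Z" for x
    using that label_boundary_edges[of x W] label_boundary_edges[of x W'] eq mate(1)[of x]
    by (auto simp: Z_def)
  have s: "(v, Suc k mod 4) \<in> Z" if "(v, k) \<in> Z" for v k
    using m[OF that] face_step[of v k] that by (auto simp: Z_def)
  have all: "(v, l) \<in> Z" if "(v, k) \<in> Z" "l < 4" for v k l
  proof -
    have k: "k < 4" using that by (auto simp: Z_def)
    have "(v, (k + i) mod 4) \<in> Z" for i
    proof (induction i)
      case (Suc i)
      then show ?case using s[of v "(k + i) mod 4"] by (simp add: mod_Suc_eq)
    qed (use that k in simp)
    from this[of "4 - k + l"] show ?thesis using k that by simp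
  qed
  have step: "(w, 0) \<in> Z" if v: "(v, 0) \<in> Z" and vw: "(v, w) \<in> component_rel \<union> component_rel\<inverse>" for v w
  proof -
    have sym: "component_rel\<inverse> = component_rel" by (auto simp: component_rel_def)
    obtain k l where kl: "k < 4" "l < 4" "label D (v, k) = label D (w, l)" "v < n" "w < n"
      using adjacent_mate[of v w] vw unfolding sym by blast
    have "(w, l) = (v, k) \<or> (w, l) = mate (v, k)"
      using mate(4)[of "(v, k)" "(w, l)"] kl by simp
    then have "(w, l) \<in> Z" using all[OF v kl(1)] m by auto
    then show ?thesis using all by simp
  qed
  have "(v, w) \<in> (component_rel \<union> component_rel\<inverse>)\<^sup>*" using assms(4) by (simp add: component_def)
  then have "(w, 0) \<in> Z"
  proof (induction rule: rtrancl_induct)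
    case base
    show ?case using assms by (simp add: Z_def)
  qed (rule step)
  then have "(w, k) \<in> Z" using all assms(5) by simp
  then show ?thesis by (auto simp: Z_def)
qed

lemma component_self: "v \<in> component v" by (simp add: component_def)

lemma finite_edge_ends [simp]: "finite (edge_ends D)" by (auto simp: edge_ends_def)

text \<open>
  A set of faces is determined by its boundary together with its members among one chosen face for each
  component.
\<close>

lemma card_boundary_edges:
  "2 ^ card (faces D) \<le> card (boundary_edges ` Pow (faces D)) * 2 ^ card (graph_components D)"
proof -
  let ?f = "\<lambda>W. (boundary_edges W, {v \<in> base ` {..<n}. face (v, 0) \<in> W})"
  have "inj_on ?f (Pow (faces D))"
  proof (rule inj_onI)
    fix W W' assume W: "W \<in> Pow (faces D)" "W' \<in> Pow (faces D)" and eq: "?f W = ?f W'"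
    have "face x \<in> W \<longleftrightarrow> face x \<in> W'" if x: "x \<in> edge_ends D" for x
    proof -
      obtain v k where vk: "x = (v, k)" "v < n" "k < 4" using x by (cases x) auto
      have b: "base v < n" "component (base v) = component v" using base[OF vk(2)] by auto
      have "face (base v, 0) \<in> W \<longleftrightarrow> face (base v, 0) \<in> W'"
        using eq vk(2) by auto
      with agreement_spreads[of W W' "base v" v k] eq b vk component_self[of v] show ?thesis by auto
    qed
    then show "W = W'" using W by (auto simp: faces_image)
  qed
  then have "card (Pow (faces D)) \<le> card (boundary_edges ` Pow (faces D) \<times> Pow (base ` {..<n}))"
    by (rule card_inj_on_le) (auto simp: faces_image)
  then show ?thesis
    by (simp add: card_Pow card_cartesian_product card_bases faces_image)
qed

lemma boundary_vertices_sym_diff: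
  "boundary_vertices (sym_diff g g') = sym_diff (boundary_vertices g) (boundary_vertices g')"
  unfolding boundary_vertices_def by auto

lemma boundary_vertices_edge:
  assumes "(v, w) \<in> component_rel" "v \<noteq> w"
  shows "\<exists>g\<subseteq>edges. boundary_vertices g = {v, w}"
proof -
  obtain k l where kl: "k < 4" "l < 4" "label D (v, k) = label D (w, l)" "v < n" "w < n"
    using adjacent_mate[OF assms(1)] .
  have m: "mate (v, k) = (w, l)"
    using mate(4)[of "(v, k)" "(w, l)"] kl assms(2) by auto
  have *: "label D (u, i) = label D (v, k) \<longleftrightarrow> (u, i) = (v, k) \<or> (u, i) = (w, l)" if "u < n" "i < 4" for u i
    using mate(4)[of "(v, k)" "(u, i)"] m kl that by auto
  have odd: "(0 = i) \<noteq> ((1 = i) \<noteq> ((2 = i) \<noteq> (3 = i)))" if "i < 4" for i :: nat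
    using that by linarith
  have "u \<in> boundary_vertices {label D (v, k)} \<longleftrightarrow> u = v \<or> u = w" for u
  proof (cases "u < n")
    case True
    then have "u \<in> boundary_vertices {label D (v, k)} \<longleftrightarrow>
      (u = v \<and> 0 = k \<or> u = w \<and> 0 = l) \<noteq> ((u = v \<and> 1 = k \<or> u = w \<and> 1 = l) \<noteq>
        ((u = v \<and> 2 = k \<or> u = w \<and> 2 = l) \<noteq> (u = v \<and> 3 = k \<or> u = w \<and> 3 = l)))"
      using *[OF True, of 0] *[OF True, of 1] *[OF True, of 2] *[OF True, of 3]
      unfolding boundary_vertices_def by simp
    then show ?thesis using odd[OF kl(1)] odd[OF kl(2)] assms(2) by (cases "u = v"; cases "u = w") auto
  qed (use kl in \<open>auto simp: boundary_vertices_def\<close>)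
  then have "boundary_vertices {label D (v, k)} = {v, w}" by blast
  then show ?thesis using kl by (intro exI[of _ "{label D (v, k)}"]) auto
qed

text \<open>
  The edges of a path have the two ends of the path as their boundary.
\<close>

lemma boundary_vertices_path:
  assumes "v < n" "w \<in> component v"
  shows "\<exists>g\<subseteq>edges. boundary_vertices g = sym_diff {v} {w}"
proof -
  have sym: "component_rel\<inverse> = component_rel" by (auto simp: component_rel_def)
  have "(v, w) \<in> (component_rel \<union> component_rel\<inverse>)\<^sup>*" using assms(2) by (simp add: component_def)
  then show ?thesis
  proof (induction rule: rtrancl_induct)
    case base
    show ?case by (intro exI[of _ "{}"]) (auto simp: boundary_vertices_def)
  next
    case (step y z)
    show ?case
    proof (cases "y = z")
      case False
      obtain g where g: "g \<subseteq> edges" "boundary_vertices g = sym_diff {v} {y}" using step by blast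
      obtain h where h: "h \<subseteq> edges" "boundary_vertices h = {y, z}"
        using boundary_vertices_edge[OF _ False] step(2) sym by auto
      have "boundary_vertices (sym_diff g h) = sym_diff {v} {z}"
        unfolding boundary_vertices_sym_diff g(2) h(2) using False by auto
      then show ?thesis using g h by (intro exI[of _ "sym_diff g h"]) auto
    qed (use step in simp)
  qed
qed

lemma prescribed_boundary:
  assumes "U \<subseteq> {..<n} - base ` {..<n}"
  shows "\<exists>g\<subseteq>edges. boundary_vertices g - base ` {..<n} = U"
proof -
  have "finite U" using assms finite_subset by blast
  then show ?thesis using assms
  proof (induction U rule: finite_induct)
    case empty
    show ?case by (intro exI[of _ "{}"]) (auto simp: boundary_vertices_def)
  next
    case (insert v U)
    obtain g where g: "g \<subseteq> edges" "boundary_vertices g - base ` {..<n} = U" using insert by auto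
    have "v < n" using insert by auto
    then have "base v \<in> component v" using base component_self by metis
    then obtain h where h: "h \<subseteq> edges" "boundary_vertices h = sym_diff {v} {base v}"
      using boundary_vertices_path[OF \<open>v < n\<close>] by blast
    have "v \<noteq> base v" "base v \<in> base ` {..<n}" using insert(4) \<open>v < n\<close> by auto
    then have "boundary_vertices (sym_diff g h) - base ` {..<n} = insert v U"
      unfolding boundary_vertices_sym_diff h(2) using g(2) insert(2,4) by auto
    then show ?case using g h by (intro exI[of _ "sym_diff g h"]) auto
  qed
qed

text \<open>
  Choose a set \<open>g U\<close> of edges for each set \<open>U\<close> of crossings without base crossings, with boundary \<open>U\<close>
  up to base crossings.  Then an even subgraph \<open>e\<close> and \<open>U\<close> can be recovered from the sum of \<open>e\<close> and \<open>g U\<close>.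
\<close>

lemma card_even_subgraphs:
  "card even_subgraphs * 2 ^ n \<le> 2 ^ (card edges + card (graph_components D))"
proof -
  let ?B = "base ` {..<n}"
  have B: "?B \<subseteq> {..<n}" using base by auto
  define g where "g U = (SOME g. g \<subseteq> edges \<and> boundary_vertices g - ?B = U)" for U
  have g: "g U \<subseteq> edges" "boundary_vertices (g U) - ?B = U" if "U \<in> Pow ({..<n} - ?B)" for U
  proof -
    have "g U \<subseteq> edges \<and> boundary_vertices (g U) - ?B = U"
      unfolding g_def by (rule someI_ex) (use prescribed_boundary that in auto)
    then show "g U \<subseteq> edges" "boundary_vertices (g U) - ?B = U" by auto
  qed
  have b: "boundary_vertices (sym_diff e (g U)) - ?B = U" if "e \<in> even_subgraphs" "U \<in> Pow ({..<n} - ?B)" for e U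
    unfolding boundary_vertices_sym_diff using that g(2)[OF that(2)] by (auto simp: even_subgraphs_def)
  have "inj_on (\<lambda>(e, U). sym_diff e (g U)) (even_subgraphs \<times> Pow ({..<n} - ?B))"
  proof (rule inj_onI, clarify)
    fix e e' U U'
    assume *: "e \<in> even_subgraphs" "e' \<in> even_subgraphs" "U \<subseteq> {..<n} - ?B" "U' \<subseteq> {..<n} - ?B"
      "sym_diff e (g U) = sym_diff e' (g U')"
    then have "U = U'" using b[of e U] b[of e' U'] by simp
    with * show "e = e' \<and> U = U'" by blast
  qed
  moreover have "(\<lambda>(e, U). sym_diff e (g U)) ` (even_subgraphs \<times> Pow ({..<n} - ?B)) \<subseteq> Pow edges"
  proof (rule image_subsetI)
    fix p assume "p \<in> even_subgraphs \<times> Pow ({..<n} - ?B)"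
    then obtain e U where "p = (e, U)" "e \<subseteq> edges" "g U \<subseteq> edges"
      using g(1) by (auto simp: even_subgraphs_def)
    then show "(case p of (e, U) \<Rightarrow> sym_diff e (g U)) \<in> Pow edges" by auto
  qed
  ultimately have "card (even_subgraphs \<times> Pow ({..<n} - ?B)) \<le> card (Pow edges)"
    by (rule card_inj_on_le) simp
  then have "card even_subgraphs * 2 ^ (n - card ?B) \<le> 2 ^ card edges"
    using B by (simp add: card_cartesian_product card_Pow card_Diff_subset finite_subset)
  moreover have "card ?B \<le> n" using card_mono[OF _ B] by simp
  ultimately have "card even_subgraphs * 2 ^ (n - card ?B) * 2 ^ card ?B \<le> 2 ^ card edges * 2 ^ card ?B"
    by simp
  moreover have "(2::nat) ^ n = 2 ^ (n - card ?B) * 2 ^ card ?B"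
    using \<open>card ?B \<le> n\<close> by (simp flip: power_add)
  ultimately show ?thesis by (simp add: card_bases power_add mult.assoc)
qed

text \<open>
  The first homology modulo 2 of a union of spheres vanishes.  The number of boundaries is at least
  \<open>2 ^ (F - K)\<close> and the number of even subgraphs is at most \<open>2 ^ (E + K - V)\<close>, and these numbers are equal by
  Euler's formula.
\<close>

lemma even_subgraphs_boundary: "even_subgraphs = boundary_edges ` Pow (faces D)"
proof -
  let ?I = "boundary_edges ` Pow (faces D)"
  have euler: "card edges + 2 * card (graph_components D) = n + card (faces D)"
    using planar by (simp add: planar_def)
  have "card even_subgraphs * 2 ^ n * 2 ^ card (faces D)
      \<le> 2 ^ (card edges + card (graph_components D)) * (card ?I * 2 ^ card (graph_components D))"
    by (intro mult_mono card_even_subgraphs card_boundary_edges) auto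
  also have "\<dots> = card ?I * 2 ^ (card edges + 2 * card (graph_components D))"
    by (simp add: power_add power_mult power2_eq_square mult_2)
  also have "\<dots> = card ?I * 2 ^ n * 2 ^ card (faces D)"
    unfolding euler by (simp add: power_add)
  finally have "card even_subgraphs \<le> card ?I" by simp
  moreover have "?I \<subseteq> even_subgraphs" using boundary_edges_even by auto
  moreover have "finite even_subgraphs"
    by (rule finite_subset[of _ "Pow edges"]) (auto simp: even_subgraphs_def)
  ultimately show ?thesis by (metis card_seteq)
qed

text \<open>
  All crossings have valence 4, so the set of all edges is even and hence the boundary of a set \<open>W\<close> of faces.
  The faces in \<open>W\<close> are the black faces of a checkerboard colouring.
\<close>

lemma checkerboard_exists: "\<exists>u. checkerboard D u"
proof -
  have "edges \<in> even_subgraphs"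
    by (auto simp: even_subgraphs_def boundary_vertices_def)
  then obtain W where W: "edges = boundary_edges W"
    by (auto simp: even_subgraphs_boundary)
  have opp: "(face x \<in> W) \<noteq> (face (mate x) \<in> W)" if "x \<in> edge_ends D" for x
    using label_boundary_edges[OF that, of W] that W by auto
  define u where "u c \<longleftrightarrow> face (c, 0) \<in> W" for c
  have inw: "inward u (c, k) \<longleftrightarrow> face (c, k) \<in> W" if "c < n" "k < 4" for c k
    using that(2)
  proof (induction k)
    case 0
    then show ?case by (simp add: inward_def u_def)
  next
    case (Suc k)
    then show ?case using opp[of "(c, k)"] face_step[of c k] that(1) by (auto simp: inward_def)
  qed
  have "inward u x \<noteq> inward u y" if "x \<in> edge_ends D" "y \<in> edge_ends D" "x \<noteq> y" "label D x = label D y" for x y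
  proof -
    have "y = mate x" using mate(4)[of x y] that by auto
    moreover have "inward u x \<longleftrightarrow> face x \<in> W" "inward u y \<longleftrightarrow> face y \<in> W"
      using that(1,2) inw[of "fst x" "snd x"] inw[of "fst y" "snd y"] by (simp_all add: edge_ends_def mem_Times_iff)
    ultimately show ?thesis using opp[OF that(1)] by simp
  qed
  then show ?thesis unfolding checkerboard_def by blast
qed

end

section \<open>Resmoothing a crossing\<close>

definition join_classes :: "('a \<times> 'a) set \<Rightarrow> 'a \<Rightarrow> 'a \<Rightarrow> ('a \<times> 'a) set" where
  "join_classes E p q = {(x, y). (x, y) \<in> E \<or> (x, p) \<in> E \<and> (q, y) \<in> E \<or> (x, q) \<in> E \<and> (p, y) \<in> E}"

lemma equivD:
  assumes "equiv UNIV E"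
  shows "(x, x) \<in> E" "(x, y) \<in> E \<Longrightarrow> (y, x) \<in> E" "(x, y) \<in> E \<Longrightarrow> (y, z) \<in> E \<Longrightarrow> (x, z) \<in> E"
  using assms by (auto simp: equiv_def refl_on_def dest: symD transD)

lemma equiv_join_classes:
  assumes "equiv UNIV E"
  shows "equiv UNIV (join_classes E p q)"
proof (rule equivI)
  note E = equivD[OF assms]
  show "refl (join_classes E p q)" using E(1) by (simp add: refl_on_def join_classes_def)
  show "sym (join_classes E p q)"
  proof (rule symI)
    fix x y assume "(x, y) \<in> join_classes E p q"
    then show "(y, x) \<in> join_classes E p q" using E(2) by (auto simp: join_classes_def)
  qed
  show "trans (join_classes E p q)"
  proof (rule transI)
    fix x y z assume "(x, y) \<in> join_classes E p q" "(y, z) \<in> join_classes E p q"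
    then consider "(x, y) \<in> E" "(y, z) \<in> join_classes E p q" | "(x, y) \<in> join_classes E p q" "(y, z) \<in> E"
      | "(x, p) \<in> E" "(q, z) \<in> E" | "(x, q) \<in> E" "(p, z) \<in> E"
      | "(x, p) \<in> E" "(p, z) \<in> E" | "(x, q) \<in> E" "(q, z) \<in> E"
      by (auto simp: join_classes_def)
    then show "(x, z) \<in> join_classes E p q"
      by cases (auto simp: join_classes_def dest: E(3))
  qed
qed simp

text \<open>
  New pairs that only relate the classes of \<open>p\<close> and \<open>q\<close>, and do relate them, unite these two classes.
\<close>

lemma generated_insert:
  fixes r :: "('a \<times> 'a) set"
  assumes s: "s \<subseteq> join_classes ((r \<union> r\<inverse>)\<^sup>*) p q"
    and p': "(p', q') \<in> s" "(p, p') \<in> (r \<union> r\<inverse>)\<^sup>*" "(q', q) \<in> (r \<union> r\<inverse>)\<^sup>*"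
  shows "((r \<union> s) \<union> (r \<union> s)\<inverse>)\<^sup>* = join_classes ((r \<union> r\<inverse>)\<^sup>*) p q"
proof -
  let ?E = "(r \<union> r\<inverse>)\<^sup>*" and ?E' = "((r \<union> s) \<union> (r \<union> s)\<inverse>)\<^sup>*"
  note E = equivD[OF equiv_generated[of r]] and E' = equivD[OF equiv_generated[of "r \<union> s"]]
  have sub: "?E \<subseteq> ?E'" by (intro rtrancl_mono) auto
  have "(p', q') \<in> ?E'" using p'(1) by auto
  then have pq: "(p, q) \<in> ?E'" using p'(2,3) sub by (meson E'(3) subsetD)
  have "join_classes ?E p q \<subseteq> ?E'"
  proof clarify
    fix x y assume "(x, y) \<in> join_classes ?E p q"
    then have "(x, y) \<in> ?E' \<or> (x, p) \<in> ?E' \<and> (q, y) \<in> ?E' \<or> (x, q) \<in> ?E' \<and> (p, y) \<in> ?E'"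
      using sub unfolding join_classes_def by blast
    then show "(x, y) \<in> ?E'" using pq E'(2)[OF pq] by (meson E'(3))
  qed
  moreover have "?E' \<subseteq> join_classes ?E p q"
  proof (rule generated_least[OF _ equiv_join_classes[OF equiv_generated]])
    have "r \<subseteq> join_classes ?E p q" by (auto simp: join_classes_def)
    then show "r \<union> s \<subseteq> join_classes ?E p q" using s by blast
  qed
  ultimately show ?thesis by blast
qed

lemma generated_absorb:
  assumes "s \<subseteq> (r \<union> r\<inverse>)\<^sup>*"
  shows "((r \<union> s) \<union> (r \<union> s)\<inverse>)\<^sup>* = (r \<union> r\<inverse>)\<^sup>*"
proof
  show "((r \<union> s) \<union> (r \<union> s)\<inverse>)\<^sup>* \<subseteq> (r \<union> r\<inverse>)\<^sup>*"
    using assms by (intro generated_least equiv_generated) auto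
qed (intro rtrancl_mono, auto)

lemma single_valued_joinable:
  assumes "single_valued r" "(x, y) \<in> (r \<union> r\<inverse>)\<^sup>*"
  shows "\<exists>z. (x, z) \<in> r\<^sup>* \<and> (y, z) \<in> r\<^sup>*"
  using assms(2)
proof (induction rule: rtrancl_induct)
  case (step y y')
  then obtain z where z: "(x, z) \<in> r\<^sup>*" "(y, z) \<in> r\<^sup>*" by blast
  from step(2) show ?case
  proof
    assume "(y, y') \<in> r"
    then show ?thesis
      using z single_valued_confluent[OF assms(1) z(2) r_into_rtrancl[OF \<open>(y, y') \<in> r\<close>]]
      by (meson rtrancl_trans rtrancl.rtrancl_refl)
  next
    assume "(y, y') \<in> r\<inverse>"
    then show ?thesis using z by (meson converseD converse_rtrancl_into_rtrancl)
  qed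
qed blast

definition smoothing_rel :: "'a diagram \<Rightarrow> bool list \<Rightarrow> ('a \<times> 'a) set" where
  "smoothing_rel D s = (\<Union>c<length (crossings D). smoothing (crossings D ! c) (s ! c))"

definition same_circle :: "'a diagram \<Rightarrow> bool list \<Rightarrow> ('a \<times> 'a) set" where
  "same_circle D s = (smoothing_rel D s \<union> (smoothing_rel D s)\<inverse>)\<^sup>*"

lemma circles_altdef: "circles D s = arcs D // same_circle D s"
  by (simp add: circles_def generated_classes_def same_circle_def smoothing_rel_def)

lemma smoothing_length_4:
  assumes "length x = 4"
  shows "smoothing x m = (if m then {(x ! 0, x ! 1), (x ! 2, x ! 3)} else {(x ! 0, x ! 3), (x ! 1, x ! 2)})"
proof -
  obtain a b c d where "x = [a, b, c, d]" using assms by (auto simp: numeral_eq_Suc length_Suc_conv)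
  then show ?thesis by (cases m) auto
qed

text \<open>
  The position of the end that is joined to the \<open>k\<close>-th end of a crossing with marker \<open>m\<close>.  It has the other
  parity, so each smoothing is compatible with a checkerboard orientation.
\<close>

definition partner :: "bool \<Rightarrow> nat \<Rightarrow> nat" where
  "partner m k = (if m then [1, 0, 3, 2] else [3, 2, 1, 0]) ! k"

lemma less_4: "k < 4 \<longleftrightarrow> k = 0 \<or> k = 1 \<or> k = 2 \<or> k = (3::nat)" by auto

lemma partner: "k < 4 \<Longrightarrow> partner m k < 4 \<and> partner m (partner m k) = k \<and> (even (partner m k) \<longleftrightarrow> odd k)"
  by (auto simp: partner_def less_4)

text \<open>
  The two ends of the under-strand of a crossing.  Either smoothing joins each of the other two ends to one of
  them, so that they represent all circles at the crossing.
\<close>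

definition opposite_a where "opposite_a D c = crossings D ! c ! 0"
definition opposite_c where "opposite_c D c = crossings D ! c ! 2"

locale checkerboard_code =
  fixes D :: "'a diagram" and u :: "nat \<Rightarrow> bool"
  assumes code: "diagram_code D" and board: "checkerboard D u"
begin

abbreviation "n \<equiv> length (crossings D)"

lemma edge_end_iff [simp]: "(c, k) \<in> edge_ends D \<longleftrightarrow> c < n \<and> k < 4"
  by (auto simp: edge_ends_def)

lemma length_crossing: "c < n \<Longrightarrow> length (crossings D ! c) = 4"
  using code by (auto simp: diagram_code_def)

text \<open>
  The strands of the smoothing away from the crossing \<open>c\<close>, followed along the orientation if \<open>i\<close> holds and
  against it otherwise.  In either direction each arc has at most one successor.
\<close>

definition flow :: "bool list \<Rightarrow> nat \<Rightarrow> bool \<Rightarrow> ('a \<times> 'a) set" where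
  "flow s c i = {(label D (c', k), label D (c', partner (s ! c') k)) | c' k.
     c' < n \<and> c' \<noteq> c \<and> k < 4 \<and> inward u (c', k) = i}"

definition other_rel :: "bool list \<Rightarrow> nat \<Rightarrow> ('a \<times> 'a) set" where
  "other_rel s c = (\<Union>c'\<in>{..<n} - {c}. smoothing (crossings D ! c') (s ! c'))"

lemma inward_partner:
  assumes "k < 4" shows "inward u (c, partner m k) \<longleftrightarrow> \<not> inward u (c, k)"
  using partner[OF assms, of m] by (auto simp: inward_def)

lemma flow_converse: "(flow s c i)\<inverse> = flow s c (\<not> i)"
proof -
  have "flow s c i \<subseteq> (flow s c (\<not> i))\<inverse>" for i
  proof clarify
    fix x y assume "(x, y) \<in> flow s c i"
    then obtain c' k where *: "x = label D (c', k)" "y = label D (c', partner (s ! c') k)"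
      "c' < n" "c' \<noteq> c" "k < 4" "inward u (c', k) = i" unfolding flow_def by blast
    have "(y, x) = (label D (c', partner (s ! c') k), label D (c', partner (s ! c') (partner (s ! c') k)))"
      using * partner by simp
    moreover have "inward u (c', partner (s ! c') k) = (\<not> i)" using * inward_partner by simp
    ultimately show "(y, x) \<in> flow s c (\<not> i)"
      using * partner unfolding flow_def by blast
  qed
  from this[of i] this[of "\<not> i"] show ?thesis by auto
qed

lemma label_inj:
  assumes "x \<in> edge_ends D" "y \<in> edge_ends D" "label D x = label D y" "inward u x = inward u y"
  shows "x = y"
  using board assms unfolding checkerboard_def by blast

lemma flow_single_valued: "single_valued (flow s c i)"
proof (rule single_valuedI)
  fix x y z assume xy: "(x, y) \<in> flow s c i" and xz: "(x, z) \<in> flow s c i"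
  obtain c1 k1 where 1: "x = label D (c1, k1)" "y = label D (c1, partner (s ! c1) k1)"
      "c1 < n" "k1 < 4" "inward u (c1, k1) = i" using xy unfolding flow_def by blast
  obtain c2 k2 where 2: "x = label D (c2, k2)" "z = label D (c2, partner (s ! c2) k2)"
      "c2 < n" "k2 < 4" "inward u (c2, k2) = i" using xz unfolding flow_def by blast
  have "(c1, k1) = (c2, k2)" using 1 2 by (intro label_inj) auto
  then show "y = z" using 1 2 by simp
qed

lemma other_rel_flow: "other_rel s c \<union> (other_rel s c)\<inverse> = flow s c i \<union> (flow s c i)\<inverse>"
proof -
  have 1: "other_rel s c \<subseteq> flow s c True \<union> flow s c False"
  proof
    fix z assume "z \<in> other_rel s c"
    then obtain c' where c': "c' < n" "c' \<noteq> c" "z \<in> smoothing (crossings D ! c') (s ! c')"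
      by (auto simp: other_rel_def)
    then obtain k where "k < 4" "z = (label D (c', k), label D (c', partner (s ! c') k))"
      using that[of 0] that[of 1] that[of 2]
      by (auto simp: smoothing_length_4[OF length_crossing] partner_def label_def split: if_splits)
    then show "z \<in> flow s c True \<union> flow s c False"
      using c' by (cases "inward u (c', k)") (unfold flow_def, blast+)
  qed
  have 2: "flow s c i \<subseteq> other_rel s c \<union> (other_rel s c)\<inverse>"
  proof
    fix z assume "z \<in> flow s c i"
    then obtain c' k where z: "z = (label D (c', k), label D (c', partner (s ! c') k))"
      and c': "c' < n" "c' \<noteq> c" and k: "k < 4"
      unfolding flow_def by blast
    from k z have "z \<in> smoothing (crossings D ! c') (s ! c') \<union> (smoothing (crossings D ! c') (s ! c'))\<inverse>"
      by (cases "s ! c'") (auto simp: less_4 smoothing_length_4[OF length_crossing[OF c'(1)]] partner_def label_def)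
    then show "z \<in> other_rel s c \<union> (other_rel s c)\<inverse>"
      using c' unfolding other_rel_def by blast
  qed
  have "flow s c True \<union> flow s c False = flow s c i \<union> (flow s c i)\<inverse>"
    using flow_converse[of s c i] by (cases i) auto
  with 1 2 flow_converse[of s c i] show ?thesis by auto
qed

abbreviation other where "other s c \<equiv> (other_rel s c \<union> (other_rel s c)\<inverse>)\<^sup>*"

lemma not_in_flow:
  assumes "c < n" "k < 4"
  shows "(label D (c, k), y) \<notin> flow s c (inward u (c, k))"
proof
  assume "(label D (c, k), y) \<in> flow s c (inward u (c, k))"
  then obtain c' k' where *: "label D (c, k) = label D (c', k')" "c' < n" "k' < 4" "c' \<noteq> c"
    "inward u (c', k') = inward u (c, k)" unfolding flow_def by blast
  have "(c, k) = (c', k')" by (rule label_inj) (use * assms in simp_all)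
  then show False using * by simp
qed

text \<open>
  If both ends point to \<open>c\<close>, then both of their arcs have no successor outside \<open>c\<close>.  But two arcs in the same
  class of a single-valued relation have a common iterated successor, so the arcs would be equal; an arc has
  only one end that points to a crossing.  For two ends that point away from \<open>c\<close> the flow is reversed.
\<close>

lemma parallel_ends_separated:
  assumes "c < n" "k < 4" "l < 4" "k \<noteq> l" "even k \<longleftrightarrow> even l"
  shows "(label D (c, k), label D (c, l)) \<notin> other s c"
proof
  let ?i = "inward u (c, k)"
  have i: "inward u (c, l) = ?i" using assms(5) by (auto simp: inward_def)
  assume "(label D (c, k), label D (c, l)) \<in> other s c"
  then have "(label D (c, k), label D (c, l)) \<in> (flow s c ?i \<union> (flow s c ?i)\<inverse>)\<^sup>*"
    by (simp only: other_rel_flow[of s c ?i])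
  then obtain z where z: "(label D (c, k), z) \<in> (flow s c ?i)\<^sup>*" "(label D (c, l), z) \<in> (flow s c ?i)\<^sup>*"
    using single_valued_joinable[OF flow_single_valued] by blast
  have "z = label D (c, k)"
    using z(1) by (cases rule: converse_rtranclE) (simp_all add: not_in_flow[OF assms(1,2)])
  moreover have "z = label D (c, l)"
    using z(2) by (cases rule: converse_rtranclE) (simp_all add: not_in_flow[OF assms(1,3), unfolded i])
  ultimately have "(c, k) = (c, l)" using assms i by (intro label_inj) auto
  then show False using assms(4) by simp
qed

text \<open>
  Otherwise the strand that leaves \<open>c\<close> at the end \<open>k\<close> never returns to \<open>c\<close>, and the successor is an injective map on the finite
  set \<open>U\<close> of its arcs.  Then it is surjective, but the first arc has no predecessor.
\<close>

lemma path_ends_at_crossing: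
  assumes c: "c < n" and k: "k < 4"
  shows "\<exists>l<4. (even l \<longleftrightarrow> odd k) \<and> (label D (c, k), label D (c, l)) \<in> other s c"
proof (rule ccontr)
  assume none: "\<not> ?thesis"
  let ?i = "\<not> inward u (c, k)"
  let ?r = "flow s c ?i"
  let ?b = "label D (c, k)"
  have oth: "other s c = (?r \<union> ?r\<inverse>)\<^sup>*" by (simp only: other_rel_flow[of s c ?i])
  define U where "U = other s c `` {?b} \<inter> label D ` edge_ends D"
  have "finite U" by (auto simp: U_def edge_ends_def)
  have succ: "\<exists>y\<in>U. (x, y) \<in> ?r" if "x \<in> U" for x
  proof -
    \<comment> \<open>One of the two ends of the arc has the required direction.\<close>
    obtain z where z: "z \<in> edge_ends D" "x = label D z" "inward u z = ?i"
    proof -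
      obtain z where z: "z \<in> edge_ends D" "x = label D z" using \<open>x \<in> U\<close> by (auto simp: U_def)
      obtain y where "y \<in> edge_ends D" "y \<noteq> z" "label D y = label D z"
        using two_ends[OF code z(1)] by blast
      with z board that[of z] that[of y] show thesis unfolding checkerboard_def by metis
    qed
    obtain c' l where cl: "z = (c', l)" "c' < n" "l < 4" using z(1) by (cases z) auto
    have "c' \<noteq> c"
    proof
      assume "c' = c"
      then have "even l \<longleftrightarrow> odd k" using z(3) cl by (auto simp: inward_def)
      moreover have "(?b, label D (c, l)) \<in> other s c" using \<open>x \<in> U\<close> z(2) cl \<open>c' = c\<close> by (simp add: U_def)
      ultimately show False using none cl(3) by blast
    qed
    let ?y = "label D (c', partner (s ! c') l)"
    have xy: "(x, ?y) \<in> ?r" using cl z \<open>c' \<noteq> c\<close> unfolding flow_def by blast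
    have "(?b, x) \<in> (?r \<union> ?r\<inverse>)\<^sup>*" using \<open>x \<in> U\<close> oth by (simp add: U_def)
    then have "(?b, ?y) \<in> other s c" unfolding oth using xy by (meson UnI1 rtrancl.rtrancl_into_rtrancl)
    moreover have "?y \<in> label D ` edge_ends D" using cl partner[OF cl(3)] by (intro imageI) simp
    ultimately show ?thesis using xy by (auto simp: U_def)
  qed
  then obtain f where f: "f x \<in> U" "(x, f x) \<in> ?r" if "x \<in> U" for x by metis
  have "inj_on f U"
  proof (rule inj_onI)
    fix x y assume "x \<in> U" "y \<in> U" "f x = f y"
    then have "(f x, x) \<in> ?r\<inverse>" "(f x, y) \<in> ?r\<inverse>" using f(2)[of x] f(2)[of y] by auto
    then show "x = y" using flow_single_valued flow_converse by (metis single_valuedD)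
  qed
  then have "f ` U = U" using endo_inj_surj[OF \<open>finite U\<close>] f(1) by blast
  moreover have "?b \<in> U" using c k by (auto simp: U_def)
  ultimately obtain x where "x \<in> U" "f x = ?b" by (metis imageE)
  then have "(x, ?b) \<in> ?r" using f by metis
  then have "(?b, x) \<in> flow s c (inward u (c, k))" using flow_converse[of s c ?i] by auto
  then show False using not_in_flow[OF c k] by blast
qed

lemma smoothing_rel_split:
  assumes "c < n"
  shows "smoothing_rel D s = other_rel s c \<union> smoothing (crossings D ! c) (s ! c)"
  using assms by (auto simp: smoothing_rel_def other_rel_def)

text \<open>
  Away from the crossing the four ends are joined in pairs, and ends of the same direction are not joined to
  each other.  Hence one of the two smoothings closes the two strands separately, and the other one
  connects them to a single circle.  In particular a resmoothing never turns one circle into one circle, which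
  can happen for diagrams that are not planar.
\<close>

lemma resmoothing:
  assumes c: "c < n" and s: "length s = n"
  defines "p \<equiv> opposite_a D c" and "q \<equiv> opposite_c D c"
  shows "(p, q) \<notin> same_circle D (s[c := True]) \<and>
      same_circle D (s[c := False]) = join_classes (same_circle D (s[c := True])) p q \<or>
    (p, q) \<notin> same_circle D (s[c := False]) \<and>
      same_circle D (s[c := True]) = join_classes (same_circle D (s[c := False])) p q"
proof -
  let ?r = "other_rel s c" and ?O = "other s c"
  let ?l = "\<lambda>k. label D (c, k)"
  note E = equivD[OF equiv_generated[of ?r]]
  have pq: "p = ?l 0" "q = ?l 2" by (simp_all add: p_def q_def opposite_a_def opposite_c_def label_def)
  have rel: "smoothing_rel D (s[c := m]) =
      ?r \<union> (if m then {(?l 0, ?l 1), (?l 2, ?l 3)} else {(?l 0, ?l 3), (?l 1, ?l 2)})" for m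
  proof -
    have "other_rel (s[c := m]) c = ?r" by (simp add: other_rel_def)
    moreover have "s[c := m] ! c = m" using c s by simp
    ultimately show ?thesis
      using smoothing_rel_split[OF c, of "s[c := m]"] smoothing_length_4[OF length_crossing[OF c]]
      by (simp add: label_def)
  qed
  have sep: "(?l 0, ?l 2) \<notin> ?O" "(?l 1, ?l 3) \<notin> ?O"
    using parallel_ends_separated[OF c, of 0 2] parallel_ends_separated[OF c, of 1 3] by simp_all
  have end1: "(?l 1, ?l 0) \<in> ?O \<or> (?l 1, ?l 2) \<in> ?O" and end3: "(?l 3, ?l 0) \<in> ?O \<or> (?l 3, ?l 2) \<in> ?O"
    using path_ends_at_crossing[OF c, of 1 s] path_ends_at_crossing[OF c, of 3 s] by (auto simp: less_4)
  consider (pos) "(?l 0, ?l 1) \<in> ?O" "(?l 2, ?l 3) \<in> ?O" | (neg) "(?l 0, ?l 3) \<in> ?O" "(?l 2, ?l 1) \<in> ?O"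
    using end1 end3 sep E(2,3) by metis
  then show ?thesis
  proof cases
    case pos
    have "same_circle D (s[c := True]) = ?O"
      unfolding same_circle_def rel using pos by (simp only: if_True) (intro generated_absorb, blast)
    moreover have "same_circle D (s[c := False]) = join_classes ?O p q"
      unfolding same_circle_def rel if_False
    proof (rule generated_insert)
      show "(?l 0, ?l 3) \<in> {(?l 0, ?l 3), (?l 1, ?l 2)}" "(p, ?l 0) \<in> ?O" "(?l 3, q) \<in> ?O"
        using pos E(2) pq by auto
      show "{(?l 0, ?l 3), (?l 1, ?l 2)} \<subseteq> join_classes ?O p q"
        using pos E(2) pq by (auto simp: join_classes_def)
    qed
    ultimately show ?thesis using sep pq by simp
  next
    case neg
    have "same_circle D (s[c := False]) = ?O"
      unfolding same_circle_def rel using neg E(2) by (simp only: if_False) (intro generated_absorb, blast)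
    moreover have "same_circle D (s[c := True]) = join_classes ?O p q"
      unfolding same_circle_def rel if_True
    proof (rule generated_insert)
      show "(?l 0, ?l 1) \<in> {(?l 0, ?l 1), (?l 2, ?l 3)}" "(p, ?l 0) \<in> ?O" "(?l 1, q) \<in> ?O"
        using neg E(2) pq by auto
      show "{(?l 0, ?l 1), (?l 2, ?l 3)} \<subseteq> join_classes ?O p q"
        using neg E(2) pq by (auto simp: join_classes_def)
    qed
    ultimately show ?thesis using sep pq by simp
  qed
qed

end

section \<open>Uniting two classes of an equivalence relation\<close>

text \<open>
  A transversal \<open>T\<close> contains at most one element of each class.  A function \<open>g\<close> of sets of classes (of the positive circles
  of a smoothing) is encoded as a function of sets \<open>T\<close> of elements: its value at a transversal \<open>T\<close> is the value of \<open>g\<close>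
  at the set of the classes that \<open>T\<close> misses, so that \<open>T\<close> marks the negative circles; all other values are 0.  This
  encoding turns the effect of a resmoothing on the signs of all circles into simple operators.
\<close>

definition transversal :: "('a \<times> 'a) set \<Rightarrow> 'a set \<Rightarrow> bool" where
  "transversal E T \<longleftrightarrow> (\<forall>x\<in>T. \<forall>y\<in>T. (x, y) \<in> E \<longrightarrow> x = y)"

definition missed :: "'a set \<Rightarrow> ('a \<times> 'a) set \<Rightarrow> 'a set \<Rightarrow> 'a set set" where
  "missed A E T = {C \<in> A // E. C \<inter> T = {}}"

definition at_transversal :: "'a set \<Rightarrow> ('a \<times> 'a) set \<Rightarrow> ('a set set \<Rightarrow> int) \<Rightarrow> 'a set \<Rightarrow> int" where
  "at_transversal A E g T = (if transversal E T then g (missed A E T) else 0)"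

text \<open>
  This operator is dual to multiplication by a variable \<open>X\<close> with \<open>X\<^sup>2 = 0\<close> that is attached to \<open>p\<close>.
\<close>

definition mult_X :: "'a \<Rightarrow> ('a set \<Rightarrow> int) \<Rightarrow> 'a set \<Rightarrow> int" where
  "mult_X p \<phi> T = (if p \<in> T then 0 else \<phi> (insert p T))"

lemma transversal_insert:
  assumes "equiv UNIV E" "x \<notin> T"
  shows "transversal E (insert x T) \<longleftrightarrow> transversal E T \<and> E `` {x} \<inter> T = {}"
proof -
  have "transversal E (insert x T) \<longleftrightarrow>
      transversal E T \<and> (\<forall>y\<in>T. (x, y) \<notin> E) \<and> (\<forall>y\<in>T. (y, x) \<notin> E)"
    using assms(2) unfolding transversal_def by (simp add: ball_conj_distrib) blast
  moreover have "(\<forall>y\<in>T. (y, x) \<notin> E) \<longleftrightarrow> (\<forall>y\<in>T. (x, y) \<notin> E)"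
    using equivD(2)[OF assms(1)] by blast
  ultimately show ?thesis by blast
qed

lemma class_of_member:
  assumes "equiv UNIV E" "C \<in> A // E" "x \<in> C"
  shows "C = E `` {x}"
  using assms(2,3) equiv_class_eq[OF assms(1)] by (auto simp: quotient_def)

lemma missed_insert:
  assumes "equiv UNIV E"
  shows "missed A E (insert x T) = missed A E T - {E `` {x}}"
proof -
  have "x \<in> C \<longleftrightarrow> C = E `` {x}" if "C \<in> A // E" for C
    using class_of_member[OF assms that] equivD(1)[OF assms, of x] by blast
  then show ?thesis by (auto simp: missed_def)
qed

text \<open>
  One element of each class outside \<open>P\<close>.
\<close>

lemma exists_transversal:
  assumes E: "equiv UNIV E" and P: "P \<subseteq> A // E" and closed: "E `` A \<subseteq> A"
  shows "\<exists>T\<subseteq>A. transversal E T \<and> missed A E T = P"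
proof -
  define rep where "rep C = (SOME x. x \<in> C)" for C :: "'a set"
  have rep: "rep C \<in> C \<and> E `` {rep C} = C" if C: "C \<in> A // E" for C
  proof -
    obtain x where x: "C = E `` {x}" using C by (auto simp: quotient_def)
    then have "x \<in> C" using equivD(1)[OF E, of x] by simp
    then have "rep C \<in> C" unfolding rep_def by (rule someI)
    then show ?thesis using class_of_member[OF E C] by simp
  qed
  let ?T = "rep ` (A // E - P)"
  have "C \<subseteq> A" if "C \<in> A // E" for C using that closed by (auto simp: quotient_def)
  then have "?T \<subseteq> A" using rep by blast
  moreover have "transversal E ?T"
    unfolding transversal_def
  proof (intro ballI impI)
    fix x y assume "x \<in> ?T" "y \<in> ?T" "(x, y) \<in> E"
    then obtain C C' where "C \<in> A // E" "C' \<in> A // E" "x = rep C" "y = rep C'" by blast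
    then show "x = y" using rep[of C] rep[of C'] equiv_class_eq[OF E \<open>(x, y) \<in> E\<close>] by simp
  qed
  moreover have "missed A E ?T = P"
  proof -
    have "C \<inter> ?T = {} \<longleftrightarrow> C \<in> P" if C: "C \<in> A // E" for C
    proof
      assume "C \<inter> ?T = {}"
      then show "C \<in> P" using rep[OF C] C by auto
    next
      assume "C \<in> P"
      show "C \<inter> ?T = {}"
      proof (rule ccontr)
        assume "C \<inter> ?T \<noteq> {}"
        then obtain C' where C': "C' \<in> A // E" "C' \<notin> P" "rep C' \<in> C" by auto
        then have "C' = C" using rep[OF C'(1)] class_of_member[OF E C C'(3)] by simp
        then show False using C' \<open>C \<in> P\<close> by simp
      qed
    qed
    then show ?thesis using P by (auto simp: missed_def)
  qed
  ultimately show ?thesis by blast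
qed

lemma Collect_restrict:
  assumes "\<And>P. Q P \<Longrightarrow> P \<in> S" "\<And>P. P \<in> S \<Longrightarrow> U P \<and> Q P"
  shows "{P. U P \<and> Q P \<and> R P} = {P \<in> S. R P}"
  using assms by blast

lemma filter_insert: "{R \<in> insert a S. Q R} = (if Q a then insert a {R \<in> S. Q R} else {R \<in> S. Q R})"
  by auto

text \<open>
  Two different classes of \<open>E\<close> become one class of \<open>E'\<close>.
\<close>

locale merged_classes =
  fixes A :: "'a set" and E :: "('a \<times> 'a) set" and p q :: 'a
  assumes equiv: "equiv UNIV E" and finite: "finite A" and closed: "E `` A \<subseteq> A"
    and p: "p \<in> A" and q: "q \<in> A" and separate: "(p, q) \<notin> E"
begin

abbreviation "Cp \<equiv> E `` {p}"
abbreviation "Cq \<equiv> E `` {q}"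
abbreviation "Cpq \<equiv> Cp \<union> Cq"
abbreviation "E' \<equiv> join_classes E p q"

lemmas E = equivD[OF equiv]
lemmas E' = equivD[OF equiv_join_classes[OF equiv]]

lemma merged_class: "E' `` {x} = (if x \<in> Cpq then Cpq else E `` {x})"
proof -
  have "(x, y) \<in> E' \<longleftrightarrow> y \<in> Cpq" if "x \<in> Cpq" for y
  proof -
    have "(p, x) \<in> E \<and> (x, p) \<in> E \<or> (q, x) \<in> E \<and> (x, q) \<in> E" using that E(2) by blast
    then show ?thesis unfolding join_classes_def by (auto dest: E(3))
  qed
  moreover have "(x, y) \<in> E' \<longleftrightarrow> (x, y) \<in> E" if "x \<notin> Cpq" for y
  proof -
    have "(x, p) \<notin> E" "(x, q) \<notin> E" using that E(2) by blast+
    then show ?thesis unfolding join_classes_def by simp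
  qed
  ultimately show ?thesis by auto
qed

lemma p_class: "p \<in> Cp" and q_class: "q \<in> Cq" using E(1) by auto

lemma Cp_Cq_disjoint: "Cp \<inter> Cq = {}"
proof -
  have "False" if "(p, x) \<in> E" "(q, x) \<in> E" for x
    using separate E(3)[OF that(1) E(2)[OF that(2)]] by simp
  then show ?thesis by blast
qed

lemma class_eq: "x \<in> Cp \<Longrightarrow> E `` {x} = Cp" "x \<in> Cq \<Longrightarrow> E `` {x} = Cq"
  using equiv_class_eq[OF equiv, of p x] equiv_class_eq[OF equiv, of q x] by simp_all

lemma merged_quotient: "A // E' = (A // E - {Cp, Cq}) \<union> {Cpq}"
proof -
  have "E `` {x} \<noteq> Cp" "E `` {x} \<noteq> Cq" if "x \<notin> Cpq" for x
    using that E(1)[of x] by blast+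
  then have "E' `` {x} \<in> (A // E - {Cp, Cq}) \<union> {Cpq}" if "x \<in> A" for x
    using that by (simp add: merged_class quotientI)
  moreover have "E `` {x} \<in> A // E'" if "x \<in> A" "E `` {x} \<noteq> Cp" "E `` {x} \<noteq> Cq" for x
  proof -
    have "x \<notin> Cpq" using that class_eq by blast
    then show ?thesis using quotientI[OF that(1), of E'] by (simp add: merged_class)
  qed
  moreover have "Cpq \<in> A // E'"
    using quotientI[OF p, of E'] p_class by (simp add: merged_class)
  ultimately show ?thesis
    by (intro equalityI subsetI) (auto elim!: quotientE intro: quotientI)
qed

lemma Cp_in: "Cp \<in> A // E" and Cq_in: "Cq \<in> A // E"
  using p q by (auto simp: quotient_def)

lemma Cp_neq_Cq: "Cp \<noteq> Cq" using p_class Cp_Cq_disjoint by blast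

lemma Cpq_not_in: "Cpq \<notin> A // E"
proof
  assume "Cpq \<in> A // E"
  then obtain x where "Cpq = E `` {x}" by (auto simp: quotient_def)
  then have xpq: "(x, p) \<in> E" "(x, q) \<in> E" using p_class q_class by blast+
  show False using E(3)[OF E(2)[OF xpq(1)] xpq(2)] separate by simp
qed

lemma finite_quotients: "finite (A // E)" "finite (A // E')"
  using finite unfolding quotient_def by auto

lemma card_merged_quotient: "card (A // E) = Suc (card (A // E'))"
proof -
  have "card (A // E') = Suc (card (A // E - {Cp, Cq}))"
    unfolding merged_quotient using Cpq_not_in finite_quotients(1) by (simp add: card_insert_if)
  also have "card (A // E - {Cp, Cq}) = card (A // E) - 2"
    using Cp_in Cq_in Cp_neq_Cq by (simp add: card_Diff_subset)
  moreover have "card {Cp, Cq} \<le> card (A // E)"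
    using Cp_in Cq_in by (intro card_mono finite_quotients) auto
  ultimately show ?thesis using Cp_neq_Cq by simp
qed

lemma merged_missed:
  "missed A E' T = (missed A E T - {Cp, Cq}) \<union> (if Cpq \<inter> T = {} then {Cpq} else {})"
  unfolding missed_def merged_quotient using Cpq_not_in by auto

lemma merged_transversal:
  "transversal E' T \<longleftrightarrow> transversal E T \<and> (Cp \<inter> T = {} \<or> Cq \<inter> T = {})"
proof -
  have "(x, y) \<in> E' \<longleftrightarrow> (x, y) \<in> E \<or> x \<in> Cp \<and> y \<in> Cq \<or> x \<in> Cq \<and> y \<in> Cp" for x y
  proof -
    have "(x, p) \<in> E \<longleftrightarrow> (p, x) \<in> E" "(x, q) \<in> E \<longleftrightarrow> (q, x) \<in> E" using E(2) by blast+
    then show ?thesis unfolding join_classes_def by auto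
  qed
  then show ?thesis using Cp_Cq_disjoint unfolding transversal_def by blast
qed

text \<open>
  The signs before a merge that lead to the signs \<open>P'\<close> after it: the other circles keep their signs, and the number
  of positive circles is preserved, because the number of circles drops by one and \<open>\<tau>\<close> grows by one.
\<close>

lemma merge_preimages:
  assumes "P' \<subseteq> A // E'"
  shows "{P. P \<subseteq> A // E \<and> P - {Cp, Cq} = P' - {Cpq} \<and> card P' = card P} =
    (if Cpq \<in> P' then {insert Cp (P' - {Cpq}), insert Cq (P' - {Cpq})} else {P'})"
proof -
  let ?Q = "P' - {Cpq}"
  have Q: "finite ?Q" "Cp \<notin> ?Q" "Cq \<notin> ?Q" "?Q \<subseteq> A // E"
    using assms finite_subset[OF assms finite_quotients(2)] merged_quotient Cpq_not_in Cp_in Cq_in by auto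
  have card_P': "card P' = card ?Q + (if Cpq \<in> P' then 1 else 0)"
    using card_Suc_Diff1[OF finite_subset[OF assms finite_quotients(2)], of Cpq] by auto
  have sub: "P = ?Q \<or> P = insert Cp ?Q \<or> P = insert Cq ?Q \<or> P = insert Cp (insert Cq ?Q)"
    if "P - {Cp, Cq} = ?Q" for P
    unfolding that[symmetric] by (cases "Cp \<in> P"; cases "Cq \<in> P") blast+
  have cards: "card (insert Cp ?Q) = Suc (card ?Q)" "card (insert Cq ?Q) = Suc (card ?Q)"
    "card (insert Cp (insert Cq ?Q)) = Suc (Suc (card ?Q))"
    using Q Cp_neq_Cq by simp_all
  have diffs: "insert Cp ?Q - {Cp, Cq} = ?Q" "insert Cq ?Q - {Cp, Cq} = ?Q" "?Q - {Cp, Cq} = ?Q"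
    using Q by auto
  let ?S = "{?Q, insert Cp ?Q, insert Cq ?Q, insert Cp (insert Cq ?Q)}"
  have "P \<in> ?S" if "P - {Cp, Cq} = ?Q" for P using sub[OF that] by simp
  moreover have "R \<subseteq> A // E \<and> R - {Cp, Cq} = ?Q" if "R \<in> ?S" for R
    using that diffs Q(4) Cp_in Cq_in by (elim insertE) (simp_all add: insert_Diff_if)
  ultimately have "{P. P \<subseteq> A // E \<and> P - {Cp, Cq} = ?Q \<and> card P' = card P} = {R \<in> ?S. card P' = card R}"
    by (rule Collect_restrict)
  also have "\<dots> = (if Cpq \<in> P' then {insert Cp ?Q, insert Cq ?Q} else {?Q})"
  proof (cases "Cpq \<in> P'")
    case True
    then have "card P' \<noteq> card ?Q" "card P' = card (insert Cp ?Q)" "card P' = card (insert Cq ?Q)"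
      "card P' \<noteq> card (insert Cp (insert Cq ?Q))" using card_P' cards by simp_all
    then show ?thesis using True
      by (simp only: filter_insert if_True if_False simp_thms refl empty_iff Collect_empty_eq) simp
  next
    case False
    then have "card P' = card ?Q" "card P' \<noteq> card (insert Cp ?Q)" "card P' \<noteq> card (insert Cq ?Q)"
      "card P' \<noteq> card (insert Cp (insert Cq ?Q))" using card_P' cards by simp_all
    then show ?thesis using False
      by (simp only: filter_insert if_True if_False simp_thms refl empty_iff Collect_empty_eq) simp
  qed
  also have "\<dots> = (if Cpq \<in> P' then {insert Cp ?Q, insert Cq ?Q} else {P'})" by simp
  finally show ?thesis .
qed

text \<open>
  In a split both the number of circles and \<open>\<tau>\<close> grow by one, so there is one more positive circle.
\<close>

lemma split_preimages:
  assumes "P' \<subseteq> A // E"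
  shows "{P. P \<subseteq> A // E' \<and> P - {Cpq} = P' - {Cp, Cq} \<and> card P' = Suc (card P)} =
    (if Cp \<in> P' \<and> Cq \<in> P' then {insert Cpq (P' - {Cp, Cq})}
     else if Cp \<in> P' \<or> Cq \<in> P' then {P' - {Cp, Cq}} else {})"
proof -
  let ?Q = "P' - {Cp, Cq}"
  have Q: "finite ?Q" "Cpq \<notin> ?Q" "?Q \<subseteq> A // E'"
    using assms finite_subset[OF assms finite_quotients(1)] merged_quotient Cpq_not_in by auto
  have fin: "finite P'" by (rule finite_subset[OF assms finite_quotients(1)])
  have card_P': "card P' = card ?Q + ((if Cp \<in> P' then 1 else 0) + (if Cq \<in> P' then 1 else 0))"
  proof -
    have "card P' = card ?Q + card (P' \<inter> {Cp, Cq})"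
      using card_Int_Diff[OF fin, of "{Cp, Cq}"] by simp
    also have "card (P' \<inter> {Cp, Cq}) = (if Cp \<in> P' then 1 else 0) + (if Cq \<in> P' then 1 else 0)"
      using Cp_neq_Cq by (auto simp: Int_insert_right)
    finally show ?thesis .
  qed
  have sub: "P = ?Q \<or> P = insert Cpq ?Q" if "P - {Cpq} = ?Q" for P
    unfolding that[symmetric] by blast
  have card_ins: "card (insert Cpq ?Q) = Suc (card ?Q)" using Q by simp
  have diffs: "insert Cpq ?Q - {Cpq} = ?Q" "?Q - {Cpq} = ?Q" using Q by auto
  have ins: "insert Cpq ?Q \<subseteq> A // E'" using Q by (auto simp: merged_quotient)
  have "P \<in> {?Q, insert Cpq ?Q}" if "P - {Cpq} = ?Q" for P using sub[OF that] by simp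
  moreover have "R \<subseteq> A // E' \<and> R - {Cpq} = ?Q" if "R \<in> {?Q, insert Cpq ?Q}" for R
    using that diffs ins Q(3) by (elim insertE) simp_all
  ultimately have "{P. P \<subseteq> A // E' \<and> P - {Cpq} = ?Q \<and> card P' = Suc (card P)} =
      {P \<in> {?Q, insert Cpq ?Q}. card P' = Suc (card P)}"
    by (rule Collect_restrict)
  also have "\<dots> = (if Cp \<in> P' \<and> Cq \<in> P' then {insert Cpq ?Q}
     else if Cp \<in> P' \<or> Cq \<in> P' then {?Q} else {})"
  proof -
    have "card P' = Suc (card ?Q) \<longleftrightarrow> (Cp \<in> P') \<noteq> (Cq \<in> P')"
      "card P' = Suc (card (insert Cpq ?Q)) \<longleftrightarrow> Cp \<in> P' \<and> Cq \<in> P'"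
      using card_ins card_P' by simp_all
    then show ?thesis by (cases "Cp \<in> P'"; cases "Cq \<in> P'") (simp_all only: filter_insert simp_thms if_True if_False, simp_all)
  qed
  finally show ?thesis .
qed

text \<open>
  A merge multiplies by the sum of the two variables.  If \<open>T\<close> misses the united class, the two summands are the two ways
  to give it a positive sign.  If \<open>T\<close> meets one of the two classes, only the other summand survives.
\<close>

lemma at_transversal_merge:
  "at_transversal A E'
     (\<lambda>P'. \<Sum>P | P \<subseteq> A // E \<and> P - {Cp, Cq} = P' - {Cpq} \<and> card P' = card P. g P) T =
   mult_X p (at_transversal A E g) T + mult_X q (at_transversal A E g) T"
proof -
  have M: "missed A E' T \<subseteq> A // E'" by (auto simp: missed_def)
  have ins: "transversal E (insert x T) \<longleftrightarrow> transversal E T \<and> E `` {x} \<inter> T = {}" if "x \<notin> T" for x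
    using transversal_insert[OF equiv that] .
  have hit: "x \<in> T \<Longrightarrow> E `` {x} \<inter> T \<noteq> {}" for x using E(1) by blast
  have Cp_miss: "Cp \<in> missed A E T \<longleftrightarrow> Cp \<inter> T = {}" and Cq_miss: "Cq \<in> missed A E T \<longleftrightarrow> Cq \<inter> T = {}"
    using Cp_in Cq_in by (auto simp: missed_def)
  have Cpq_miss: "Cpq \<notin> missed A E T" using Cpq_not_in by (auto simp: missed_def)
  consider "\<not> transversal E T" | "transversal E T" "Cp \<inter> T \<noteq> {}" "Cq \<inter> T \<noteq> {}"
    | "transversal E T" "Cp \<inter> T \<noteq> {}" "Cq \<inter> T = {}" | "transversal E T" "Cp \<inter> T = {}" "Cq \<inter> T \<noteq> {}"
    | "transversal E T" "Cp \<inter> T = {}" "Cq \<inter> T = {}" by blast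
  then show ?thesis
  proof cases
    case 1
    then show ?thesis using ins by (auto simp: at_transversal_def mult_X_def merged_transversal)
  next
    case 2
    then show ?thesis using ins by (auto simp: at_transversal_def mult_X_def merged_transversal)
  next
    case 3
    then have "missed A E' T = missed A E (insert q T)" "Cpq \<notin> missed A E' T"
      unfolding missed_insert[OF equiv] merged_missed using Cp_miss Cq_miss Cpq_miss by auto
    moreover have "q \<notin> T" using 3 hit by blast
    ultimately show ?thesis
      using 3 ins merge_preimages[OF M] by (simp add: at_transversal_def mult_X_def merged_transversal)
  next
    case 4
    then have "missed A E' T = missed A E (insert p T)" "Cpq \<notin> missed A E' T"
      unfolding missed_insert[OF equiv] merged_missed using Cp_miss Cq_miss Cpq_miss by auto
    moreover have "p \<notin> T" using 4 hit by blast
    ultimately show ?thesis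
      using 4 ins merge_preimages[OF M] by (simp add: at_transversal_def mult_X_def merged_transversal)
  next
    case 5
    then have "Cpq \<inter> T = {}" by blast
    then have *: "missed A E' T - {Cpq} = missed A E T - {Cp, Cq}" "Cpq \<in> missed A E' T"
      unfolding merged_missed using Cpq_miss by auto
    have "missed A E (insert p T) = insert Cq (missed A E' T - {Cpq})"
      "missed A E (insert q T) = insert Cp (missed A E' T - {Cpq})"
      unfolding missed_insert[OF equiv] * using Cp_miss Cq_miss 5 Cp_neq_Cq by auto
    moreover have "insert Cp (missed A E' T - {Cpq}) \<noteq> insert Cq (missed A E' T - {Cpq})"
      unfolding * using Cp_neq_Cq by blast
    moreover have "p \<notin> T" "q \<notin> T" using 5 hit by blast+
    ultimately show ?thesis
      using 5 ins merge_preimages[OF M] *(2)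
      by (simp add: at_transversal_def mult_X_def merged_transversal)
  qed
qed

text \<open>
  A split does not change the function at all: a transversal of the finer relation that meets both classes is not a
  transversal of the coarser one.
\<close>

lemma at_transversal_split:
  "at_transversal A E
     (\<lambda>P'. \<Sum>P | P \<subseteq> A // E' \<and> P - {Cpq} = P' - {Cp, Cq} \<and> card P' = Suc (card P). g P) T =
   at_transversal A E' g T"
proof -
  have M: "missed A E T \<subseteq> A // E" by (auto simp: missed_def)
  have "Cp \<in> missed A E T \<longleftrightarrow> Cp \<inter> T = {}" "Cq \<in> missed A E T \<longleftrightarrow> Cq \<inter> T = {}"
    using Cp_in Cq_in by (auto simp: missed_def)
  moreover have "Cpq \<inter> T = {} \<longleftrightarrow> Cp \<inter> T = {} \<and> Cq \<inter> T = {}" by blast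
  ultimately show ?thesis
    unfolding at_transversal_def split_preimages[OF M] merged_transversal merged_missed by auto
qed

end

section \<open>The differential evaluated at transversals\<close>

type_synonym 'a int_chain = "'a enhanced_state \<Rightarrow> int"

definition later_negatives :: "bool list \<Rightarrow> nat \<Rightarrow> nat" where
  "later_negatives s c = card {k. c < k \<and> k < length s \<and> \<not> s ! k}"

text \<open>
  The entries of the differential in all bidegrees at once; if \<open>\<sigma>\<close> drops by 2, then \<open>j\<close> is preserved if and only
  if \<open>\<tau>\<close> grows by 1.
\<close>

definition incidence_number :: "'a diagram \<Rightarrow> 'a enhanced_state \<Rightarrow> 'a enhanced_state \<Rightarrow> int" where
  "incidence_number D S S' =
     (if S \<in> enhanced_states D \<and> S' \<in> enhanced_states D \<and>
         state_sigma S' = state_sigma S - 2 \<and> state_tau D S' = state_tau D S + 1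
      then (-1) ^ sign_exponent D S S' * incidence D S S' else 0)"

definition int_differential :: "'a diagram \<Rightarrow> 'a int_chain \<Rightarrow> 'a int_chain" where
  "int_differential D f = (\<lambda>S'. \<Sum>S\<in>enhanced_states D. incidence_number D S S' * f S)"

text \<open>
  Multiplication by the variable of the circle through the arc \<open>e\<close>.
\<close>

definition multiplication_by_X :: "'a diagram \<Rightarrow> 'a \<Rightarrow> 'a int_chain \<Rightarrow> 'a int_chain" where
  "multiplication_by_X D e f = (\<lambda>(s, P).
     if same_circle D s `` {e} \<in> P then f (s, P - {same_circle D s `` {e}}) else 0)"

definition evaluation :: "'a diagram \<Rightarrow> 'a int_chain \<Rightarrow> bool list \<Rightarrow> 'a set \<Rightarrow> int" where
  "evaluation D f s = at_transversal (arcs D) (same_circle D s) (\<lambda>P. f (s, P))"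

text \<open>
  The effect of changing the marker of \<open>c\<close> in \<open>s\<close> from positive to negative.  If the two under-strand ends lie on
  the same circle of \<open>s\<close>, this circle is split, otherwise two circles are merged.
\<close>

definition resmoothing_map :: "'a diagram \<Rightarrow> nat \<Rightarrow> bool list \<Rightarrow> ('a set \<Rightarrow> int) \<Rightarrow> 'a set \<Rightarrow> int" where
  "resmoothing_map D c s \<phi> T =
     (if (opposite_a D c, opposite_c D c) \<in> same_circle D s then \<phi> T
      else mult_X (opposite_a D c) \<phi> T + mult_X (opposite_c D c) \<phi> T)"

lemma filter_marker_update:
  assumes "c < length s" "\<not> s ! c"
  shows "length (filter (\<lambda>m. m) (s[c := True])) = Suc (length (filter (\<lambda>m. m) s))"
    "length (filter Not s) = Suc (length (filter Not (s[c := True])))"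
proof -
  have s: "s = take c s @ False # drop (Suc c) s"
    using id_take_nth_drop[OF assms(1)] assms(2) by simp
  have s': "s[c := True] = take c s @ True # drop (Suc c) s"
    using upd_conv_take_nth_drop[OF assms(1)] by simp
  show "length (filter (\<lambda>m. m) (s[c := True])) = Suc (length (filter (\<lambda>m. m) s))"
    unfolding s' by (subst (3) s) simp
  show "length (filter Not s) = Suc (length (filter Not (s[c := True])))"
    unfolding s' by (subst s) simp
qed

lemma state_sigma_update:
  assumes "c < length s" "\<not> s ! c"
  shows "state_sigma (s[c := True], P) = state_sigma (s, P') + 2"
  using filter_marker_update[OF assms] by (simp add: state_sigma_def)

lemma same_circle_equiv: "equiv UNIV (same_circle D s)"
  unfolding same_circle_def by (rule equiv_generated)

lemma at_transversal_cong:
  assumes "\<And>P. P \<subseteq> A // E \<Longrightarrow> g P = h P"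
  shows "at_transversal A E g T = at_transversal A E h T"
  using assms[of "missed A E T"] by (auto simp: at_transversal_def missed_def)

lemma mult_X_commute: "mult_X p (mult_X q \<phi>) T = mult_X q (mult_X p \<phi>) T"
  by (auto simp: mult_X_def insert_commute)

lemma mult_X_add: "mult_X p (\<lambda>T. \<phi> T + \<psi> T) T = mult_X p \<phi> T + mult_X p \<psi> T"
  by (simp add: mult_X_def)

lemma mult_X_sum: "mult_X p (\<lambda>T. \<Sum>i\<in>I. a i * \<phi> i T) T = (\<Sum>i\<in>I. a i * mult_X p (\<phi> i) T)"
  by (simp add: mult_X_def)

lemma resmoothing_map_sum:
  "resmoothing_map D c s (\<lambda>T. \<Sum>i\<in>I. a i * \<phi> i T) T = (\<Sum>i\<in>I. a i * resmoothing_map D c s (\<phi> i) T)"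
  by (simp add: resmoothing_map_def mult_X_sum sum.distrib distrib_left)

text \<open>
  Only the circle of the arc matters for the action of a variable on encoded functions.
\<close>

lemma mult_X_same_class:
  assumes E: "equiv UNIV E" and xy: "(x, y) \<in> E"
  shows "mult_X x (at_transversal A E g) T = mult_X y (at_transversal A E g) T"
proof -
  have cl: "E `` {x} = E `` {y}" by (rule equiv_class_eq[OF E xy])
  have "x \<in> E `` {y}" "y \<in> E `` {x}" using xy equivD(2)[OF E xy] by simp_all
  then show ?thesis
    using cl transversal_insert[OF E, of x T] transversal_insert[OF E, of y T]
    by (auto simp: mult_X_def at_transversal_def missed_insert[OF E])
qed

lemma evaluation_multiplication_by_X:
  assumes "e \<in> arcs D"
  shows "evaluation D (multiplication_by_X D e f) s T = mult_X e (evaluation D f s) T"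
proof -
  let ?E = "same_circle D s"
  have E: "equiv UNIV ?E" by (rule same_circle_equiv)
  have "?E `` {e} \<in> missed (arcs D) ?E T \<longleftrightarrow> ?E `` {e} \<inter> T = {}"
    using assms by (auto simp: missed_def quotient_def)
  moreover have "e \<in> ?E `` {e}" using equivD(1)[OF E] by simp
  ultimately show ?thesis
    using transversal_insert[OF E, of e T]
    by (auto simp: evaluation_def at_transversal_def mult_X_def multiplication_by_X_def missed_insert[OF E])
qed

text \<open>
  All that the Khovanov complex needs of a planar diagram: a change of marker always merges two circles or splits
  one.
\<close>

locale resmoothable =
  fixes D :: "'a diagram"
  assumes finite_arcs: "finite (arcs D)"
    and crossing: "x \<in> set (crossings D) \<Longrightarrow> length x = 4 \<and> set x \<subseteq> arcs D"
    and resmoothing: "c < length (crossings D) \<Longrightarrow> length s = length (crossings D) \<Longrightarrow>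
      (opposite_a D c, opposite_c D c) \<notin> same_circle D (s[c := True]) \<and>
        same_circle D (s[c := False]) =
          join_classes (same_circle D (s[c := True])) (opposite_a D c) (opposite_c D c) \<or>
      (opposite_a D c, opposite_c D c) \<notin> same_circle D (s[c := False]) \<and>
        same_circle D (s[c := True]) =
          join_classes (same_circle D (s[c := False])) (opposite_a D c) (opposite_c D c)"
begin

abbreviation "n \<equiv> length (crossings D)"
abbreviation "A \<equiv> arcs D"
abbreviation "E \<equiv> same_circle D"
abbreviation "pa \<equiv> opposite_a D"
abbreviation "pc \<equiv> opposite_c D"

lemma crossing_nth: "c < n \<Longrightarrow> length (crossings D ! c) = 4 \<and> set (crossings D ! c) \<subseteq> A"
  using crossing by simp

lemma same_circle_arcs: "(x, y) \<in> E s \<Longrightarrow> x = y \<or> x \<in> A \<and> y \<in> A"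
proof -
  have "smoothing_rel D s \<subseteq> A \<times> A"
  proof -
    have "smoothing (crossings D ! c) m \<subseteq> A \<times> A" if "c < n" for c m
    proof -
      have "crossings D ! c ! k \<in> A" if "k < 4" for k
        using crossing_nth[OF \<open>c < n\<close>] that by (metis nth_mem subsetD)
      then show ?thesis using crossing_nth[OF that] by (simp add: smoothing_length_4)
    qed
    then show ?thesis unfolding smoothing_rel_def by blast
  qed
  moreover have "equiv UNIV {(x, y). x = y \<or> x \<in> A \<and> y \<in> A}"
    by (intro equivI) (auto simp: refl_on_def sym_def trans_def)
  ultimately have "E s \<subseteq> {(x, y). x = y \<or> x \<in> A \<and> y \<in> A}"
    unfolding same_circle_def by (intro generated_least) auto
  then show "(x, y) \<in> E s \<Longrightarrow> x = y \<or> x \<in> A \<and> y \<in> A" by auto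
qed

lemma closed: "E s `` A \<subseteq> A" using same_circle_arcs by blast

lemma opposite_arcs: "c < n \<Longrightarrow> pa c \<in> A" "c < n \<Longrightarrow> pc c \<in> A"
  using crossing_nth[of c] by (auto simp: opposite_a_def opposite_c_def subset_iff)

lemma finite_circles: "finite (circles D s)"
  using finite_arcs unfolding circles_altdef quotient_def by auto

lemma finite_enhanced_states: "finite (enhanced_states D)"
proof -
  have "enhanced_states D = Sigma {s. length s = n} (\<lambda>s. Pow (circles D s))"
    by (auto simp: enhanced_states_def kauffman_states_def)
  moreover have "finite {s :: bool list. length s = n}"
    using finite_lists_length_eq[of "UNIV :: bool set" n] by simp
  ultimately show ?thesis using finite_circles by simp
qed

lemma enhanced_state_iff: "(s, P) \<in> enhanced_states D \<longleftrightarrow> length s = n \<and> P \<subseteq> circles D s"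
  by (simp add: enhanced_states_def kauffman_states_def)

lemma state_tau_eq: "P \<subseteq> circles D s \<Longrightarrow> state_tau D (s, P) = 2 * int (card P) - int (card (circles D s))"
  using card_mono[OF finite_circles, of P s]
  by (simp add: state_tau_def card_Diff_subset finite_subset[OF _ finite_circles] of_nat_diff)

text \<open>
  The signs \<open>P\<close> of the enhanced states whose differential contains \<open>(s', P')\<close> through a change of the marker of \<open>c\<close>.
\<close>

definition previous_signs :: "bool list \<Rightarrow> nat \<Rightarrow> 'a set set \<Rightarrow> 'a set set set" where
  "previous_signs s' c P' = {P. P \<subseteq> circles D (s'[c := True]) \<and>
     (\<forall>C\<in>circles D (s'[c := True]) \<union> circles D s'. \<not> touches D C c \<longrightarrow> (C \<in> P \<longleftrightarrow> C \<in> P')) \<and>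
     state_tau D (s', P') = state_tau D (s'[c := True], P) + 1}"

lemma differ_exactly_at_update:
  assumes "c < n" "length s' = n" "\<not> s' ! c"
  shows "differ_exactly_at D c' (s'[c := True], P) (s', P') \<longleftrightarrow> c' = c"
proof -
  have "{k. k < n \<and> s'[c := True] ! k \<noteq> s' ! k} = {c}"
    using assms by (auto simp: nth_list_update)
  then show ?thesis by (auto simp: differ_exactly_at_def)
qed

lemma incidence_number_update:
  assumes "c < n" "length s' = n" "\<not> s' ! c" "P' \<subseteq> circles D s'" "P \<subseteq> circles D (s'[c := True])"
  shows "incidence_number D (s'[c := True], P) (s', P') =
    (if P \<in> previous_signs s' c P' then (-1) ^ later_negatives s' c else 0)"
proof -
  have "{k. c < k \<and> k < n \<and> \<not> s'[c := True] ! k} = {k. c < k \<and> k < length s' \<and> \<not> s' ! k}"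
    using assms by auto
  moreover have "state_sigma (s', P') = state_sigma (s'[c := True], P) - 2"
    using state_sigma_update[of c s' P P'] assms by simp
  ultimately show ?thesis
    using assms
    by (simp add: incidence_number_def enhanced_state_iff incidence_def sign_exponent_def
        differ_exactly_at_update later_negatives_def previous_signs_def) blast
qed

lemma incidence_number_nonzero:
  assumes "incidence_number D (s, P) (s', P') \<noteq> 0"
  shows "\<exists>c<n. \<not> s' ! c \<and> s = s'[c := True]"
proof -
  have *: "length s = n" "length s' = n" "state_sigma (s', P') = state_sigma (s, P) - 2" "incidence D (s, P) (s', P') \<noteq> 0"
    using assms by (auto simp: incidence_number_def enhanced_state_iff split: if_splits)
  then obtain c where c: "{k. k < n \<and> s ! k \<noteq> s' ! k} = {c}"
    by (auto simp: incidence_def differ_exactly_at_def split: if_splits)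
  have cn: "c < n" "s ! c \<noteq> s' ! c" using c by blast+
  have upd: "s = s'[c := s ! c]" "s' = s[c := s' ! c]"
  proof -
    have "s ! k = s' ! k" if "k < n" "k \<noteq> c" for k using c that by blast
    then show "s = s'[c := s ! c]" "s' = s[c := s' ! c]"
      using * cn(1) by (simp_all add: list_eq_iff_nth_eq nth_list_update)
  qed
  show ?thesis
  proof (cases "s' ! c")
    case True
    then have "s' = s[c := True]" "\<not> s ! c" using upd(2) cn by auto
    then have "state_sigma (s', P') = state_sigma (s, P) + 2"
      using state_sigma_update[of c s P' P] cn * by simp
    then show ?thesis using * by simp
  next
    case False
    then show ?thesis using upd(1) cn by auto
  qed
qed

abbreviation "negatives s \<equiv> {c. c < n \<and> \<not> s ! c}"

lemma int_differential_eq: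
  assumes s': "length s' = n" and P': "P' \<subseteq> circles D s'"
  shows "int_differential D f (s', P') =
    (\<Sum>c\<in>negatives s'. (-1) ^ later_negatives s' c * (\<Sum>P\<in>previous_signs s' c P'. f (s'[c := True], P)))"
proof -
  let ?h = "\<lambda>(c, P). (s'[c := True], P)"
  let ?J = "Sigma (negatives s') (\<lambda>c. previous_signs s' c P')"
  have fin: "finite (previous_signs s' c P')" for c
    by (rule finite_subset[of _ "Pow (circles D (s'[c := True]))"])
      (auto simp: previous_signs_def finite_circles)
  have inj: "inj_on ?h ?J"
  proof (rule inj_onI)
    fix x y assume xy: "x \<in> ?J" "y \<in> ?J" "?h x = ?h y"
    obtain c P d Q where eq: "x = (c, P)" "y = (d, Q)" by fastforce
    then have *: "c < n" "\<not> s' ! c" "d < n" "\<not> s' ! d" "s'[c := True] = s'[d := True]" "P = Q"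
      using xy by auto
    have "s'[d := True] ! c" using *(1) s' by (simp flip: *(5))
    then have "c = d" using *(2) by (cases "c = d") simp_all
    then show "x = y" using eq * by simp
  qed
  have sub: "?h ` ?J \<subseteq> enhanced_states D"
    using s' by (auto simp: enhanced_state_iff previous_signs_def)
  have zero: "incidence_number D S (s', P') = 0" if "S \<in> enhanced_states D - ?h ` ?J" for S
  proof (rule ccontr)
    assume nz: "incidence_number D S (s', P') \<noteq> 0"
    obtain s P where S: "S = (s, P)" by (cases S)
    obtain c where c: "c < n" "\<not> s' ! c" "s = s'[c := True]"
      using incidence_number_nonzero nz S by blast
    have "P \<subseteq> circles D (s'[c := True])" using that S c by (auto simp: enhanced_state_iff)
    then have "P \<in> previous_signs s' c P'"
      using nz incidence_number_update[OF c(1) s' c(2) P'] S c(3) by (auto split: if_splits)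
    then have "S \<in> ?h ` ?J" using S c by force
    then show False using that by blast
  qed
  have "int_differential D f (s', P') = (\<Sum>S\<in>?h ` ?J. incidence_number D S (s', P') * f S)"
    unfolding int_differential_def
    by (rule sum.mono_neutral_right) (use finite_enhanced_states sub zero in auto)
  also have "\<dots> = (\<Sum>(c, P)\<in>?J. incidence_number D (s'[c := True], P) (s', P') * f (s'[c := True], P))"
    by (subst sum.reindex[OF inj]) (auto intro!: sum.cong)
  also have "\<dots> = (\<Sum>c\<in>negatives s'. \<Sum>P\<in>previous_signs s' c P'.
      incidence_number D (s'[c := True], P) (s', P') * f (s'[c := True], P))"
    by (rule sum.Sigma[symmetric]) (auto simp: fin)
  also have "\<dots> = (\<Sum>c\<in>negatives s'. \<Sum>P\<in>previous_signs s' c P'.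
      (-1) ^ later_negatives s' c * f (s'[c := True], P))"
  proof (intro sum.cong refl)
    fix c P assume "c \<in> negatives s'" and P: "P \<in> previous_signs s' c P'"
    then have "incidence_number D (s'[c := True], P) (s', P') = (-1) ^ later_negatives s' c"
      using incidence_number_update[of c s' P' P] s' P' by (auto simp: previous_signs_def)
    then show "incidence_number D (s'[c := True], P) (s', P') * f (s'[c := True], P) =
      (-1) ^ later_negatives s' c * f (s'[c := True], P)" by simp
  qed
  finally show ?thesis by (simp add: sum_distrib_left)
qed

lemma length_update_eq: "length s = n \<Longrightarrow> length (s[c := m]) = n" by simp

lemma pa_pc_labels: "c < n \<Longrightarrow> pa c \<in> set (crossings D ! c)" "c < n \<Longrightarrow> pc c \<in> set (crossings D ! c)"
  using crossing_nth[of c] by (auto simp: opposite_a_def opposite_c_def)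

text \<open>
  The circles that touch \<open>c\<close> are those through its two under-strand ends.
\<close>

lemma crossing_labels_cover:
  assumes "c < n"
  shows "set (crossings D ! c) \<subseteq> E s `` {pa c} \<union> E s `` {pc c}"
proof
  fix x assume "x \<in> set (crossings D ! c)"
  then obtain k where k: "k < 4" "x = crossings D ! c ! k"
    using crossing_nth[OF assms] by (metis in_set_conv_nth)
  have "smoothing (crossings D ! c) (s ! c) \<subseteq> E s"
    using assms unfolding same_circle_def smoothing_rel_def by blast
  then have sm: "if s ! c then (crossings D ! c ! 0, crossings D ! c ! 1) \<in> E s \<and> (crossings D ! c ! 2, crossings D ! c ! 3) \<in> E s
    else (crossings D ! c ! 0, crossings D ! c ! 3) \<in> E s \<and> (crossings D ! c ! 1, crossings D ! c ! 2) \<in> E s"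
    using smoothing_length_4[of "crossings D ! c" "s ! c"] crossing_nth[OF assms] by (cases "s ! c") simp_all
  note eq = equivD(1,2)[OF same_circle_equiv[of D s]]
  show "x \<in> E s `` {pa c} \<union> E s `` {pc c}"
    using k sm eq(2) eq(1)[of "pa c"] eq(1)[of "pc c"]
    by (cases "s ! c") (auto simp: opposite_a_def opposite_c_def less_4)
qed

lemma agree_outside_iff:
  assumes "P \<subseteq> X" "P' \<subseteq> (X - K) \<union> {m}" "m \<notin> X"
  shows "(\<forall>C\<in>X - K. C \<in> P \<longleftrightarrow> C \<in> P') \<longleftrightarrow> P - K = P' - {m}"
proof
  assume "\<forall>C\<in>X - K. C \<in> P \<longleftrightarrow> C \<in> P'"
  then show "P - K = P' - {m}" using assms by auto
next
  assume *: "P - K = P' - {m}"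
  show "\<forall>C\<in>X - K. C \<in> P \<longleftrightarrow> C \<in> P'"
  proof
    fix C assume "C \<in> X - K"
    then have eq: "C \<in> P \<longleftrightarrow> C \<in> P - K" "C \<in> P' \<longleftrightarrow> C \<in> P' - {m}" using assms(3) by auto
    show "C \<in> P \<longleftrightarrow> C \<in> P'" by (simp only: eq *)
  qed
qed

lemma touching_signs_agree:
  assumes "merged_classes (arcs D) F p q" "p \<in> L" "q \<in> L" "L \<subseteq> F `` {p} \<union> F `` {q}"
    and "P \<subseteq> A // F" "P' \<subseteq> A // join_classes F p q"
  shows "(\<forall>C\<in>A // F \<union> A // join_classes F p q. \<not> C \<inter> L \<noteq> {} \<longrightarrow> (C \<in> P \<longleftrightarrow> C \<in> P')) \<longleftrightarrow>
    P - {F `` {p}, F `` {q}} = P' - {F `` {p} \<union> F `` {q}}"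
proof -
  interpret merged_classes "arcs D" F p q by fact
  have touch: "C \<inter> L = {} \<longleftrightarrow> C \<noteq> Cp \<and> C \<noteq> Cq" if C: "C \<in> A // F" for C
  proof
    assume "C \<inter> L = {}"
    then show "C \<noteq> Cp \<and> C \<noteq> Cq" using assms(2,3) p_class q_class by blast
  next
    assume *: "C \<noteq> Cp \<and> C \<noteq> Cq"
    have "x \<notin> C" if "x \<in> L" for x
    proof
      assume "x \<in> C"
      then have Cx: "C = F `` {x}" by (rule class_of_member[OF equiv C])
      have "x \<in> Cp \<or> x \<in> Cq" using that assms(4) by blast
      then have "C = Cp \<or> C = Cq" unfolding Cx using class_eq by (elim disjE) simp_all
      then show False using * by simp
    qed
    then show "C \<inter> L = {}" by blast
  qed
  have "Cpq \<inter> L \<noteq> {}" using assms(2) p_class by blast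
  have "(\<forall>C\<in>A // F \<union> A // E'. \<not> C \<inter> L \<noteq> {} \<longrightarrow> (C \<in> P \<longleftrightarrow> C \<in> P')) \<longleftrightarrow>
    (\<forall>C\<in>A // F - {Cp, Cq}. C \<in> P \<longleftrightarrow> C \<in> P')"
    unfolding merged_quotient using touch \<open>Cpq \<inter> L \<noteq> {}\<close> by blast
  also have "\<dots> \<longleftrightarrow> P - {Cp, Cq} = P' - {Cpq}"
    by (rule agree_outside_iff[OF assms(5) assms(6)[unfolded merged_quotient] Cpq_not_in])
  finally show ?thesis .
qed

lemma merged_classesI:
  "c < n \<Longrightarrow> (pa c, pc c) \<notin> E s \<Longrightarrow> merged_classes A (E s) (pa c) (pc c)"
  by unfold_locales (use same_circle_equiv finite_arcs closed opposite_arcs in auto)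

lemma previous_signs_merge:
  assumes c: "c < n" and P': "P' \<subseteq> circles D s'" and sep: "(pa c, pc c) \<notin> E (s'[c := True])"
    and E': "E s' = join_classes (E (s'[c := True])) (pa c) (pc c)"
  defines "F \<equiv> E (s'[c := True])"
  shows "previous_signs s' c P' = {P. P \<subseteq> A // F \<and>
    P - {F `` {pa c}, F `` {pc c}} = P' - {F `` {pa c} \<union> F `` {pc c}} \<and> card P' = card P}"
proof -
  have m: "merged_classes A F (pa c) (pc c)" unfolding F_def by (rule merged_classesI[OF c sep])
  have circ: "circles D (s'[c := True]) = A // F" "circles D s' = A // join_classes F (pa c) (pc c)"
    by (simp_all add: circles_altdef F_def E')
  have tau: "state_tau D (s', P') = state_tau D (s'[c := True], P) + 1 \<longleftrightarrow> card P' = card P" if "P \<subseteq> A // F" for P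
    using state_tau_eq[OF P'] state_tau_eq[of P "s'[c := True]"] that merged_classes.card_merged_quotient[OF m]
    unfolding circ by auto
  show ?thesis
    unfolding previous_signs_def touches_def circ
  proof (intro Collect_cong conj_cong refl)
    fix P assume P: "P \<subseteq> A // F"
    show "(\<forall>C\<in>A // F \<union> A // join_classes F (pa c) (pc c). \<not> C \<inter> set (crossings D ! c) \<noteq> {} \<longrightarrow>
        (C \<in> P \<longleftrightarrow> C \<in> P')) \<longleftrightarrow> P - {F `` {pa c}, F `` {pc c}} = P' - {F `` {pa c} \<union> F `` {pc c}}"
      by (rule touching_signs_agree[OF m pa_pc_labels[OF c]
          crossing_labels_cover[OF c, of "s'[c := True]", folded F_def] P P'[unfolded circ]])
    show "state_tau D (s', P') = state_tau D (s'[c := True], P) + 1 \<longleftrightarrow> card P' = card P"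
      by (rule tau[OF P])
  qed
qed

lemma previous_signs_split:
  assumes c: "c < n" and P': "P' \<subseteq> circles D s'" and sep: "(pa c, pc c) \<notin> E s'"
    and E': "E (s'[c := True]) = join_classes (E s') (pa c) (pc c)"
  defines "F \<equiv> E s'"
  shows "previous_signs s' c P' = {P. P \<subseteq> A // join_classes F (pa c) (pc c) \<and>
    P - {F `` {pa c} \<union> F `` {pc c}} = P' - {F `` {pa c}, F `` {pc c}} \<and> card P' = Suc (card P)}"
proof -
  have m: "merged_classes A F (pa c) (pc c)" unfolding F_def by (rule merged_classesI[OF c sep])
  have circ: "circles D (s'[c := True]) = A // join_classes F (pa c) (pc c)" "circles D s' = A // F"
    by (simp_all add: circles_altdef F_def E')
  have tau: "state_tau D (s', P') = state_tau D (s'[c := True], P) + 1 \<longleftrightarrow> card P' = Suc (card P)"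
    if "P \<subseteq> A // join_classes F (pa c) (pc c)" for P
    using state_tau_eq[OF P'] state_tau_eq[of P "s'[c := True]"] that merged_classes.card_merged_quotient[OF m]
    unfolding circ by auto
  show ?thesis
    unfolding previous_signs_def touches_def circ
  proof (intro Collect_cong conj_cong refl)
    fix P assume P: "P \<subseteq> A // join_classes F (pa c) (pc c)"
    have "(\<forall>C\<in>A // F \<union> A // join_classes F (pa c) (pc c). \<not> C \<inter> set (crossings D ! c) \<noteq> {} \<longrightarrow>
        (C \<in> P' \<longleftrightarrow> C \<in> P)) \<longleftrightarrow> P' - {F `` {pa c}, F `` {pc c}} = P - {F `` {pa c} \<union> F `` {pc c}}"
      by (rule touching_signs_agree[OF m pa_pc_labels[OF c]
          crossing_labels_cover[OF c, of s', folded F_def] P'[unfolded circ] P])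
    then show "(\<forall>C\<in>A // join_classes F (pa c) (pc c) \<union> A // F. \<not> C \<inter> set (crossings D ! c) \<noteq> {} \<longrightarrow>
        (C \<in> P \<longleftrightarrow> C \<in> P')) \<longleftrightarrow> P - {F `` {pa c} \<union> F `` {pc c}} = P' - {F `` {pa c}, F `` {pc c}}"
      by (simp only: Un_commute[of "A // F"] eq_commute)
    show "state_tau D (s', P') = state_tau D (s'[c := True], P) + 1 \<longleftrightarrow> card P' = Suc (card P)"
      by (rule tau[OF P])
  qed
qed

lemma resmoothing_cases:
  assumes "c < n" "length s' = n" "\<not> s' ! c"
  obtains (merge) "(pa c, pc c) \<notin> E (s'[c := True])" "E s' = join_classes (E (s'[c := True])) (pa c) (pc c)"
  | (split) "(pa c, pc c) \<notin> E s'" "E (s'[c := True]) = join_classes (E s') (pa c) (pc c)"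
proof -
  have "s'[c := False] = s'" using assms by (metis list_update_id)
  then show thesis using resmoothing[OF assms(1,2)] merge split by auto
qed

text \<open>
  The two cases of the resmoothing are the two operations on transversals.
\<close>

lemma at_transversal_previous_signs:
  assumes c: "c < n" "length s' = n" "\<not> s' ! c"
  shows "at_transversal A (E s') (\<lambda>P'. \<Sum>P\<in>previous_signs s' c P'. f (s'[c := True], P)) T =
    resmoothing_map D c (s'[c := True]) (evaluation D f (s'[c := True])) T"
  using c
proof (cases rule: resmoothing_cases)
  case merge
  let ?F = "E (s'[c := True])"
  interpret merged_classes A ?F "pa c" "pc c" by (rule merged_classesI[OF c(1) merge(1)])
  have "at_transversal A (E s') (\<lambda>P'. \<Sum>P\<in>previous_signs s' c P'. f (s'[c := True], P)) T =
      at_transversal A (E s') (\<lambda>P'. \<Sum>P | P \<subseteq> A // ?F \<and>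
        P - {Cp, Cq} = P' - {Cpq} \<and> card P' = card P. f (s'[c := True], P)) T"
    by (intro at_transversal_cong) (simp only: previous_signs_merge[OF c(1) _ merge] circles_altdef)
  also have "\<dots> = mult_X (pa c) (evaluation D f (s'[c := True])) T + mult_X (pc c) (evaluation D f (s'[c := True])) T"
    unfolding merge(2) evaluation_def by (rule at_transversal_merge)
  finally show ?thesis using merge(1) by (simp add: resmoothing_map_def)
next
  case split
  let ?F = "E s'"
  interpret merged_classes A ?F "pa c" "pc c" by (rule merged_classesI[OF c(1) split(1)])
  have "at_transversal A (E s') (\<lambda>P'. \<Sum>P\<in>previous_signs s' c P'. f (s'[c := True], P)) T =
      at_transversal A ?F (\<lambda>P'. \<Sum>P | P \<subseteq> A // E' \<and>
        P - {Cpq} = P' - {Cp, Cq} \<and> card P' = Suc (card P). f (s'[c := True], P)) T"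
    by (intro at_transversal_cong) (simp only: previous_signs_split[OF c(1) _ split] circles_altdef)
  also have "\<dots> = evaluation D f (s'[c := True]) T"
    unfolding split(2) evaluation_def by (rule at_transversal_split)
  moreover have "(pa c, pc c) \<in> E'" using E(1) by (simp add: join_classes_def)
  ultimately show ?thesis by (simp add: resmoothing_map_def split(2))
qed

text \<open>
  The differential as a signed sum of resmoothing maps, in which no enhanced state occurs any more.
\<close>

lemma evaluation_differential:
  assumes s': "length s' = n"
  shows "evaluation D (int_differential D f) s' T =
    (\<Sum>c\<in>negatives s'. (-1) ^ later_negatives s' c *
      resmoothing_map D c (s'[c := True]) (evaluation D f (s'[c := True])) T)"
proof -
  have "missed A (E s') T \<subseteq> circles D s'" by (auto simp: missed_def circles_altdef)
  then have "evaluation D (int_differential D f) s' T =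
    (\<Sum>c\<in>negatives s'. (-1) ^ later_negatives s' c *
      at_transversal A (E s') (\<lambda>P'. \<Sum>P\<in>previous_signs s' c P'. f (s'[c := True], P)) T)"
    by (simp add: evaluation_def at_transversal_def int_differential_eq[OF s'])
  then show ?thesis using at_transversal_previous_signs s' by simp
qed

end

section \<open>The square of the differential\<close>

definition supported :: "'a diagram \<Rightarrow> 'a int_chain \<Rightarrow> bool" where
  "supported D f \<longleftrightarrow> (\<forall>S. S \<notin> enhanced_states D \<longrightarrow> f S = 0)"

text \<open>
  The sign of the differential at a crossing that comes before all crossings of the diagram.
\<close>

definition alternate :: "'a int_chain \<Rightarrow> 'a int_chain" where
  "alternate f = (\<lambda>(s, P). (-1) ^ length (filter Not s) * f (s, P))"

lemma later_negatives_update: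
  assumes "d < length s" "\<not> s ! d"
  shows "later_negatives s c = later_negatives (s[d := True]) c + (if c < d then 1 else 0)"
proof -
  let ?K = "{k. c < k \<and> k < length s \<and> \<not> s[d := True] ! k}"
  have "{k. c < k \<and> k < length s \<and> \<not> s ! k} = (if c < d then insert d ?K else ?K)"
    using assms by (auto simp: nth_list_update)
  moreover have "d \<notin> ?K" using assms by simp
  moreover have "finite ?K" by simp
  ultimately show ?thesis by (simp add: later_negatives_def)
qed

lemma later_negatives_swap:
  assumes "c < length s" "d < length s" "\<not> s ! c" "\<not> s ! d" "c \<noteq> d"
  shows "(-1 :: int) ^ later_negatives s c * (-1) ^ later_negatives (s[c := True]) d =
    - ((-1) ^ later_negatives s d * (-1) ^ later_negatives (s[d := True]) c)"
  using later_negatives_update[of d s c] later_negatives_update[of c s d] assms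
  by (cases "c < d") simp_all

lemma resmoothing_map_mult_X:
  "resmoothing_map D c s (mult_X e \<phi>) T = mult_X e (resmoothing_map D c s \<phi>) T"
  by (auto simp: resmoothing_map_def mult_X_commute[of _ e] mult_X_def insert_commute)

text \<open>
  Two paths of steps \<open>\<plusminus>1\<close> with the same ends have either the same first step or exchanged steps.
\<close>

lemma two_paths_of_unit_steps:
  fixes w x y z :: nat
  assumes "if a then x = Suc w else w = Suc x" "if b then z = Suc x else x = Suc z"
    "if a' then y = Suc w else w = Suc y" "if b' then z = Suc y else y = Suc z"
  shows "a = a' \<and> b = b' \<and> a \<noteq> b \<or> a = b' \<and> b = a'"
  using assms by (simp only: if_bool_eq_conj) linarith

lemma antisymmetric_double_sum:
  fixes t :: "nat \<Rightarrow> nat \<Rightarrow> int"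
  assumes "finite N" and "\<And>c d. c \<in> N \<Longrightarrow> d \<in> N \<Longrightarrow> c \<noteq> d \<Longrightarrow> t c d = - t d c"
  shows "(\<Sum>c\<in>N. \<Sum>d\<in>N - {c}. t c d) = 0"
proof -
  define u where "u c d = (if c = d then 0 else t c d)" for c d
  have eq: "(\<Sum>d\<in>N - {c}. t c d) = (\<Sum>d\<in>N. u c d)" for c
    by (rule sum.mono_neutral_cong_left) (auto simp: u_def assms(1))
  have "(\<Sum>c\<in>N. \<Sum>d\<in>N. u c d) = (\<Sum>c\<in>N. \<Sum>d\<in>N. u d c)" by (rule sum.swap)
  also have "\<dots> = (\<Sum>c\<in>N. \<Sum>d\<in>N. - u c d)"
  proof (intro sum.cong refl)
    fix c d assume "c \<in> N" "d \<in> N"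
    then show "u d c = - u c d" using assms(2)[of c d] by (simp add: u_def)
  qed
  also have "\<dots> = - (\<Sum>c\<in>N. \<Sum>d\<in>N. u c d)" by (simp add: sum_negf)
  finally show ?thesis by (simp add: eq)
qed

context resmoothable
begin

text \<open>
  An evaluation at a transversal of the negative circles of a state is the coefficient of that state.
\<close>

lemma chain_eqI:
  assumes "supported D f" "supported D g"
    and "\<And>s T. length s = n \<Longrightarrow> T \<subseteq> A \<Longrightarrow> evaluation D f s T = evaluation D g s T"
  shows "f = g"
proof
  fix S show "f S = g S"
  proof (cases "S \<in> enhanced_states D")
    case True
    obtain s P where S: "S = (s, P)" by (cases S)
    with True have sP: "length s = n" "P \<subseteq> A // E s" by (auto simp: enhanced_state_iff circles_altdef)
    obtain T where "T \<subseteq> A" "transversal (E s) T" "missed A (E s) T = P"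
      using exists_transversal[OF same_circle_equiv sP(2) closed] by blast
    then show ?thesis using assms(3)[OF sP(1), of T] S by (simp add: evaluation_def at_transversal_def)
  next
    case False
    then show ?thesis using assms(1,2) unfolding supported_def by metis
  qed
qed

lemma supported_differential: "supported D (int_differential D f)"
  by (auto simp: supported_def int_differential_def incidence_number_def)

lemma supported_multiplication_by_X:
  assumes "e \<in> A" "supported D f"
  shows "supported D (multiplication_by_X D e f)"
proof -
  have "(s, P) \<in> enhanced_states D" if "E s `` {e} \<in> P" "(s, P - {E s `` {e}}) \<in> enhanced_states D" for s P
    using that quotientI[OF assms(1), of "E s"] by (auto simp: enhanced_state_iff circles_altdef)
  then show ?thesis
    using assms(2) by (auto simp: supported_def multiplication_by_X_def)
qed

lemma card_circles_resmoothing: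
  assumes "c < n" "length s' = n" "\<not> s' ! c"
  shows "if (pa c, pc c) \<in> E (s'[c := True]) then card (circles D s') = Suc (card (circles D (s'[c := True])))
    else card (circles D (s'[c := True])) = Suc (card (circles D s'))"
  using assms
proof (cases rule: resmoothing_cases)
  case merge
  interpret merged_classes A "E (s'[c := True])" "pa c" "pc c" by (rule merged_classesI[OF assms(1) merge(1)])
  show ?thesis using card_merged_quotient merge by (simp add: circles_altdef)
next
  case split
  interpret merged_classes A "E s'" "pa c" "pc c" by (rule merged_classesI[OF assms(1) split(1)])
  have "(pa c, pc c) \<in> E'" using E(1) by (simp add: join_classes_def)
  then show ?thesis using card_merged_quotient split by (simp add: circles_altdef)
qed

text \<open>
  The variables commute, so the claim is clear if the crossing \<open>c\<close> merges circles along both paths or splits circles along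
  both paths, and the same holds for \<open>d\<close>.  By the count of circles, the only other possibility is that both paths start
  with a split and continue with a merge, or conversely.  Then the two crossings operate on the same pair of circles, and the factors
  \<open>X\<^sub>a + X\<^sub>c\<close> of \<open>c\<close> and \<open>d\<close> act alike on functions that are encoded with the circles of \<open>v\<close>.
\<close>

lemma resmoothing_maps_commute:
  fixes f :: "'a int_chain"
  assumes c: "c < n" "\<not> s ! c" and d: "d < n" "\<not> s ! d" and "c \<noteq> d" and s: "length s = n"
  defines "v \<equiv> s[c := True, d := True]"
  defines "\<phi> \<equiv> evaluation D f v"
  shows "resmoothing_map D c (s[c := True]) (resmoothing_map D d v \<phi>) T =
    resmoothing_map D d (s[d := True]) (resmoothing_map D c v \<phi>) T"
proof -
  have v': "v = s[d := True, c := True]" using \<open>c \<noteq> d\<close> by (simp add: v_def list_update_swap)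
  have nd: "\<not> s[c := True] ! d" and nc: "\<not> s[d := True] ! c" using c d \<open>c \<noteq> d\<close> by simp_all
  let ?a = "(pa d, pc d) \<in> E v" and ?b = "(pa c, pc c) \<in> E (s[c := True])"
  let ?a' = "(pa c, pc c) \<in> E v" and ?b' = "(pa d, pc d) \<in> E (s[d := True])"
  have "?a = ?a' \<and> ?b = ?b' \<and> ?a \<noteq> ?b \<or> ?a = ?b' \<and> ?b = ?a'"
    by (rule two_paths_of_unit_steps[OF
        card_circles_resmoothing[OF d(1) length_update_eq[OF s] nd, folded v_def] card_circles_resmoothing[OF c(1) s c(2)]
        card_circles_resmoothing[OF c(1) length_update_eq[OF s] nc, folded v'] card_circles_resmoothing[OF d(1) s d(2)]])
  then show ?thesis
  proof
    assume "?a = ?b' \<and> ?b = ?a'"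
    then show ?thesis
      by (auto simp: resmoothing_map_def[abs_def] mult_X_add mult_X_commute[of "pa c" "pa d"]
          mult_X_commute[of "pa c" "pc d"] mult_X_commute[of "pc c" "pa d"] mult_X_commute[of "pc c" "pc d"])
  next
    assume mixed: "?a = ?a' \<and> ?b = ?b' \<and> ?a \<noteq> ?b"
    note eqv = equivD[OF same_circle_equiv[of D v]]
    have "(pa c, pa d) \<in> E v \<and> (pc d, pc c) \<in> E v \<or> (pa c, pc d) \<in> E v \<and> (pa d, pc c) \<in> E v"
      using d(1) length_update_eq[OF s, of c True] nd
    proof (cases rule: resmoothing_cases)
      case merge
      then show ?thesis using mixed by (auto simp: v_def join_classes_def)
    next
      case split
      then have "?a" using equivD(1)[OF same_circle_equiv[of D "s[c := True]"]]
        by (simp add: v_def join_classes_def)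
      then have "(pa c, pc c) \<in> E v" "(pa c, pc c) \<notin> E (s[c := True])" using mixed by auto
      then show ?thesis unfolding v_def split(2) by (auto simp: join_classes_def)
    qed
    then have "mult_X (pa c) \<phi> T + mult_X (pc c) \<phi> T = mult_X (pa d) \<phi> T + mult_X (pc d) \<phi> T"
      unfolding \<phi>_def evaluation_def
      using mult_X_same_class[OF same_circle_equiv[of D v]] by fastforce
    then show ?thesis using mixed by (auto simp: resmoothing_map_def[abs_def])
  qed
qed

text \<open>
  Two changes of markers commute and come with opposite signs in the two orders.
\<close>

lemma differential_square: "int_differential D (int_differential D f) = (\<lambda>_. 0)"
proof (rule chain_eqI)
  fix s :: "bool list" and T assume s: "length s = n"
  let ?N = "negatives s"
  let ?L = "\<lambda>c d. resmoothing_map D c (s[c := True]) (resmoothing_map D d (s[c := True, d := True])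
    (evaluation D f (s[c := True, d := True]))) T"
  let ?t = "\<lambda>c d. (-1) ^ later_negatives s c * (-1) ^ later_negatives (s[c := True]) d * ?L c d"
  have "evaluation D (int_differential D f) (s[c := True]) =
    (\<lambda>T. \<Sum>d\<in>?N - {c}. (-1) ^ later_negatives (s[c := True]) d *
      resmoothing_map D d (s[c := True, d := True]) (evaluation D f (s[c := True, d := True])) T)" if "c \<in> ?N" for c
  proof -
    have "negatives (s[c := True]) = ?N - {c}"
      using that s by (auto simp: nth_list_update)
    then show ?thesis using evaluation_differential[of "s[c := True]" f] s by auto
  qed
  then have "evaluation D (int_differential D (int_differential D f)) s T = (\<Sum>c\<in>?N. \<Sum>d\<in>?N - {c}. ?t c d)"
    by (simp add: evaluation_differential[OF s] resmoothing_map_sum sum_distrib_left mult.assoc)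
  also have "\<dots> = 0"
  proof (rule antisymmetric_double_sum)
    fix c d assume cd: "c \<in> ?N" "d \<in> ?N" "c \<noteq> d"
    then have "?L c d = ?L d c"
      using resmoothing_maps_commute[of c s d f T] s list_update_swap[of c d s True True] by simp
    then show "?t c d = - ?t d c"
      using later_negatives_swap[of c s d] cd s by simp
  qed simp
  finally show "evaluation D (int_differential D (int_differential D f)) s T = evaluation D (\<lambda>_. 0) s T"
    by (simp add: evaluation_def at_transversal_def)
qed (auto simp: supported_differential, simp add: supported_def)

text \<open>
  All resmoothing maps are linear over the variables.
\<close>

lemma multiplication_by_X_differential:
  assumes e: "e \<in> A"
  shows "multiplication_by_X D e (int_differential D f) = int_differential D (multiplication_by_X D e f)"
proof (rule chain_eqI)
  fix s :: "bool list" and T assume s: "length s = n"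
  have "evaluation D (multiplication_by_X D e f) s' = mult_X e (evaluation D f s')" for s'
    by (rule ext) (rule evaluation_multiplication_by_X[OF e])
  then show "evaluation D (multiplication_by_X D e (int_differential D f)) s T =
      evaluation D (int_differential D (multiplication_by_X D e f)) s T"
    by (simp add: evaluation_multiplication_by_X[OF e] evaluation_differential[OF s]
        resmoothing_map_mult_X mult_X_def)
qed (auto simp: e supported_multiplication_by_X supported_differential)

text \<open>
  The differential raises the number of negative markers by one.
\<close>

lemma alternate_differential: "alternate (int_differential D f) = (\<lambda>S. - int_differential D (alternate f) S)"
proof
  fix S' show "alternate (int_differential D f) S' = - int_differential D (alternate f) S'"
  proof (cases S')
    case (Pair s' P')
    have "(-1) ^ length (filter Not s') * (incidence_number D S S' * f S) =
        - (incidence_number D S S' * alternate f S)" if S: "S \<in> enhanced_states D" for S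
    proof (cases "incidence_number D S S' = 0")
      case False
      obtain s P where sP: "S = (s, P)" by (cases S)
      obtain c where "c < n" "\<not> s' ! c" "s = s'[c := True]"
        using incidence_number_nonzero False sP Pair by blast
      moreover have "length s' = n" using False Pair by (auto simp: incidence_number_def enhanced_state_iff split: if_splits)
      ultimately show ?thesis using filter_marker_update(2)[of c s'] sP by (simp add: alternate_def)
    qed simp
    moreover have "alternate g (s', P') = (-1) ^ length (filter Not s') * g (s', P')" for g :: "'a int_chain"
      by (simp add: alternate_def)
    ultimately show ?thesis
      by (simp add: Pair int_differential_def sum_distrib_left flip: sum_negf)
  qed
qed

end

lemma multiplication_by_X_alternate:
  "multiplication_by_X D e (alternate f) = alternate (multiplication_by_X D e f)"
  by (auto simp: multiplication_by_X_def alternate_def)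

lemma alternate_alternate [simp]: "alternate (alternate f) = f"
proof
  fix S :: "'a enhanced_state"
  show "alternate (alternate f) S = f S"
    by (cases S) (simp add: alternate_def flip: mult.assoc power_add)
qed

section \<open>The circles after adding a Hopf link\<close>

lemma link_diagram_resmoothable:
  assumes "link_diagram D"
  shows "resmoothable D"
proof -
  have code: "diagram_code D" and "plane_code D"
    using assms by (auto simp: link_diagram_def plane_code_def)
  then obtain u where "checkerboard D u" using plane_code.checkerboard_exists by blast
  then interpret checkerboard_code D u by unfold_locales (rule code)
  show ?thesis
  proof (rule resmoothable.intro)
    show "finite (arcs D)" "\<And>x. x \<in> set (crossings D) \<Longrightarrow> length x = 4 \<and> set x \<subseteq> arcs D"
      using code by (auto simp: diagram_code_def)
  qed (rule resmoothing)
qed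

lemma join_classes_commute: "join_classes E p q = join_classes E q p"
  by (auto simp: join_classes_def)

text \<open>
  A diagram \<open>D\<close> and a Hopf link added to its arc \<open>e\<close>, of which \<open>r\<close> is the part to the right of the new circle.  For a
  crossingless component \<open>r = e\<close>.  The crossings \<open>xs\<close> are those of \<open>D\<close> up to replacing \<open>e\<close> by \<open>r\<close> at some ends, and \<open>swapped\<close>
  tells the order of the new crossings.
\<close>

locale hopf = resmoothable +
  fixes D' :: "'a diagram" and e r m t b :: 'a and xs :: "'a list list" and swapped :: bool
  assumes e: "e \<in> arcs D" and r: "r = e \<or> r \<notin> arcs D"
    and new_distinct: "distinct [m, t, b]" and fresh: "{m, t, b} \<inter> insert r (arcs D) = {}"
    and arcs': "arcs D' = arcs D \<union> {r, m, t, b}"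
    and crossings': "crossings D' = (if swapped then [b, r, t, m] # [e, b, m, t] # xs
      else [e, b, m, t] # [b, r, t, m] # xs)"
    and length_xs: "length xs = length (crossings D)"
    and xs: "c < length (crossings D) \<Longrightarrow> length (xs ! c) = 4 \<and>
      (\<forall>k<4. xs ! c ! k = crossings D ! c ! k \<or> xs ! c ! k = r \<and> crossings D ! c ! k = e)"
begin

abbreviation "A' \<equiv> arcs D'"

text \<open>
  The extra circle for the markers \<open>m1\<close>, \<open>m2\<close> of the new crossings, or the empty set if the markers differ and there is
  no extra circle.  All other new arcs then lie on the circle of \<open>e\<close>, to which they are retracted.
\<close>

definition extra :: "bool \<Rightarrow> bool \<Rightarrow> 'a set" where
  "extra m1 m2 = (if m1 \<noteq> m2 then {} else if m1 then {m, t} else {b, m})"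

definition retract :: "'a \<Rightarrow> 'a" where
  "retract x = (if x \<in> A then x else e)"

text \<open>
  The relation on the arcs of \<open>D'\<close> which has \<open>Z\<close> as one class (unless it is empty), and the preimages of the classes of \<open>F\<close>
  under the retraction as its other classes.
\<close>

definition lift_rel :: "'a set \<Rightarrow> ('a \<times> 'a) set \<Rightarrow> ('a \<times> 'a) set" where
  "lift_rel Z F = {(x, y). x = y \<or> x \<in> A' \<and> y \<in> A' \<and>
     (x \<in> Z \<and> y \<in> Z \<or> x \<notin> Z \<and> y \<notin> Z \<and> (retract x, retract y) \<in> F)}"

lemma new_arcs: "m \<notin> A" "t \<notin> A" "b \<notin> A" "m \<noteq> r" "t \<noteq> r" "b \<noteq> r" "m \<noteq> t" "m \<noteq> b" "t \<noteq> b"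
  "m \<noteq> e" "t \<noteq> e" "b \<noteq> e"
  using new_distinct fresh e by auto

lemma retract_simps [simp]: "retract e = e" "retract r = e" "retract m = e" "retract t = e" "retract b = e"
  "x \<in> A \<Longrightarrow> retract x = x"
  using new_arcs r e by (auto simp: retract_def)

lemma retract_in: "retract x \<in> A" using e by (simp add: retract_def)

lemma A'_members: "e \<in> A'" "r \<in> A'" "m \<in> A'" "t \<in> A'" "b \<in> A'" "x \<in> A \<Longrightarrow> x \<in> A'"
  using arcs' e by auto

lemma extra_disjoint: "extra m1 m2 \<inter> insert r A = {}"
  using new_arcs by (auto simp: extra_def)

lemma extra_subset: "extra m1 m2 \<subseteq> A'" using A'_members by (auto simp: extra_def)

lemma equiv_lift_rel:
  assumes "equiv UNIV F"
  shows "equiv UNIV (lift_rel Z F)"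
proof (rule equivI)
  note F = equivD[OF assms]
  show "refl (lift_rel Z F)" by (simp add: lift_rel_def refl_on_def)
  show "sym (lift_rel Z F)"
    by (rule symI) (use F(2) in \<open>auto simp: lift_rel_def\<close>)
  show "trans (lift_rel Z F)"
    by (rule transI) (use F(3) in \<open>auto simp: lift_rel_def\<close>)
qed simp

lemma xs_retract:
  assumes "c < n" "k < 4"
  shows "retract (xs ! c ! k) = crossings D ! c ! k" "xs ! c ! k \<in> insert r A" "xs ! c ! k \<in> A'"
proof -
  have "crossings D ! c ! k \<in> A" using crossing_nth[OF assms(1)] assms(2) by (metis nth_mem subsetD)
  moreover have "xs ! c ! k = crossings D ! c ! k \<or> xs ! c ! k = r \<and> crossings D ! c ! k = e"
    using xs[OF assms(1)] assms(2) by blast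
  ultimately show "retract (xs ! c ! k) = crossings D ! c ! k" "xs ! c ! k \<in> insert r A" "xs ! c ! k \<in> A'"
    using A'_members by (metis retract_simps(2,6) insertCI)+
qed

lemma smoothing_rel_hopf:
  "smoothing_rel D' (m1 # m2 # s) =
    smoothing [e, b, m, t] (if swapped then m2 else m1) \<union>
    smoothing [b, r, t, m] (if swapped then m1 else m2) \<union>
    (\<Union>c<n. smoothing (xs ! c) (s ! c))"
proof -
  have "{..<Suc (Suc n)} = {0, 1} \<union> (\<lambda>c. Suc (Suc c)) ` {..<n}"
    by (simp add: lessThan_Suc_eq_insert_0 image_image insert_commute)
  then show ?thesis
    by (auto simp: smoothing_rel_def crossings' length_xs split: if_splits)
qed

text \<open>
  Every smoothing pair of \<open>D'\<close> is related by the right-hand side.  Conversely the smoothings of the new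
  crossings connect \<open>e\<close> with \<open>r\<close> and with all new arcs outside the extra circle, so each smoothing pair of \<open>D\<close> lifts to
  related arcs.
\<close>

lemma same_circle_hopf: "same_circle D' (m1 # m2 # s) = lift_rel (extra m1 m2) (E s)"
proof
  let ?E' = "same_circle D' (m1 # m2 # s)" and ?Z = "extra m1 m2"
  note F = equivD[OF same_circle_equiv[of D s]]
  note F' = equivD[OF same_circle_equiv[of D' "m1 # m2 # s"]]
  have old: "smoothing (crossings D ! c) (s ! c) \<subseteq> E s" if "c < n" for c
    using that unfolding same_circle_def smoothing_rel_def by blast
  show "?E' \<subseteq> lift_rel ?Z (E s)"
    unfolding same_circle_def[of D']
  proof (rule generated_least[OF _ equiv_lift_rel[OF same_circle_equiv]])
    have "smoothing [e, b, m, t] (if swapped then m2 else m1) \<union>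
        smoothing [b, r, t, m] (if swapped then m1 else m2) \<subseteq> lift_rel ?Z (E s)"
      using new_arcs A'_members F(1)[of e] r e
      by (cases m1; cases m2; cases swapped) (auto simp: lift_rel_def extra_def)
    moreover have "smoothing (xs ! c) (s ! c) \<subseteq> lift_rel ?Z (E s)" if c: "c < n" for c
    proof -
      have "(xs ! c ! k, xs ! c ! l) \<in> lift_rel ?Z (E s)"
        if "k < 4" "l < 4" "(crossings D ! c ! k, crossings D ! c ! l) \<in> E s" for k l
        using that xs_retract[OF c] extra_disjoint[of m1 m2] unfolding lift_rel_def by fastforce
      then show ?thesis
        using old[OF c] xs[OF c] crossing_nth[OF c]
        by (cases "s ! c") (simp_all add: smoothing_length_4)
    qed
    ultimately show "smoothing_rel D' (m1 # m2 # s) \<subseteq> lift_rel ?Z (E s)"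
      unfolding smoothing_rel_hopf by blast
  qed
  have new: "smoothing [e, b, m, t] (if swapped then m2 else m1) \<union>
      smoothing [b, r, t, m] (if swapped then m1 else m2) \<subseteq> ?E'"
    and xs_sub: "(\<Union>c<n. smoothing (xs ! c) (s ! c)) \<subseteq> ?E'"
    unfolding same_circle_def smoothing_rel_hopf by blast+
  have new_rel: "(e, r) \<in> ?E' \<and> (\<forall>x\<in>{m, t, b} - ?Z. (e, x) \<in> ?E') \<and> (\<forall>x\<in>?Z. (m, x) \<in> ?E')"
  proof -
    have "(p \<and> (e, b) \<in> X \<and> (m, t) \<in> X \<or> \<not> p \<and> (e, t) \<in> X \<and> (b, m) \<in> X) \<and>
      (q \<and> (b, r) \<in> X \<and> (t, m) \<in> X \<or> \<not> q \<and> (b, m) \<in> X \<and> (r, t) \<in> X)"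
      if "smoothing [e, b, m, t] p \<union> smoothing [b, r, t, m] q \<subseteq> X" for p q X
      using that by (cases p; cases q) simp_all
    from this[OF new]
    consider (pp) "m1" "m2" "(e, b) \<in> ?E'" "(m, t) \<in> ?E'" "(b, r) \<in> ?E'"
      | (nn) "\<not> m1" "\<not> m2" "(e, t) \<in> ?E'" "(b, m) \<in> ?E'" "(r, t) \<in> ?E'"
      | (pn) "m1 \<noteq> m2" "(e, b) \<in> ?E'" "(m, t) \<in> ?E'" "(b, m) \<in> ?E'" "(r, t) \<in> ?E'"
      | (np) "m1 \<noteq> m2" "(e, t) \<in> ?E'" "(b, m) \<in> ?E'" "(b, r) \<in> ?E'" "(t, m) \<in> ?E'"
      by (cases m1; cases m2; cases swapped) auto
    then show ?thesis
    proof cases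
      case pp
      then show ?thesis using F'(1)[of m] F'(3)[OF pp(3,5)] by (auto simp: extra_def)
    next
      case nn
      then show ?thesis using F'(1)[of m] F'(2)[OF nn(4)] F'(3)[OF nn(3) F'(2)[OF nn(5)]] by (auto simp: extra_def)
    next
      case pn
      have em: "(e, m) \<in> ?E'" using F'(3)[OF pn(2,4)] .
      have et: "(e, t) \<in> ?E'" using F'(3)[OF em pn(3)] .
      show ?thesis using pn em et F'(3)[OF et F'(2)[OF pn(5)]] by (auto simp: extra_def)
    next
      case np
      have em: "(e, m) \<in> ?E'" using F'(3)[OF np(2,5)] .
      have eb: "(e, b) \<in> ?E'" using F'(3)[OF em F'(2)[OF np(3)]] .
      show ?thesis using np em eb F'(3)[OF eb np(4)] by (auto simp: extra_def)
    qed
  qed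
  have sub: "E s \<subseteq> ?E'"
    unfolding same_circle_def[of D]
  proof (rule generated_least[OF _ same_circle_equiv])
    have "smoothing (crossings D ! c) (s ! c) \<subseteq> ?E'" if c: "c < n" for c
    proof -
      have "(crossings D ! c ! k, crossings D ! c ! l) \<in> ?E'"
        if kl: "k < 4" "l < 4" "(xs ! c ! k, xs ! c ! l) \<in> ?E'" for k l
      proof -
        have *: "(crossings D ! c ! k, xs ! c ! k) \<in> ?E'" if "k < 4" for k
          using xs[OF c] that F'(1) new_rel by auto
        show ?thesis by (rule F'(3)[OF *[OF kl(1)] F'(3)[OF kl(3) F'(2)[OF *[OF kl(2)]]]])
      qed
      moreover have "smoothing (xs ! c) (s ! c) \<subseteq> ?E'" using xs_sub c by blast
      ultimately show ?thesis
        using xs[OF c] crossing_nth[OF c]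
        by (cases "s ! c") (simp_all add: smoothing_length_4)
    qed
    then show "smoothing_rel D s \<subseteq> ?E'" unfolding smoothing_rel_def by blast
  qed
  have ret: "(retract x, x) \<in> ?E'" if "x \<in> A'" "x \<notin> ?Z" for x
    using that new_rel F'(1)[of x] arcs' by (cases "x \<in> A") (auto simp: retract_def)
  show "lift_rel ?Z (E s) \<subseteq> ?E'"
  proof clarify
    fix x y assume "(x, y) \<in> lift_rel ?Z (E s)"
    then consider "x = y" | "x \<in> ?Z" "y \<in> ?Z"
      | "x \<in> A'" "y \<in> A'" "x \<notin> ?Z" "y \<notin> ?Z" "(retract x, retract y) \<in> E s"
      by (auto simp: lift_rel_def)
    then show "(x, y) \<in> ?E'"
    proof cases
      case 1
      then show ?thesis using F'(1) by simp
    next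
      case 2
      then have "(m, x) \<in> ?E'" "(m, y) \<in> ?E'" using new_rel by auto
      then show ?thesis using F'(3)[OF F'(2)] by blast
    next
      case 3
      then have "(retract x, x) \<in> ?E'" "(retract y, y) \<in> ?E'" "(retract x, retract y) \<in> ?E'"
        using ret sub by auto
      then show ?thesis using F'(3)[OF F'(2)] F'(3) by blast
    qed
  qed
qed

text \<open>
  Changing one of two equal new markers unites the extra circle with the circle of \<open>e\<close>.
\<close>

lemma lift_rel_join_new:
  assumes F: "equiv UNIV F" and Z: "Z \<subseteq> {m, t, b}" and y: "y \<in> Z" and x: "x \<in> {e, r, m, t, b}" "x \<notin> Z"
  shows "(x, y) \<notin> lift_rel Z F" "lift_rel {} F = join_classes (lift_rel Z F) x y"
proof -
  note F = equivD[OF F]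
  have rx: "retract x = e" "x \<in> A'" using x A'_members by auto
  have rz: "retract z = e" "z \<in> A'" if "z \<in> Z" for z using that Z A'_members by auto
  show "(x, y) \<notin> lift_rel Z F" using x y by (auto simp: lift_rel_def)
  have 1: "(u, x) \<in> lift_rel Z F \<longleftrightarrow> u \<in> A' \<and> u \<notin> Z \<and> (retract u, e) \<in> F" for u
    using x rx F(1)[of e] by (auto simp: lift_rel_def)
  have 2: "(x, u) \<in> lift_rel Z F \<longleftrightarrow> u \<in> A' \<and> u \<notin> Z \<and> (e, retract u) \<in> F" for u
    using x rx F(1)[of e] by (auto simp: lift_rel_def)
  have 3: "(u, y) \<in> lift_rel Z F \<longleftrightarrow> u \<in> Z" "(y, u) \<in> lift_rel Z F \<longleftrightarrow> u \<in> Z" for u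
    using y rz by (auto simp: lift_rel_def)
  have "(u, v) \<in> lift_rel {} F \<longleftrightarrow> (u, v) \<in> join_classes (lift_rel Z F) x y" for u v
    unfolding join_classes_def mem_Collect_eq prod.case 1 2 3
    using rz F(1)[of e] by (cases "u \<in> Z"; cases "v \<in> Z") (auto simp: lift_rel_def)
  then show "lift_rel {} F = join_classes (lift_rel Z F) x y" by auto
qed

text \<open>
  Changing a marker of \<open>D\<close> has the same effect on the circles of \<open>D\<close> and on the circles lifted from them.
\<close>

lemma lift_rel_join_old:
  assumes F: "equiv UNIV F" and p': "p' \<in> A'" "p' \<notin> Z" "retract p' = p" and q': "q' \<in> A'" "q' \<notin> Z" "retract q' = q"
  shows "(p', q') \<in> lift_rel Z F \<longleftrightarrow> (p, q) \<in> F"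
    "lift_rel Z (join_classes F p q) = join_classes (lift_rel Z F) p' q'"
proof -
  note F = equivD[OF F]
  have 1: "(u, p') \<in> lift_rel Z F \<longleftrightarrow> u \<in> A' \<and> u \<notin> Z \<and> (retract u, p) \<in> F"
    "(p', u) \<in> lift_rel Z F \<longleftrightarrow> u \<in> A' \<and> u \<notin> Z \<and> (p, retract u) \<in> F"
    "(u, q') \<in> lift_rel Z F \<longleftrightarrow> u \<in> A' \<and> u \<notin> Z \<and> (retract u, q) \<in> F"
    "(q', u) \<in> lift_rel Z F \<longleftrightarrow> u \<in> A' \<and> u \<notin> Z \<and> (q, retract u) \<in> F" for u
    using p' q' F(1)[of p] F(1)[of q] by (auto simp: lift_rel_def)
  show "(p', q') \<in> lift_rel Z F \<longleftrightarrow> (p, q) \<in> F" using q' by (simp add: 1(2))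
  have "(u, v) \<in> lift_rel Z (join_classes F p q) \<longleftrightarrow> (u, v) \<in> join_classes (lift_rel Z F) p' q'" for u v
    unfolding join_classes_def mem_Collect_eq prod.case 1
    by (auto simp: lift_rel_def)
  then show "lift_rel Z (join_classes F p q) = join_classes (lift_rel Z F) p' q'" by auto
qed

lemma opposite_new:
  assumes "c \<in> {0, 1}"
  shows "opposite_a D' c \<in> {e, b}" "opposite_c D' c \<in> {m, t}"
    "m1 = m2 \<Longrightarrow> (opposite_a D' c \<in> extra m1 m2) \<noteq> (opposite_c D' c \<in> extra m1 m2)"
  using assms new_arcs
  by (auto simp: opposite_a_def opposite_c_def crossings' extra_def)

lemma opposite_old:
  assumes "c < n"
  shows "retract (opposite_a D' (Suc (Suc c))) = pa c" "retract (opposite_c D' (Suc (Suc c))) = pc c"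
    "opposite_a D' (Suc (Suc c)) \<in> insert r A" "opposite_c D' (Suc (Suc c)) \<in> insert r A"
  using xs_retract[OF assms, of 0] xs_retract[OF assms, of 2]
  by (auto simp: opposite_a_def opposite_c_def crossings')

lemma new_resmoothing:
  assumes "c \<in> {0, 1}"
  defines "p \<equiv> opposite_a D' c" and "q \<equiv> opposite_c D' c"
  shows "(p, q) \<notin> lift_rel (extra k k) (E s)" "lift_rel {} (E s) = join_classes (lift_rel (extra k k) (E s)) p q"
    "(p, q) \<in> lift_rel {} (E s)"
proof -
  note new = opposite_new[OF assms(1), folded p_def q_def]
  have sub: "extra k k \<subseteq> {m, t, b}" by (auto simp: extra_def)
  have in': "p \<in> {e, r, m, t, b}" "q \<in> {e, r, m, t, b}" using new by auto
  note eqv = same_circle_equiv[of D s]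
  consider "p \<in> extra k k" "q \<notin> extra k k" | "p \<notin> extra k k" "q \<in> extra k k"
    using new(3)[of k k] by auto
  then have "(p, q) \<notin> lift_rel (extra k k) (E s) \<and> lift_rel {} (E s) = join_classes (lift_rel (extra k k) (E s)) p q"
  proof cases
    case 1
    note * = lift_rel_join_new[OF eqv sub 1(1) in'(2) 1(2)]
    have "(p, q) \<notin> lift_rel (extra k k) (E s)"
      using *(1) equivD(2)[OF equiv_lift_rel[OF eqv]] by blast
    moreover have "lift_rel {} (E s) = join_classes (lift_rel (extra k k) (E s)) p q"
      by (subst join_classes_commute) (rule *(2))
    ultimately show ?thesis by blast
  next
    case 2
    show ?thesis
      using lift_rel_join_new[OF eqv sub 2(2) in'(1) 2(1)] by blast
  qed
  then show "(p, q) \<notin> lift_rel (extra k k) (E s)" "lift_rel {} (E s) = join_classes (lift_rel (extra k k) (E s)) p q"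
    by blast+
  have "retract p = e" "retract q = e" "p \<in> A'" "q \<in> A'" using in' A'_members by auto
  then show "(p, q) \<in> lift_rel {} (E s)" using equivD(1)[OF eqv, of e] by (simp add: lift_rel_def)
qed

lemma extra_mixed [simp]: "extra True False = {}" "extra False True = {}"
  by (auto simp: extra_def)

lemma hopf_resmoothable: "resmoothable D'"
proof (rule resmoothable.intro)
  show "finite A'" using finite_arcs arcs' by simp
next
  fix x assume x: "x \<in> set (crossings D')"
  have "length (xs ! c) = 4 \<and> set (xs ! c) \<subseteq> A'" if "c < n" for c
    using xs[OF that] xs_retract(3)[OF that] by (auto simp: set_conv_nth)
  then have "length x = 4 \<and> set x \<subseteq> A'" if "x \<in> set xs" for x
    using that by (auto simp: in_set_conv_nth length_xs)
  then show "length x = 4 \<and> set x \<subseteq> A'"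
    using x A'_members by (auto simp: crossings' split: if_splits)
next
  fix c and s' :: "bool list"
  assume c: "c < length (crossings D')" and s': "length s' = length (crossings D')"
  have len: "length (crossings D') = Suc (Suc n)" by (simp add: crossings' length_xs)
  obtain m1 m2 s where s: "s' = m1 # m2 # s" "length s = n"
    using s' len by (metis length_Suc_conv)
  let ?p = "opposite_a D' c" and ?q = "opposite_c D' c"
  consider "c = 0" | "c = 1" | k where "c = Suc (Suc k)" "k < n"
    using c len by (metis One_nat_def not0_implies_Suc Suc_less_eq)
  then show "(?p, ?q) \<notin> same_circle D' (s'[c := True]) \<and>
        same_circle D' (s'[c := False]) = join_classes (same_circle D' (s'[c := True])) ?p ?q \<or>
      (?p, ?q) \<notin> same_circle D' (s'[c := False]) \<and>
        same_circle D' (s'[c := True]) = join_classes (same_circle D' (s'[c := False])) ?p ?q"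
  proof cases
    case 1
    then show ?thesis
      using new_resmoothing(1,2)[where c = 0 and k = m2 and s = s] by (cases m2) (simp_all add: s same_circle_hopf)
  next
    case 2
    then show ?thesis
      using new_resmoothing(1,2)[where c = 1 and k = m1 and s = s] by (cases m1) (simp_all add: s same_circle_hopf)
  next
    case (3 k)
    let ?Z = "extra m1 m2"
    note old = opposite_old[OF 3(2), folded 3(1)]
    have out: "?p \<in> A'" "?p \<notin> ?Z" "?q \<in> A'" "?q \<notin> ?Z"
      using old(3,4) extra_disjoint[of m1 m2] A'_members by auto
    note lift = lift_rel_join_old[OF same_circle_equiv out(1,2) old(1) out(3,4) old(2)]
    have "s'[c := x] = m1 # m2 # s[k := x]" for x by (simp add: s 3)
    then show ?thesis
      using resmoothing[OF 3(2) s(2)] lift[of D "s[k := True]"] lift[of D "s[k := False]"]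
      by (auto simp: same_circle_hopf)
  qed
qed

end

sublocale hopf \<subseteq> H: resmoothable D'
  by (rule hopf_resmoothable)

section \<open>Six blocks of enhanced states\<close>

lemma filter_image:
  assumes "\<And>x. x \<in> X \<Longrightarrow> Q (f x) \<longleftrightarrow> R x"
  shows "{y \<in> f ` X. Q y} = f ` {x \<in> X. R x}"
  using assms by auto

context hopf
begin

definition lift_circle :: "'a set \<Rightarrow> 'a set \<Rightarrow> 'a set" where
  "lift_circle Z C = {x \<in> A'. x \<notin> Z \<and> retract x \<in> C}"

text \<open>
  For each choice of the new markers and of the sign \<open>x\<close> of the extra circle, the enhanced states of \<open>D'\<close> are a copy of the
  enhanced states of \<open>D\<close>.  The choice is valid if \<open>m1 = m2 \<or> \<not> x\<close>; without an extra circle \<open>x = False\<close> by convention.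
  This leaves six blocks, and a chain of \<open>D'\<close> is a sixtuple of chains of \<open>D\<close>.
\<close>

definition hopf_state :: "bool \<Rightarrow> bool \<Rightarrow> bool \<Rightarrow> 'a enhanced_state \<Rightarrow> 'a enhanced_state" where
  "hopf_state m1 m2 x = (\<lambda>(s, P).
     (m1 # m2 # s, lift_circle (extra m1 m2) ` P \<union> (if x then {extra m1 m2} else {})))"

definition component :: "bool \<Rightarrow> bool \<Rightarrow> bool \<Rightarrow> 'a int_chain \<Rightarrow> 'a int_chain" where
  "component m1 m2 x f' = (\<lambda>S. if S \<in> enhanced_states D then f' (hopf_state m1 m2 x S) else 0)"

definition assemble :: "(bool \<Rightarrow> bool \<Rightarrow> bool \<Rightarrow> 'a int_chain) \<Rightarrow> 'a int_chain" where
  "assemble g = (\<lambda>(s', P'). if (s', P') \<in> enhanced_states D'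
     then g (s' ! 0) (s' ! 1) (extra (s' ! 0) (s' ! 1) \<in> P') (drop 2 s', (\<lambda>C. C \<inter> A) ` P' - {{}})
     else 0)"

lemma length_crossings' [simp]: "length (crossings D') = Suc (Suc n)"
  by (simp add: crossings' length_xs)

lemma lift_circle_Int: "Z \<inter> A = {} \<Longrightarrow> C \<subseteq> A \<Longrightarrow> lift_circle Z C \<inter> A = C"
  using A'_members(6) by (auto simp: lift_circle_def)

lemma circle_subset: "C \<in> circles D s \<Longrightarrow> C \<subseteq> A \<and> C \<noteq> {}"
  using closed[of s] equivD(1)[OF same_circle_equiv[of D s]] by (auto simp: circles_altdef quotient_def)

lemma extra_Int: "extra m1 m2 \<inter> A = {}"
  using extra_disjoint by blast

lemma lift_rel_class:
  assumes "equiv UNIV F" "Z \<subseteq> A'" "x \<in> A'"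
  shows "lift_rel Z F `` {x} = (if x \<in> Z then Z else lift_circle Z (F `` {retract x}))"
proof -
  have "(retract x, retract x) \<in> F" using equivD(1)[OF assms(1)] .
  then show ?thesis using assms(2,3) by (auto simp: lift_rel_def lift_circle_def)
qed

lemma quotient_lift_rel:
  assumes "equiv UNIV F" "Z \<subseteq> A'" "Z \<inter> A = {}"
  shows "A' // lift_rel Z F = lift_circle Z ` (A // F) \<union> (if Z = {} then {} else {Z})"
proof (intro equalityI subsetI)
  fix C assume "C \<in> A' // lift_rel Z F"
  then obtain x where "x \<in> A'" "C = lift_rel Z F `` {x}" by (auto simp: quotient_def)
  then show "C \<in> lift_circle Z ` (A // F) \<union> (if Z = {} then {} else {Z})"
    using lift_rel_class[OF assms(1,2)] quotientI[OF retract_in, of F] by auto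
next
  fix C assume "C \<in> lift_circle Z ` (A // F) \<union> (if Z = {} then {} else {Z})"
  then consider y where "y \<in> A" "C = lift_circle Z (F `` {y})" | z where "z \<in> Z" "C = Z"
    by (auto simp: quotient_def split: if_splits)
  then show "C \<in> A' // lift_rel Z F"
  proof cases
    case 1
    then have "C = lift_rel Z F `` {y}" using lift_rel_class[OF assms(1,2), of y] assms(3) A'_members(6) by auto
    then show ?thesis using quotientI A'_members(6) 1 by metis
  next
    case 2
    then have "C = lift_rel Z F `` {z}" using lift_rel_class[OF assms(1,2), of z] assms(2) by auto
    then show ?thesis using quotientI 2 assms(2) by (metis subsetD)
  qed
qed

lemma circles_hopf:
  "circles D' (m1 # m2 # s) = lift_circle (extra m1 m2) ` circles D s \<union> (if m1 = m2 then {extra m1 m2} else {})"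
proof -
  have "extra m1 m2 = {} \<longleftrightarrow> m1 \<noteq> m2" by (auto simp: extra_def)
  then show ?thesis
    unfolding circles_altdef same_circle_hopf
    by (simp add: quotient_lift_rel[OF same_circle_equiv extra_subset extra_Int])
qed

lemma inj_lift_circle:
  assumes "Z \<inter> A = {}"
  shows "inj_on (lift_circle Z) (Pow A)"
  by (rule inj_onI) (metis PowD lift_circle_Int[OF assms])

lemma extra_not_lift: "C \<in> circles D s \<Longrightarrow> lift_circle (extra m1 m2) C \<noteq> extra m1 m2"
  using circle_subset lift_circle_Int[OF extra_Int] extra_Int by metis

lemma hopf_state_enhanced:
  assumes "S \<in> enhanced_states D" "m1 = m2 \<or> \<not> x"
  shows "hopf_state m1 m2 x S \<in> enhanced_states D'"
  using assms
  by (cases S) (auto simp: hopf_state_def enhanced_state_iff H.enhanced_state_iff circles_hopf)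

lemma hopf_state_decode:
  assumes "(s, P) \<in> enhanced_states D"
  shows "(\<lambda>C. C \<inter> A) ` snd (hopf_state m1 m2 x (s, P)) - {{}} = P"
    and "extra m1 m2 \<in> snd (hopf_state m1 m2 x (s, P)) \<longleftrightarrow> x"
proof -
  have P: "P \<subseteq> circles D s" using assms by (simp add: enhanced_state_iff)
  have "(\<lambda>C. C \<inter> A) ` lift_circle (extra m1 m2) ` P = P"
  proof -
    have "lift_circle (extra m1 m2) C \<inter> A = C" if "C \<in> P" for C
      using subsetD[OF P that] circle_subset lift_circle_Int[OF extra_Int] by blast
    then show ?thesis by (simp add: image_image cong: image_cong)
  qed
  moreover have "{} \<notin> P" using P circle_subset by blast
  ultimately show "(\<lambda>C. C \<inter> A) ` snd (hopf_state m1 m2 x (s, P)) - {{}} = P"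
    by (simp add: hopf_state_def image_Un extra_Int)
  show "extra m1 m2 \<in> snd (hopf_state m1 m2 x (s, P)) \<longleftrightarrow> x"
  proof -
    have "extra m1 m2 \<notin> lift_circle (extra m1 m2) ` P"
      using P extra_not_lift[of _ s m1 m2] by (metis imageE subsetD)
    then show ?thesis by (simp add: hopf_state_def)
  qed
qed

lemma enhanced_states_hopf:
  assumes "S' \<in> enhanced_states D'"
  obtains m1 m2 x S where "S \<in> enhanced_states D" "m1 = m2 \<or> \<not> x" "S' = hopf_state m1 m2 x S"
proof -
  obtain s' P' where S': "S' = (s', P')" by (cases S')
  then have len: "length s' = Suc (Suc n)" and P': "P' \<subseteq> circles D' s'"
    using assms by (auto simp: H.enhanced_state_iff)
  obtain m1 m2 s where s: "s' = m1 # m2 # s" "length s = n" using len by (metis length_Suc_conv)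
  let ?Z = "extra m1 m2"
  define P where "P = {C \<in> circles D s. lift_circle ?Z C \<in> P'}"
  have "P' = lift_circle ?Z ` P \<union> (if m1 = m2 \<and> ?Z \<in> P' then {?Z} else {})"
    using P' unfolding s circles_hopf P_def by (auto split: if_splits)
  then have "S' = hopf_state m1 m2 (m1 = m2 \<and> ?Z \<in> P') (s, P)"
    by (simp add: S' s hopf_state_def)
  moreover have "(s, P) \<in> enhanced_states D" using s by (auto simp: enhanced_state_iff P_def)
  ultimately show thesis using that[of "(s, P)" m1 m2 "m1 = m2 \<and> ?Z \<in> P'"] by blast
qed

lemma assemble_hopf_state:
  assumes "S \<in> enhanced_states D" "m1 = m2 \<or> \<not> x"
  shows "assemble g (hopf_state m1 m2 x S) = g m1 m2 x S"
proof -
  obtain s P where S: "S = (s, P)" by (cases S)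
  obtain P' where P': "hopf_state m1 m2 x (s, P) = (m1 # m2 # s, P')" by (simp add: hopf_state_def)
  then show ?thesis
    using hopf_state_enhanced[OF assms] hopf_state_decode[of s P m1 m2 x] assms(1)
    by (simp add: S assemble_def)
qed

lemma component_assemble:
  assumes "supported D (g m1 m2 x)" "m1 = m2 \<or> \<not> x"
  shows "component m1 m2 x (assemble g) = g m1 m2 x"
  using assms by (auto simp: component_def assemble_hopf_state supported_def)

lemma supported_component: "supported D (component m1 m2 x f')"
  by (simp add: supported_def component_def)

lemma supported_assemble: "supported D' (assemble g)"
  by (auto simp: supported_def assemble_def)

lemma hopf_chain_eqI:
  assumes "supported D' f'" "supported D' g'"
    and "\<And>m1 m2 x. m1 = m2 \<or> \<not> x \<Longrightarrow> component m1 m2 x f' = component m1 m2 x g'"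
  shows "f' = g'"
proof
  fix S' show "f' S' = g' S'"
  proof (cases "S' \<in> enhanced_states D'")
    case True
    then obtain m1 m2 x S where *: "S \<in> enhanced_states D" "m1 = m2 \<or> \<not> x" "S' = hopf_state m1 m2 x S"
      by (rule enhanced_states_hopf)
    then show ?thesis using fun_cong[OF assms(3)[OF *(2)], of S] by (simp add: component_def)
  next
    case False
    then show ?thesis using assms(1,2) unfolding supported_def by metis
  qed
qed

lemma state_sigma_hopf_state:
  "state_sigma (hopf_state m1 m2 x S) = state_sigma S + (if m1 then 1 else -1) + (if m2 then 1 else -1)"
  by (cases S) (simp add: state_sigma_def hopf_state_def)

lemma state_tau_hopf_state:
  assumes "S \<in> enhanced_states D" "m1 = m2 \<or> \<not> x"
  shows "state_tau D' (hopf_state m1 m2 x S) = state_tau D S + (if m1 = m2 then if x then 1 else -1 else 0)"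
proof -
  obtain s P where S: "S = (s, P)" by (cases S)
  let ?Z = "extra m1 m2"
  let ?P' = "lift_circle ?Z ` P \<union> (if x then {?Z} else {})"
  have P: "P \<subseteq> circles D s" using assms(1) by (simp add: S enhanced_state_iff)
  have sub: "circles D s \<subseteq> Pow A" using circle_subset by blast
  have fin: "finite P" "finite (circles D s)" using finite_subset[OF P finite_circles] finite_circles by auto
  have cards: "card (lift_circle ?Z ` P) = card P" "card (lift_circle ?Z ` circles D s) = card (circles D s)"
    using P sub inj_on_subset[OF inj_lift_circle[OF extra_Int]] by (auto intro!: card_image)
  have notin: "?Z \<notin> lift_circle ?Z ` circles D s"
  proof
    assume "?Z \<in> lift_circle ?Z ` circles D s"
    then obtain C where "C \<in> circles D s" "lift_circle ?Z C = ?Z" by (metis imageE)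
    then show False using extra_not_lift by blast
  qed
  then have notin': "?Z \<notin> lift_circle ?Z ` P" using image_mono[OF P, of "lift_circle ?Z"] by blast
  have "?P' \<subseteq> circles D' (m1 # m2 # s)" using P assms(2) unfolding circles_hopf by auto
  moreover have "card ?P' = card P + (if x then 1 else 0)"
    using cards notin' fin by simp
  moreover have "card (circles D' (m1 # m2 # s)) = card (circles D s) + (if m1 = m2 then 1 else 0)"
    unfolding circles_hopf using cards notin fin by (cases "m1 = m2") simp_all
  ultimately show ?thesis
    using assms(2) by (auto simp: S hopf_state_def H.state_tau_eq state_tau_eq[OF P])
qed

lemma alpha_state_eq: "S \<in> enhanced_states D \<Longrightarrow> alpha_state D D' S = hopf_state False False False S"
proof -
  assume "S \<in> enhanced_states D"
  then obtain s P where S: "S = (s, P)" "P \<subseteq> circles D s" by (cases S) (auto simp: enhanced_state_iff)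
  let ?Z = "extra False False"
  have "{C \<in> circles D' (False # False # s). C \<inter> A \<noteq> {} \<and> C \<inter> A \<in> P} = lift_circle ?Z ` P"
    unfolding circles_hopf
  proof -
    have "lift_circle ?Z C \<inter> A = C \<and> C \<noteq> {}" if "C \<in> circles D s" for C
      using circle_subset[OF that] lift_circle_Int[OF extra_Int] by blast
    then show "{C \<in> lift_circle ?Z ` circles D s \<union> (if False = False then {?Z} else {}). C \<inter> A \<noteq> {} \<and> C \<inter> A \<in> P} =
        lift_circle ?Z ` P"
      using S(2) extra_Int[of False False] by auto
  qed
  then show ?thesis by (simp add: alpha_state_def S hopf_state_def Let_def)
qed

lemma beta_state_eq:
  assumes "S \<in> enhanced_states D" "m1 = m2 \<or> \<not> x"
  shows "beta_state D (hopf_state m1 m2 x S) = (if m1 \<and> m2 \<and> x then Some S else None)"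
proof -
  obtain s P where S: "S = (s, P)" by (cases S)
  obtain P' where P': "hopf_state m1 m2 x (s, P) = (m1 # m2 # s, P')" by (simp add: hopf_state_def)
  have P: "P \<subseteq> circles D s" using assms(1) by (simp add: S enhanced_state_iff)
  have dec: "(\<lambda>C. C \<inter> A) ` P' - {{}} = P"
    using hopf_state_decode(1)[of s P m1 m2 x] assms(1) P' S by simp
  have "(\<exists>C\<in>P'. C \<inter> A = {}) \<longleftrightarrow> x"
  proof -
    have "P' = lift_circle (extra m1 m2) ` P \<union> (if x then {extra m1 m2} else {})"
      using P' by (simp add: hopf_state_def)
    moreover have "lift_circle (extra m1 m2) C \<inter> A \<noteq> {}" if "C \<in> P" for C
      using that P circle_subset lift_circle_Int[OF extra_Int] by (metis subsetD)
    ultimately show ?thesis using extra_Int by auto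
  qed
  moreover have "{C \<inter> A | C. C \<in> P' \<and> C \<inter> A \<noteq> {}} = P" using dec by blast
  ultimately show ?thesis by (auto simp: S P' beta_state_def)
qed

text \<open>
  The arc \<open>m\<close> lies on the extra circle for both pairs of equal markers.  A transversal of circles of \<open>D\<close> is completed by \<open>m\<close> if the
  extra circle exists and is negative.
\<close>

definition marked :: "bool \<Rightarrow> bool \<Rightarrow> bool \<Rightarrow> 'a set \<Rightarrow> 'a set" where
  "marked m1 m2 x T = (if m1 = m2 \<and> \<not> x then insert m T else T)"

lemma m_in_extra: "m \<in> extra m1 m1" by (simp add: extra_def)

lemma transversal_marked:
  assumes "T \<subseteq> A"
  shows "transversal (lift_rel (extra m1 m2) F) (marked m1 m2 x T) \<longleftrightarrow> transversal F T"
proof -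
  let ?Z = "extra m1 m2"
  have T: "u \<in> A'" "u \<notin> ?Z" "retract u = u" "u \<noteq> m" if "u \<in> T" for u
    using that assms A'_members(6) extra_Int[of m1 m2] new_arcs by auto
  have "(u, v) \<in> lift_rel ?Z F \<longleftrightarrow> u = v \<or> (u, v) \<in> F" if "u \<in> T" "v \<in> T" for u v
    using T[OF that(1)] T[OF that(2)] by (auto simp: lift_rel_def)
  then have "transversal (lift_rel ?Z F) T \<longleftrightarrow> transversal F T" by (auto simp: transversal_def)
  moreover have "(u, m) \<notin> lift_rel ?Z F" "(m, u) \<notin> lift_rel ?Z F" if "u \<in> T" "m1 = m2" for u
    using T[OF that(1)] m_in_extra[of m1] that(2) by (auto simp: lift_rel_def)
  ultimately show ?thesis by (auto simp: marked_def transversal_def)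
qed

lemma missed_marked:
  assumes "T \<subseteq> A" and s: "length s = n" and x: "m1 = m2 \<or> \<not> x"
  shows "(m1 # m2 # s, missed A' (lift_rel (extra m1 m2) (E s)) (marked m1 m2 x T)) =
    hopf_state m1 m2 x (s, missed A (E s) T)"
proof -
  let ?Z = "extra m1 m2"
  have "missed A' (lift_rel ?Z (E s)) (marked m1 m2 x T) =
      {C \<in> lift_circle ?Z ` circles D s \<union> (if m1 = m2 then {?Z} else {}). C \<inter> marked m1 m2 x T = {}}"
    unfolding missed_def same_circle_hopf[symmetric] circles_altdef[symmetric] circles_hopf ..
  also have "\<dots> = {C \<in> lift_circle ?Z ` circles D s. C \<inter> marked m1 m2 x T = {}} \<union>
      {C \<in> (if m1 = m2 then {?Z} else {}). C \<inter> marked m1 m2 x T = {}}"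
    by blast
  also have "{C \<in> (if m1 = m2 then {?Z} else {}). C \<inter> marked m1 m2 x T = {}} = (if x then {?Z} else {})"
  proof -
    have "?Z \<inter> marked m1 m2 x T = {} \<longleftrightarrow> x" if "m1 = m2"
      using that assms(1) extra_Int[of m1 m2] m_in_extra[of m1] by (auto simp: marked_def)
    then show ?thesis using x by (cases "m1 = m2") auto
  qed
  also have "{C \<in> lift_circle ?Z ` circles D s. C \<inter> marked m1 m2 x T = {}} =
      lift_circle ?Z ` {C \<in> circles D s. C \<inter> T = {}}"
  proof (rule filter_image)
    fix C assume C: "C \<in> circles D s"
    have "lift_circle ?Z C \<inter> A = C" using circle_subset[OF C] lift_circle_Int[OF extra_Int] by blast
    moreover have "m1 = m2 \<Longrightarrow> m \<notin> lift_circle ?Z C" using m_in_extra by (auto simp: lift_circle_def)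
    ultimately show "lift_circle ?Z C \<inter> marked m1 m2 x T = {} \<longleftrightarrow> C \<inter> T = {}"
      using assms(1) by (auto simp: marked_def)
  qed
  finally show ?thesis by (simp add: hopf_state_def missed_def circles_altdef)
qed

text \<open>
  The encodings by transversals of a chain of \<open>D'\<close> and of its components in the blocks agree.
\<close>

lemma evaluation_component:
  assumes "T \<subseteq> A" "length s = n" "m1 = m2 \<or> \<not> x"
  shows "evaluation D (component m1 m2 x f') s T = evaluation D' f' (m1 # m2 # s) (marked m1 m2 x T)"
proof -
  have "(s, missed A (E s) T) \<in> enhanced_states D"
    using assms(2) by (auto simp: enhanced_state_iff circles_altdef missed_def)
  then show ?thesis
    by (simp add: evaluation_def at_transversal_def same_circle_hopf transversal_marked[OF assms(1)]
        missed_marked[OF assms] component_def)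
qed

end

section \<open>The differential in blocks\<close>

lemma later_negatives_Cons: "later_negatives (k # s) (Suc c) = later_negatives s c"
proof -
  have "{i. Suc c < i \<and> i < length (k # s) \<and> \<not> (k # s) ! i} = Suc ` {i. c < i \<and> i < length s \<and> \<not> s ! i}"
  proof (intro equalityI subsetI)
    fix i assume "i \<in> {i. Suc c < i \<and> i < length (k # s) \<and> \<not> (k # s) ! i}"
    then show "i \<in> Suc ` {i. c < i \<and> i < length s \<and> \<not> s ! i}" by (cases i) auto
  qed auto
  then show ?thesis unfolding later_negatives_def by (simp add: card_image)
qed

lemma later_negatives_0: "later_negatives (k # s) 0 = length (filter Not s)"
proof -
  have "{i. 0 < i \<and> i < length (k # s) \<and> \<not> (k # s) ! i} = Suc ` {i. i < length s \<and> \<not> s ! i}"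
  proof (intro equalityI subsetI)
    fix i assume "i \<in> {i. 0 < i \<and> i < length (k # s) \<and> \<not> (k # s) ! i}"
    then show "i \<in> Suc ` {i. i < length s \<and> \<not> s ! i}" by (cases i) auto
  qed auto
  then show ?thesis by (simp add: later_negatives_def card_image length_filter_conv_card)
qed

lemma sum_old_and_new_negatives:
  fixes F :: "nat \<Rightarrow> int"
  shows "(\<Sum>c | c < Suc (Suc n) \<and> \<not> (m1 # m2 # s) ! c. F c) =
    (if m1 then 0 else F 0) + (if m2 then 0 else F 1) + (\<Sum>c | c < n \<and> \<not> s ! c. F (Suc (Suc c)))"
proof -
  let ?N = "{c. c < n \<and> \<not> s ! c}"
  have N: "{c. c < Suc (Suc n) \<and> \<not> (m1 # m2 # s) ! c} =
      (if m1 then {} else {0}) \<union> ((if m2 then {} else {1}) \<union> (\<lambda>c. Suc (Suc c)) ` ?N)"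
  proof (intro equalityI subsetI)
    fix c assume "c \<in> {c. c < Suc (Suc n) \<and> \<not> (m1 # m2 # s) ! c}"
    then have c: "c < Suc (Suc n)" "\<not> (m1 # m2 # s) ! c" by auto
    show "c \<in> (if m1 then {} else {0}) \<union> ((if m2 then {} else {1}) \<union> (\<lambda>c. Suc (Suc c)) ` ?N)"
    proof (cases c)
      case 0
      then show ?thesis using c by simp
    next
      case (Suc d)
      then show ?thesis using c by (cases d) simp_all
    qed
  qed (auto split: if_splits)
  have "(\<Sum>c\<in>(\<lambda>c. Suc (Suc c)) ` ?N. F c) = (\<Sum>c\<in>?N. F (Suc (Suc c)))"
    by (subst sum.reindex) (auto simp: inj_on_def)
  then show ?thesis
    unfolding N by (subst sum.union_disjoint, simp, simp, force, subst sum.union_disjoint) auto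
qed

lemma evaluation_add: "evaluation D (\<lambda>S. f S + g S) s T = evaluation D f s T + evaluation D g s T"
  by (simp add: evaluation_def at_transversal_def)

lemma evaluation_diff: "evaluation D (\<lambda>S. f S - g S) s T = evaluation D f s T - evaluation D g s T"
  by (simp add: evaluation_def at_transversal_def)

lemma evaluation_alternate: "evaluation D (alternate f) s T = (-1) ^ length (filter Not s) * evaluation D f s T"
  by (simp add: evaluation_def at_transversal_def alternate_def)

context hopf
begin

lemma mult_X_marked:
  assumes "T \<subseteq> A" "length s = n" "m1 = m2 \<or> \<not> x" "p \<in> A"
  shows "mult_X p (evaluation D' f' (m1 # m2 # s)) (marked m1 m2 x T) =
    mult_X p (evaluation D (component m1 m2 x f') s) T"
proof -
  have "p \<in> marked m1 m2 x T \<longleftrightarrow> p \<in> T" using assms(4) new_arcs by (auto simp: marked_def)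
  moreover have "insert p (marked m1 m2 x T) = marked m1 m2 x (insert p T)"
    by (auto simp: marked_def)
  ultimately show ?thesis
    using evaluation_component[of "insert p T" s m1 m2 x f'] assms by (simp add: mult_X_def)
qed

lemma mult_X_same_circle:
  assumes "(p, q) \<in> same_circle D0 s"
  shows "mult_X p (evaluation D0 f s) T = mult_X q (evaluation D0 f s) T"
  unfolding evaluation_def by (rule mult_X_same_class[OF same_circle_equiv assms])

text \<open>
  At a crossing of \<open>D\<close> the ends may be relabelled from \<open>e\<close> to \<open>r\<close>, but these arcs lie on the same circle.
\<close>

lemma resmoothing_map_old:
  assumes "c < n" "T \<subseteq> A" "length s = n" "m1 = m2 \<or> \<not> x"
  shows "resmoothing_map D' (Suc (Suc c)) (m1 # m2 # s) (evaluation D' f' (m1 # m2 # s)) (marked m1 m2 x T) =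
    resmoothing_map D c s (evaluation D (component m1 m2 x f') s) T"
proof -
  let ?p = "opposite_a D' (Suc (Suc c))" and ?q = "opposite_c D' (Suc (Suc c))"
  let ?Z = "extra m1 m2"
  note old = opposite_old[OF assms(1)]
  have out: "?p \<in> A'" "?p \<notin> ?Z" "?q \<in> A'" "?q \<notin> ?Z"
    using old(3,4) extra_disjoint[of m1 m2] A'_members by auto
  have pq: "pa c \<in> A" "pc c \<in> A" "pa c \<in> A'" "pc c \<in> A'" "pa c \<notin> ?Z" "pc c \<notin> ?Z"
    using opposite_arcs[OF assms(1)] A'_members extra_Int[of m1 m2] by auto
  have refl: "(y, y) \<in> E s" for y by (rule equivD(1)[OF same_circle_equiv])
  have same: "(?p, pa c) \<in> same_circle D' (m1 # m2 # s)" "(?q, pc c) \<in> same_circle D' (m1 # m2 # s)"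
    unfolding same_circle_hopf using out pq old refl by (auto simp: lift_rel_def)
  have "mult_X ?p (evaluation D' f' (m1 # m2 # s)) U = mult_X (pa c) (evaluation D' f' (m1 # m2 # s)) U"
    "mult_X ?q (evaluation D' f' (m1 # m2 # s)) U = mult_X (pc c) (evaluation D' f' (m1 # m2 # s)) U" for U
    by (rule mult_X_same_circle[OF same(1)], rule mult_X_same_circle[OF same(2)])
  moreover have "(?p, ?q) \<in> same_circle D' (m1 # m2 # s) \<longleftrightarrow> (pa c, pc c) \<in> E s"
    unfolding same_circle_hopf
    by (rule lift_rel_join_old(1)[OF same_circle_equiv out(1,2) old(1) out(3,4) old(2)])
  ultimately show ?thesis
    using mult_X_marked[OF assms(2-4) pq(1)] mult_X_marked[OF assms(2-4) pq(2)] evaluation_component[OF assms(2-4), of f']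
    by (simp add: resmoothing_map_def)
qed

text \<open>
  The circle of \<open>e\<close> and the extra circle are merged, so the factor is the sum of their variables.  The variable of the extra
  circle turns its sign.
\<close>

lemma resmoothing_map_merge_extra:
  assumes c: "c \<in> {0, 1}" and T: "T \<subseteq> A" and s: "length s = n"
  shows "resmoothing_map D' c (True # True # s) (evaluation D' f' (True # True # s)) T =
    evaluation D (multiplication_by_X D e (component True True True f')) s T +
    evaluation D (component True True False f') s T"
proof -
  let ?p = "opposite_a D' c" and ?q = "opposite_c D' c" and ?\<phi> = "evaluation D' f' (True # True # s)"
  have refl: "(y, y) \<in> E s" for y by (rule equivD(1)[OF same_circle_equiv])
  have "retract ?p = e" using opposite_new(1)[OF c] retract_simps(1,5) by (metis insertE singletonD)
  then have same: "(?p, e) \<in> same_circle D' (True # True # s)" "(?q, m) \<in> same_circle D' (True # True # s)"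
    unfolding same_circle_hopf
    using opposite_new(1,2)[OF c] A'_members new_arcs refl[of e] by (auto simp: lift_rel_def extra_def)
  have "mult_X ?p ?\<phi> T = mult_X e ?\<phi> T" "mult_X ?q ?\<phi> T = mult_X m ?\<phi> T"
    by (rule mult_X_same_circle[OF same(1)], rule mult_X_same_circle[OF same(2)])
  moreover have "(?p, ?q) \<notin> same_circle D' (True # True # s)"
    unfolding same_circle_hopf by (rule new_resmoothing(1)[OF c])
  moreover have "mult_X e ?\<phi> T = evaluation D (multiplication_by_X D e (component True True True f')) s T"
    using mult_X_marked[OF T s _ e, of True True True f']
    by (simp add: evaluation_multiplication_by_X[OF e] marked_def)
  moreover have "mult_X m ?\<phi> T = evaluation D (component True True False f') s T"
    using evaluation_component[OF T s, of True True False f'] T new_arcs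
    by (auto simp: mult_X_def marked_def)
  ultimately show ?thesis by (simp add: resmoothing_map_def)
qed

text \<open>
  The extra circle is split off from the circle of \<open>e\<close>.  Before the split the arc \<open>m\<close> is on the circle of \<open>e\<close>, so
  that inserting it into a transversal is multiplication by the variable of \<open>e\<close>.
\<close>

lemma resmoothing_map_split_extra:
  assumes c: "c \<in> {0, 1}" and T: "T \<subseteq> A" and s: "length s = n" and mixed: "m1 \<noteq> m2"
  shows "resmoothing_map D' c (m1 # m2 # s) (evaluation D' f' (m1 # m2 # s)) (marked False False x T) =
    (if x then evaluation D (component m1 m2 False f') s T
     else evaluation D (multiplication_by_X D e (component m1 m2 False f')) s T)"
proof -
  let ?\<phi> = "evaluation D' f' (m1 # m2 # s)"
  have Z: "extra m1 m2 = {}" using mixed by (simp add: extra_def)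
  have "(opposite_a D' c, opposite_c D' c) \<in> same_circle D' (m1 # m2 # s)"
    unfolding same_circle_hopf Z by (rule new_resmoothing(3)[OF c])
  then have "resmoothing_map D' c (m1 # m2 # s) ?\<phi> U = ?\<phi> U" for U
    by (simp add: resmoothing_map_def)
  moreover have "?\<phi> T = evaluation D (component m1 m2 False f') s T"
    using evaluation_component[OF T s, of m1 m2 False f'] mixed by (simp add: marked_def)
  moreover have "?\<phi> (insert m T) = evaluation D (multiplication_by_X D e (component m1 m2 False f')) s T"
  proof -
    have "?\<phi> (insert m T) = mult_X m ?\<phi> T" using T new_arcs by (auto simp: mult_X_def)
    also have "\<dots> = mult_X e ?\<phi> T"
    proof (rule mult_X_same_circle)
      show "(m, e) \<in> same_circle D' (m1 # m2 # s)"
        unfolding same_circle_hopf Z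
        using A'_members equivD(1)[OF same_circle_equiv[of D s], of e] by (simp add: lift_rel_def)
    qed
    also have "\<dots> = mult_X e (evaluation D (component m1 m2 False f') s) T"
      using mult_X_marked[OF T s _ e, of m1 m2 False f'] mixed by (simp add: marked_def)
    finally show ?thesis by (simp add: evaluation_multiplication_by_X[OF e])
  qed
  ultimately show ?thesis by (simp add: marked_def)
qed

lemma evaluation_component_differential:
  assumes T: "T \<subseteq> A" and s: "length s = n" and x: "m1 = m2 \<or> \<not> x"
  shows "evaluation D (component m1 m2 x (int_differential D' f')) s T =
    evaluation D (int_differential D (component m1 m2 x f')) s T +
    (if m1 then 0 else (-1) ^ length (filter Not (m2 # s)) *
      resmoothing_map D' 0 (True # m2 # s) (evaluation D' f' (True # m2 # s)) (marked m1 m2 x T)) +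
    (if m2 then 0 else (-1) ^ length (filter Not s) *
      resmoothing_map D' 1 (m1 # True # s) (evaluation D' f' (m1 # True # s)) (marked m1 m2 x T))"
proof -
  have "length (m1 # m2 # s) = length (crossings D')" using s by simp
  note H.evaluation_differential[OF this, of f' "marked m1 m2 x T"]
  moreover have "(\<Sum>c | c < n \<and> \<not> s ! c. (-1) ^ later_negatives s c *
      resmoothing_map D' (Suc (Suc c)) (m1 # m2 # s[c := True])
        (evaluation D' f' (m1 # m2 # s[c := True])) (marked m1 m2 x T)) =
      evaluation D (int_differential D (component m1 m2 x f')) s T"
    unfolding evaluation_differential[OF s]
    by (intro sum.cong refl arg_cong2[of _ _ _ _ "(*)"] resmoothing_map_old) (use T s x in auto)
  ultimately show ?thesis
    unfolding evaluation_component[OF T s x]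
    by (simp add: sum_old_and_new_negatives later_negatives_Cons later_negatives_0)
qed

lemma supported_add: "supported D0 f \<Longrightarrow> supported D0 g \<Longrightarrow> supported D0 (\<lambda>S. f S + g S)"
  and supported_diff: "supported D0 f \<Longrightarrow> supported D0 g \<Longrightarrow> supported D0 (\<lambda>S. f S - g S)"
  and supported_uminus: "supported D0 f \<Longrightarrow> supported D0 (\<lambda>S. - f S)"
  and supported_zero: "supported D0 (\<lambda>S. 0)"
  and supported_alternate: "supported D0 f \<Longrightarrow> supported D0 (alternate f)"
  by (auto simp: supported_def alternate_def)

lemmas supported_intros = supported_add supported_diff supported_uminus supported_zero supported_alternate
  supported_component supported_differential supported_multiplication_by_X[OF e]

text \<open>
  With the components \<open>V\<close>, \<open>W\<close> for two positive markers (extra circle positive, negative), \<open>p\<close> for markers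
  \<open>-+\<close>, \<open>q\<close> for \<open>+-\<close>, and \<open>V'\<close>, \<open>W'\<close> for two negative markers, the components of the differential are \<open>dV\<close>, \<open>dW\<close>,
  \<open>dp + \<epsilon>(XV + W)\<close>, \<open>dq + \<epsilon>(XV + W)\<close>, \<open>dV' + \<epsilon>(p - q)\<close>, \<open>dW' + \<epsilon>(Xp - Xq)\<close>.
\<close>

lemma component_differential:
  "component True True x (int_differential D' f') = int_differential D (component True True x f')"
  "component False True False (int_differential D' f') = (\<lambda>S. int_differential D (component False True False f') S +
     alternate (\<lambda>S. multiplication_by_X D e (component True True True f') S + component True True False f' S) S)"
  "component True False False (int_differential D' f') = (\<lambda>S. int_differential D (component True False False f') S +
     alternate (\<lambda>S. multiplication_by_X D e (component True True True f') S + component True True False f' S) S)"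
  "component False False True (int_differential D' f') = (\<lambda>S. int_differential D (component False False True f') S +
     alternate (\<lambda>S. component False True False f' S - component True False False f' S) S)"
  "component False False False (int_differential D' f') = (\<lambda>S. int_differential D (component False False False f') S +
     alternate (\<lambda>S. multiplication_by_X D e (component False True False f') S -
       multiplication_by_X D e (component True False False f') S) S)"
proof -
  note simps = evaluation_component_differential evaluation_add evaluation_diff evaluation_alternate
  have unmarked: "marked False True False T = T" "marked True False False T = T" for T
    by (simp_all add: marked_def)
  show "component True True x (int_differential D' f') = int_differential D (component True True x f')"
    by (rule chain_eqI) (intro supported_intros, intro supported_intros, simp add: simps)
  show "component False True False (int_differential D' f') = (\<lambda>S. int_differential D (component False True False f') S +
     alternate (\<lambda>S. multiplication_by_X D e (component True True True f') S + component True True False f' S) S)"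
    by (rule chain_eqI) (intro supported_intros, intro supported_intros,
        simp add: simps unmarked resmoothing_map_merge_extra)
  show "component True False False (int_differential D' f') = (\<lambda>S. int_differential D (component True False False f') S +
     alternate (\<lambda>S. multiplication_by_X D e (component True True True f') S + component True True False f' S) S)"
    by (rule chain_eqI) (intro supported_intros, intro supported_intros,
        simp add: simps unmarked resmoothing_map_merge_extra)
  show "component False False True (int_differential D' f') = (\<lambda>S. int_differential D (component False False True f') S +
     alternate (\<lambda>S. component False True False f' S - component True False False f' S) S)"
    by (rule chain_eqI) (intro supported_intros, intro supported_intros,
        simp add: simps resmoothing_map_split_extra algebra_simps)
  show "component False False False (int_differential D' f') = (\<lambda>S. int_differential D (component False False False f') S +
     alternate (\<lambda>S. multiplication_by_X D e (component False True False f') S -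
       multiplication_by_X D e (component True False False f') S) S)"
    by (rule chain_eqI) (intro supported_intros, intro supported_intros,
        simp add: simps resmoothing_map_split_extra algebra_simps)
qed

end

section \<open>Splittings and a contracting homotopy\<close>

definition homogeneous :: "'a diagram \<Rightarrow> int \<Rightarrow> int \<Rightarrow> 'a int_chain \<Rightarrow> bool" where
  "homogeneous D i j f \<longleftrightarrow> (\<forall>S. f S \<noteq> 0 \<longrightarrow> S \<in> generators D i j)"

lemma homogeneous_supported: "homogeneous D i j f \<Longrightarrow> supported D f"
  by (auto simp: homogeneous_def supported_def generators_def)

lemma homogeneousD: "homogeneous D i j f \<Longrightarrow> f S \<noteq> 0 \<Longrightarrow> S \<in> generators D i j"
  unfolding homogeneous_def by blast

lemma homogeneous_zero: "homogeneous D i j (\<lambda>_. 0)" by (simp add: homogeneous_def)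

lemma homogeneous_differential: "homogeneous D i j f \<Longrightarrow> homogeneous D (i - 2) j (int_differential D f)"
  unfolding homogeneous_def int_differential_def
proof (intro allI impI)
  fix S' assume f: "\<forall>S. f S \<noteq> 0 \<longrightarrow> S \<in> generators D i j"
    and nz: "(\<Sum>S\<in>enhanced_states D. incidence_number D S S' * f S) \<noteq> 0"
  obtain S where "incidence_number D S S' * f S \<noteq> 0"
    using sum.not_neutral_contains_not_neutral[OF nz] by blast
  then have "incidence_number D S S' \<noteq> 0" "S \<in> generators D i j" using f[rule_format, of S] by simp_all
  then show "S' \<in> generators D (i - 2) j"
    by (auto simp: incidence_number_def generators_def split: if_splits)
qed

lemma homogeneous_alternate: "homogeneous D i j f \<Longrightarrow> homogeneous D i j (alternate f)"
  by (auto simp: homogeneous_def alternate_def)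

lemma homogeneous_diff: "homogeneous D i j f \<Longrightarrow> homogeneous D i j g \<Longrightarrow> homogeneous D i j (\<lambda>S. f S - g S)"
  unfolding homogeneous_def by (metis diff_0_right)

lemma homogeneous_uminus: "homogeneous D i j f \<Longrightarrow> homogeneous D i j (\<lambda>S. - f S)"
  by (auto simp: homogeneous_def)

lemma (in resmoothable) homogeneous_multiplication_by_X:
  assumes "e \<in> A" "homogeneous D i j f"
  shows "homogeneous D i (j + 4) (multiplication_by_X D e f)"
  unfolding homogeneous_def
proof (intro allI impI)
  fix S assume nz: "multiplication_by_X D e f S \<noteq> 0"
  obtain s P where S: "S = (s, P)" by (cases S)
  let ?C = "E s `` {e}"
  have C: "?C \<in> P" "f (s, P - {?C}) \<noteq> 0" using nz by (auto simp: S multiplication_by_X_def split: if_splits)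
  then have gen: "(s, P - {?C}) \<in> generators D i j" using assms(2) by (auto simp: homogeneous_def)
  then have s: "length s = n" "P - {?C} \<subseteq> circles D s" by (auto simp: generators_def enhanced_state_iff)
  moreover have "?C \<in> circles D s" using assms(1) by (simp add: circles_altdef quotientI)
  ultimately have P: "P \<subseteq> circles D s" by blast
  have "card P = Suc (card (P - {?C}))"
    using card_Suc_Diff1[OF finite_subset[OF P finite_circles] C(1)] by simp
  then have "state_tau D (s, P) = state_tau D (s, P - {?C}) + 2"
    using state_tau_eq[OF P] state_tau_eq[OF s(2)] by simp
  then show "S \<in> generators D i (j + 4)"
    using gen P s by (auto simp: S generators_def enhanced_state_iff state_sigma_def)
qed

lemma int_differential_linear:
  "int_differential D (\<lambda>S. f S + g S) S' = int_differential D f S' + int_differential D g S'"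
  "int_differential D (\<lambda>S. f S - g S) S' = int_differential D f S' - int_differential D g S'"
  "int_differential D (\<lambda>S. - f S) S' = - int_differential D f S'"
  "int_differential D (\<lambda>S. 0) S' = 0"
  by (simp_all add: int_differential_def algebra_simps sum.distrib sum_subtractf sum_negf)

lemma multiplication_by_X_linear:
  "multiplication_by_X D e (\<lambda>S. f S + g S) S' = multiplication_by_X D e f S' + multiplication_by_X D e g S'"
  "multiplication_by_X D e (\<lambda>S. f S - g S) S' = multiplication_by_X D e f S' - multiplication_by_X D e g S'"
  "multiplication_by_X D e (\<lambda>S. - f S) S' = - multiplication_by_X D e f S'"
  "multiplication_by_X D e (\<lambda>S. 0) S' = 0"
  by (simp_all add: multiplication_by_X_def split: prod.splits)

lemma alternate_linear:
  "alternate (\<lambda>S. f S + g S) S' = alternate f S' + alternate g S'"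
  "alternate (\<lambda>S. f S - g S) S' = alternate f S' - alternate g S'"
  "alternate (\<lambda>S. - f S) S' = - alternate f S'"
  "alternate (\<lambda>S. 0) S' = 0"
  by (simp_all add: alternate_def algebra_simps split: prod.splits)

lemmas chain_linear = int_differential_linear multiplication_by_X_linear alternate_linear

context hopf
begin

text \<open>
  With the notation \<open>(V, W, p, q, V', W')\<close> for the components of a chain of \<open>D'\<close>: \<open>\<alpha>\<close> sends \<open>g\<close> to \<open>(0, 0, 0, 0, 0, g)\<close> and \<open>\<beta>\<close>
  is the component \<open>V\<close>.  Two chain maps in the other direction, \<open>\<gamma> g = (g, -Xg, 0, 0, 0, 0)\<close> and
  \<open>\<delta> = W' - XV'\<close>, satisfy \<open>\<beta>\<gamma> = 1\<close> and \<open>\<delta>\<alpha> = 1\<close>: the chain \<open>\<gamma> g\<close> is killed by the merges, as \<open>XV + W = 0\<close>, and \<open>\<delta>\<close>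
  kills the results \<open>(p - q, Xp - Xq)\<close> of the splits.  The homotopy \<open>(0, \<epsilon>q, \<epsilon>V', 0, 0, 0)\<close> inverts one of the two
  merges and one of the two splits.
\<close>

definition alpha_int :: "'a int_chain \<Rightarrow> 'a int_chain" where
  "alpha_int g = assemble (\<lambda>m1 m2 x. if \<not> m1 \<and> \<not> m2 \<and> \<not> x then g else (\<lambda>_. 0))"

definition beta_int :: "'a int_chain \<Rightarrow> 'a int_chain" where
  "beta_int f' = component True True True f'"

definition gamma_int :: "'a int_chain \<Rightarrow> 'a int_chain" where
  "gamma_int g = assemble (\<lambda>m1 m2 x. if m1 \<and> m2 then if x then g else (\<lambda>S. - multiplication_by_X D e g S) else (\<lambda>_. 0))"

definition delta_int :: "'a int_chain \<Rightarrow> 'a int_chain" where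
  "delta_int f' = (\<lambda>S. component False False False f' S - multiplication_by_X D e (component False False True f') S)"

definition homotopy_int :: "'a int_chain \<Rightarrow> 'a int_chain" where
  "homotopy_int f' = assemble (\<lambda>m1 m2 x.
     if \<not> m1 \<and> m2 then alternate (component False False True f')
     else if m1 \<and> m2 \<and> \<not> x then alternate (component True False False f') else (\<lambda>_. 0))"

lemma component_alpha:
  "supported D g \<Longrightarrow> m1 = m2 \<or> \<not> x \<Longrightarrow>
    component m1 m2 x (alpha_int g) = (if \<not> m1 \<and> \<not> m2 \<and> \<not> x then g else (\<lambda>_. 0))"
  unfolding alpha_int_def by (subst component_assemble) (auto intro: supported_intros)

lemma component_gamma:
  "supported D g \<Longrightarrow> m1 = m2 \<or> \<not> x \<Longrightarrow>
    component m1 m2 x (gamma_int g) = (if m1 \<and> m2 then if x then g else (\<lambda>S. - multiplication_by_X D e g S) else (\<lambda>_. 0))"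
  unfolding gamma_int_def by (subst component_assemble) (auto intro!: supported_intros)

lemma component_homotopy:
  "m1 = m2 \<or> \<not> x \<Longrightarrow> component m1 m2 x (homotopy_int f') =
    (if \<not> m1 \<and> m2 then alternate (component False False True f')
     else if m1 \<and> m2 \<and> \<not> x then alternate (component True False False f') else (\<lambda>_. 0))"
  unfolding homotopy_int_def by (subst component_assemble) (auto intro!: supported_intros)

lemma component_linear:
  "component m1 m2 x (\<lambda>S. f S + g S) S' = component m1 m2 x f S' + component m1 m2 x g S'"
  "component m1 m2 x (\<lambda>S. f S - g S) S' = component m1 m2 x f S' - component m1 m2 x g S'"
  by (simp_all add: component_def)

lemma chain_cases:
  assumes "supported D' f'" "supported D' g'"
    and "component True True True f' = component True True True g'" "component True True False f' = component True True False g'"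
      "component True False False f' = component True False False g'" "component False True False f' = component False True False g'"
      "component False False True f' = component False False True g'" "component False False False f' = component False False False g'"
  shows "f' = g'"
proof (rule hopf_chain_eqI[OF assms(1,2)])
  fix m1 m2 x :: bool assume "m1 = m2 \<or> \<not> x"
  then show "component m1 m2 x f' = component m1 m2 x g'"
    using assms(3-) by (cases m1; cases m2; cases x) simp_all
qed

lemma supported_alpha: "supported D' (alpha_int g)"
  and supported_gamma: "supported D' (gamma_int g)"
  and supported_homotopy: "supported D' (homotopy_int f')"
  by (simp_all add: alpha_int_def gamma_int_def homotopy_int_def supported_assemble)

lemma alternate_int_differential: "int_differential D (alternate f) S = - alternate (int_differential D f) S"
  using fun_cong[OF alternate_differential, of f S] by simp

lemma X_differential: "int_differential D (multiplication_by_X D e f) S = multiplication_by_X D e (int_differential D f) S"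
  using fun_cong[OF multiplication_by_X_differential[OF e], of f S] by simp

lemma alpha_int_chain_map:
  assumes g: "supported D g"
  shows "int_differential D' (alpha_int g) = alpha_int (int_differential D g)"
  by (rule chain_cases)
    (simp_all add: H.supported_differential supported_alpha component_differential component_alpha[OF g]
      component_alpha[OF supported_differential] chain_linear fun_eq_iff)

lemma beta_int_chain_map: "beta_int (int_differential D' f') = int_differential D (beta_int f')"
  by (simp add: beta_int_def component_differential)

lemma gamma_int_chain_map:
  assumes g: "supported D g"
  shows "int_differential D' (gamma_int g) = gamma_int (int_differential D g)"
  by (rule chain_cases)
    (simp_all add: H.supported_differential supported_gamma component_differential component_gamma[OF g]
      component_gamma[OF supported_differential] chain_linear X_differential fun_eq_iff)

lemma delta_int_chain_map: "delta_int (int_differential D' f') = int_differential D (delta_int f')"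
  by (simp add: delta_int_def component_differential chain_linear X_differential fun_eq_iff multiplication_by_X_alternate)

lemma beta_gamma:
  assumes g: "supported D g" shows "beta_int (gamma_int g) = g"
  by (simp add: beta_int_def component_gamma[OF g])

lemma beta_alpha:
  assumes g: "supported D g" shows "beta_int (alpha_int g) = (\<lambda>_. 0)"
  by (simp add: beta_int_def component_alpha[OF g])

lemma delta_alpha:
  assumes g: "supported D g" shows "delta_int (alpha_int g) = g"
  by (simp add: delta_int_def component_alpha[OF g] chain_linear fun_eq_iff)

lemma supported_delta: "supported D (delta_int f')"
  unfolding delta_int_def by (intro supported_intros)

lemma supported_beta: "supported D (beta_int f')"
  unfolding beta_int_def by (rule supported_component)

text \<open>
  In components, \<open>d h + h d\<close> is \<open>(0, W + XV, p, q, V', XV')\<close>, since \<open>\<epsilon>d = - d\<epsilon>\<close>.  What is missing to the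
  identity, \<open>(V, -XV, 0, 0, 0, W' - XV')\<close>, is \<open>\<gamma>\<beta> + \<alpha>\<delta>\<close>.
\<close>

lemma homotopy:
  assumes f': "supported D' f'"
  shows "f' = (\<lambda>S. alpha_int (delta_int f') S + gamma_int (beta_int f') S +
    int_differential D' (homotopy_int f') S + homotopy_int (int_differential D' f') S)"
proof (rule chain_cases[OF f'])
  show "supported D' (\<lambda>S. alpha_int (delta_int f') S + gamma_int (beta_int f') S +
    int_differential D' (homotopy_int f') S + homotopy_int (int_differential D' f') S)"
    by (intro supported_add supported_alpha supported_gamma supported_homotopy H.supported_differential)
qed (simp_all add: fun_eq_iff component_linear component_alpha[OF supported_delta, unfolded delta_int_def]
      component_gamma[OF supported_beta, unfolded beta_int_def]
      component_differential component_homotopy chain_linear alternate_int_differential beta_int_def delta_int_def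
      multiplication_by_X_alternate)

lemma homogeneous_component:
  assumes "homogeneous D' i' j' f'" "m1 = m2 \<or> \<not> x"
    "i' = i + (if m1 then 1 else -1) + (if m2 then 1 else -1)"
    "j' = j + (if m1 then 1 else -1) + (if m2 then 1 else -1) + (if m1 = m2 then if x then 2 else -2 else 0)"
  shows "homogeneous D i j (component m1 m2 x f')"
  unfolding homogeneous_def
proof (intro allI impI)
  fix S assume "component m1 m2 x f' S \<noteq> 0"
  then have S: "S \<in> enhanced_states D" "f' (hopf_state m1 m2 x S) \<noteq> 0" by (auto simp: component_def split: if_splits)
  have "hopf_state m1 m2 x S \<in> generators D' i' j'" by (rule homogeneousD[OF assms(1) S(2)])
  then show "S \<in> generators D i j"
    using S assms(2-4) by (auto simp: generators_def state_sigma_hopf_state state_tau_hopf_state split: if_splits)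
qed

lemma homogeneous_assemble:
  assumes "\<And>m1 m2 x. m1 = m2 \<or> \<not> x \<Longrightarrow> homogeneous D (i' - (if m1 then 1 else -1) - (if m2 then 1 else -1))
    (j' - (if m1 then 1 else -1) - (if m2 then 1 else -1) - (if m1 = m2 then if x then 2 else -2 else 0)) (g m1 m2 x)"
  shows "homogeneous D' i' j' (assemble g)"
  unfolding homogeneous_def
proof (intro allI impI)
  fix S' assume nz: "assemble g S' \<noteq> 0"
  then have "S' \<in> enhanced_states D'" using supported_assemble[of g] unfolding supported_def by blast
  then obtain m1 m2 x S where S: "S \<in> enhanced_states D" "m1 = m2 \<or> \<not> x" "S' = hopf_state m1 m2 x S"
    by (rule enhanced_states_hopf)
  then have "g m1 m2 x S \<noteq> 0" using nz by (simp add: assemble_hopf_state)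
  then have "S \<in> generators D (i' - (if m1 then 1 else -1) - (if m2 then 1 else -1))
    (j' - (if m1 then 1 else -1) - (if m2 then 1 else -1) - (if m1 = m2 then if x then 2 else -2 else 0))"
    by (rule homogeneousD[OF assms[OF S(2)]])
  then show "S' \<in> generators D' i' j'"
    using S hopf_state_enhanced[OF S(1,2)]
    by (auto simp: generators_def state_sigma_hopf_state state_tau_hopf_state split: if_splits)
qed

lemma homogeneous_alpha:
  "homogeneous D i j g \<Longrightarrow> homogeneous D' (i - 2) (j - 4) (alpha_int g)"
  unfolding alpha_int_def by (rule homogeneous_assemble) (auto simp: homogeneous_zero)

lemma homogeneous_beta:
  "homogeneous D' i j f' \<Longrightarrow> homogeneous D (i - 2) (j - 4) (beta_int f')"
  unfolding beta_int_def by (rule homogeneous_component) auto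

lemma homogeneous_gamma:
  assumes "homogeneous D i j g"
  shows "homogeneous D' (i + 2) (j + 4) (gamma_int g)"
  unfolding gamma_int_def
  by (rule homogeneous_assemble)
    (use assms homogeneous_multiplication_by_X[OF e assms] in \<open>auto simp: homogeneous_zero add.commute intro!: homogeneous_uminus\<close>)

lemma homogeneous_delta:
  assumes "homogeneous D' i j f'"
  shows "homogeneous D (i + 2) (j + 4) (delta_int f')"
proof -
  have "homogeneous D (i + 2) j (component False False True f')"
    by (rule homogeneous_component[OF assms]) auto
  from homogeneous_multiplication_by_X[OF e this] show ?thesis
    unfolding delta_int_def
    by (intro homogeneous_diff homogeneous_component[OF assms]) auto
qed

lemma homogeneous_homotopy:
  assumes "homogeneous D' i j f'"
  shows "homogeneous D' (i + 2) j (homotopy_int f')"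
proof -
  have "homogeneous D (i + 2) j (component False False True f')" "homogeneous D i j (component True False False f')"
    by (rule homogeneous_component[OF assms]; simp)+
  then show ?thesis
    unfolding homotopy_int_def
    by (intro homogeneous_assemble) (auto simp: homogeneous_zero add.commute intro!: homogeneous_alternate)
qed

end

section \<open>Exact sequences of quotient modules\<close>

lemma (in cring) free_module_is_module: "module R (free_module R G)"
proof (rule moduleI)
  have "abelian_group (free_module R G)"
  proof (rule abelian_groupI)
    fix f assume "f \<in> carrier (free_module R G)"
    then show "\<exists>g\<in>carrier (free_module R G). g \<oplus>\<^bsub>free_module R G\<^esub> f = \<zero>\<^bsub>free_module R G\<^esub>"
      by (intro bexI[of _ "\<lambda>S. \<ominus> f S"]) (auto simp: free_module_def fun_eq_iff, (metis l_neg zero_closed)+)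
  qed (auto simp: free_module_def fun_eq_iff, (metis a_assoc a_comm l_zero zero_closed)+)
  then show "abelian_group (free_module R G)" .
qed (auto simp: free_module_def fun_eq_iff is_cring, (metis l_distr r_distr m_assoc l_one zero_closed)+)

lemma module_homD:
  assumes "f \<in> module_hom R M N"
  shows "x \<in> carrier M \<Longrightarrow> f x \<in> carrier N"
    and "x \<in> carrier M \<Longrightarrow> y \<in> carrier M \<Longrightarrow> f (x \<oplus>\<^bsub>M\<^esub> y) = f x \<oplus>\<^bsub>N\<^esub> f y"
    and "r \<in> carrier R \<Longrightarrow> x \<in> carrier M \<Longrightarrow> f (r \<odot>\<^bsub>M\<^esub> x) = r \<odot>\<^bsub>N\<^esub> f x"
  using assms by (auto simp: module_hom_def hom_def)

lemma module_homI:
  assumes "\<And>x. x \<in> carrier M \<Longrightarrow> f x \<in> carrier N"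
    and "\<And>x y. x \<in> carrier M \<Longrightarrow> y \<in> carrier M \<Longrightarrow> f (x \<oplus>\<^bsub>M\<^esub> y) = f x \<oplus>\<^bsub>N\<^esub> f y"
    and "\<And>r x. r \<in> carrier R \<Longrightarrow> x \<in> carrier M \<Longrightarrow> f (r \<odot>\<^bsub>M\<^esub> x) = r \<odot>\<^bsub>N\<^esub> f x"
  shows "f \<in> module_hom R M N"
  using assms by (auto simp: module_hom_def hom_def)

lemma module_hom_zero_inv:
  assumes "module R M" "module R N" "f \<in> module_hom R M N"
  shows "f \<zero>\<^bsub>M\<^esub> = \<zero>\<^bsub>N\<^esub>" "x \<in> carrier M \<Longrightarrow> f (\<ominus>\<^bsub>M\<^esub> x) = \<ominus>\<^bsub>N\<^esub> f x"
proof -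
  interpret M: module R M by fact
  interpret N: module R N by fact
  have "f \<in> hom (add_monoid M) (add_monoid N)" using assms(3) by (simp add: module_hom_def)
  then have "group_hom (add_monoid M) (add_monoid N) f"
    by (simp add: group_hom_def group_hom_axioms_def M.M.a_group N.M.a_group)
  then interpret abelian_group_hom M N f
    by (rule abelian_group_homI[OF M.M.abelian_group_axioms N.M.abelian_group_axioms])
  show "f \<zero>\<^bsub>M\<^esub> = \<zero>\<^bsub>N\<^esub>" "x \<in> carrier M \<Longrightarrow> f (\<ominus>\<^bsub>M\<^esub> x) = \<ominus>\<^bsub>N\<^esub> f x" by simp_all
qed

lemma kernel_submodule:
  assumes "module R M" "module R N" "f \<in> module_hom R M N"
  shows "submodule (a_kernel M N f) R M"
proof -
  interpret M: module R M by fact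
  interpret N: module R N by fact
  show ?thesis
    by (rule M.submoduleI)
      (use module_homD[OF assms(3)] module_hom_zero_inv[OF assms] in \<open>auto simp: a_kernel_def'\<close>)
qed

lemma image_submodule:
  assumes "module R M" "module R N" "f \<in> module_hom R M N"
  shows "submodule (f ` carrier M) R N"
proof -
  interpret M: module R M by fact
  interpret N: module R N by fact
  note f = module_homD[OF assms(3)] module_hom_zero_inv[OF assms]
  show ?thesis
  proof (rule N.submoduleI)
    show "f ` carrier M \<subseteq> carrier N" using f(1) by auto
    show "\<zero>\<^bsub>N\<^esub> \<in> f ` carrier M" using f(4) by (metis M.zero_closed imageI)
    show "\<ominus>\<^bsub>N\<^esub> a \<in> f ` carrier M" if "a \<in> f ` carrier M" for a
      using that f(5) by (metis (no_types, lifting) M.a_inv_closed imageE imageI)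
    show "a \<oplus>\<^bsub>N\<^esub> b \<in> f ` carrier M" if "a \<in> f ` carrier M" "b \<in> f ` carrier M" for a b
      using that f(2) by (metis (no_types, lifting) M.a_closed imageE imageI)
    show "r \<odot>\<^bsub>N\<^esub> a \<in> f ` carrier M" if "r \<in> carrier R" "a \<in> f ` carrier M" for r a
      using that f(3) by (metis (no_types, lifting) M.smult_closed imageE imageI)
  qed
qed

lemma submodule_restrict:
  assumes "module R M" "submodule N R M" "N \<subseteq> Z" "submodule Z R M"
  shows "submodule N R (M\<lparr>carrier := Z\<rparr>)"
proof -
  interpret M: module R M by fact
  interpret Z: module R "M\<lparr>carrier := Z\<rparr>" by (rule submodule.submodule_is_module[OF assms(4,1)])
  note N = M.submoduleE[OF assms(2)]
  have zero: "\<zero>\<^bsub>M\<^esub> \<in> N" using N(1,2,3,5) by (metis M.r_neg all_not_in_conv subsetD)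
  have inv: "\<ominus>\<^bsub>M\<lparr>carrier := Z\<rparr>\<^esub> x = \<ominus>\<^bsub>M\<^esub> x" if "x \<in> N" for x
  proof (rule Z.minus_equality)
    show "\<ominus>\<^bsub>M\<^esub> x \<oplus>\<^bsub>M\<lparr>carrier := Z\<rparr>\<^esub> x = \<zero>\<^bsub>M\<lparr>carrier := Z\<rparr>\<^esub>"
      using that N(1) by (auto simp: M.l_neg)
  qed (use that N(3) assms(3) in auto)
  show ?thesis
    by (rule Z.submoduleI) (use assms(3) N zero inv in auto)
qed

locale module_quotient = module R M for R (structure) and M :: "('a, 'c) module" (structure) and N +
  assumes submodule: "submodule N R M"
begin

lemma subgroup: "subgroup N (add_monoid M)"
  using submodule by (simp add: submodule_def)

sublocale N: abelian_subgroup N M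
  by (rule abelian_subgroupI2[OF a_comm_group subgroup])

lemma submodule_facts: "N \<subseteq> carrier M" "\<zero>\<^bsub>M\<^esub> \<in> N" "x \<in> N \<Longrightarrow> y \<in> N \<Longrightarrow> x \<oplus>\<^bsub>M\<^esub> y \<in> N" "x \<in> N \<Longrightarrow> \<ominus>\<^bsub>M\<^esub> x \<in> N"
  "r \<in> carrier R \<Longrightarrow> x \<in> N \<Longrightarrow> r \<odot>\<^bsub>M\<^esub> x \<in> N"
  using submoduleE[OF submodule] N.zero_closed by auto

lemma coset_mem: "y \<in> N +>\<^bsub>M\<^esub> x \<longleftrightarrow> (\<exists>k\<in>N. y = k \<oplus>\<^bsub>M\<^esub> x)"
  by (auto simp: a_r_coset_def')

lemma coset_eq: "x \<in> carrier M \<Longrightarrow> k \<in> N \<Longrightarrow> N +>\<^bsub>M\<^esub> (k \<oplus>\<^bsub>M\<^esub> x) = N +>\<^bsub>M\<^esub> x"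
  using M.a_repr_independence[OF _ _ subgroup, of "k \<oplus>\<^bsub>M\<^esub> x" x] by (auto simp: coset_mem)

lemma coset_eq_iff:
  assumes "x \<in> carrier M" "y \<in> carrier M"
  shows "N +>\<^bsub>M\<^esub> x = N +>\<^bsub>M\<^esub> y \<longleftrightarrow> (\<exists>k\<in>N. x = k \<oplus>\<^bsub>M\<^esub> y)"
  using coset_eq[OF assms(2)] N.a_rcos_self[OF assms(1)] by (auto simp: coset_mem)

lemma coset_zero_iff: "x \<in> carrier M \<Longrightarrow> N +>\<^bsub>M\<^esub> x = N \<longleftrightarrow> x \<in> N"
  using M.a_coset_join2[OF _ subgroup] N.a_rcos_self by auto

lemma carrier_quotient: "carrier (quotient_module M N) = (\<lambda>x. N +>\<^bsub>M\<^esub> x) ` carrier M"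
  by (auto simp: quotient_module_def A_RCOSETS_def')

lemma add_quotient:
  "x \<in> carrier M \<Longrightarrow> y \<in> carrier M \<Longrightarrow>
    (N +>\<^bsub>M\<^esub> x) \<oplus>\<^bsub>quotient_module M N\<^esub> (N +>\<^bsub>M\<^esub> y) = N +>\<^bsub>M\<^esub> (x \<oplus>\<^bsub>M\<^esub> y)"
  by (simp add: quotient_module_def N.a_rcos_sum)

lemma zero_quotient: "\<zero>\<^bsub>quotient_module M N\<^esub> = N"
  by (simp add: quotient_module_def)

text \<open>
  Maps on cosets are given as unions over representatives; if all representatives contribute the same, the union is that
  contribution.
\<close>

lemma union_over_coset:
  assumes "x \<in> carrier M" "\<And>k. k \<in> N \<Longrightarrow> h (k \<oplus>\<^bsub>M\<^esub> x) = h x"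
  shows "(\<Union>y\<in>N +>\<^bsub>M\<^esub> x. h y) = h x"
  using assms submodule_facts(2) by (force simp: coset_mem)

lemma smult_quotient:
  assumes "r \<in> carrier R" "x \<in> carrier M"
  shows "r \<odot>\<^bsub>quotient_module M N\<^esub> (N +>\<^bsub>M\<^esub> x) = N +>\<^bsub>M\<^esub> (r \<odot>\<^bsub>M\<^esub> x)"
proof -
  have "N +>\<^bsub>M\<^esub> (r \<odot>\<^bsub>M\<^esub> (k \<oplus>\<^bsub>M\<^esub> x)) = N +>\<^bsub>M\<^esub> (r \<odot>\<^bsub>M\<^esub> x)" if "k \<in> N" for k
    using that assms submodule_facts(1,5) smult_r_distr coset_eq by (auto simp: subset_iff)
  from union_over_coset[OF assms(2), of "\<lambda>y. N +>\<^bsub>M\<^esub> (r \<odot>\<^bsub>M\<^esub> y)", OF this]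
  show ?thesis by (simp add: quotient_module_def)
qed

lemma quotient_is_module: "module R (quotient_module M N)"
proof (rule moduleI)
  show "cring R" by (rule R.is_cring)
  have zero: "\<zero>\<^bsub>quotient_module M N\<^esub> = N +>\<^bsub>M\<^esub> \<zero>\<^bsub>M\<^esub>"
    using coset_zero_iff[OF M.zero_closed] submodule_facts(2) by (simp add: zero_quotient)
  show "abelian_group (quotient_module M N)"
  proof (rule abelian_groupI)
    fix X assume "X \<in> carrier (quotient_module M N)"
    then obtain x where "x \<in> carrier M" "X = N +>\<^bsub>M\<^esub> x" by (auto simp: carrier_quotient)
    then show "\<exists>Y\<in>carrier (quotient_module M N). Y \<oplus>\<^bsub>quotient_module M N\<^esub> X = \<zero>\<^bsub>quotient_module M N\<^esub>"
      by (intro bexI[of _ "N +>\<^bsub>M\<^esub> (\<ominus>\<^bsub>M\<^esub> x)"]) (simp_all add: carrier_quotient zero add_quotient M.l_neg)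
  qed (auto simp: carrier_quotient zero add_quotient M.a_ac)
qed (auto simp: carrier_quotient smult_quotient add_quotient smult_l_distr smult_r_distr smult_assoc1)

end

text \<open>
  The exactness of the sequence of quotients in terms of representatives.
\<close>

lemma short_exact_sequence_quotients:
  assumes L: "module_quotient R L NL" and M: "module_quotient R M NM" and N: "module_quotient R N NN"
    and f: "f \<in> module_hom R L M" "f ` NL \<subseteq> NM" and g: "g \<in> module_hom R M N" "g ` NM \<subseteq> NN"
    and inj: "\<And>x. x \<in> carrier L \<Longrightarrow> f x \<in> NM \<Longrightarrow> x \<in> NL"
    and zero: "\<And>x. x \<in> carrier L \<Longrightarrow> g (f x) \<in> NN"
    and exact: "\<And>y. y \<in> carrier M \<Longrightarrow> g y \<in> NN \<Longrightarrow> \<exists>x\<in>carrier L. \<exists>k\<in>NM. y = k \<oplus>\<^bsub>M\<^esub> f x"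
    and surj: "\<And>z. z \<in> carrier N \<Longrightarrow> \<exists>y\<in>carrier M. g y = z"
  shows "short_exact_sequence R (quotient_module L NL) (\<lambda>X. \<Union>x\<in>X. NM +>\<^bsub>M\<^esub> f x) (quotient_module M NM)
    (\<lambda>X. \<Union>x\<in>X. NN +>\<^bsub>N\<^esub> g x) (quotient_module N NN)"
proof -
  interpret L: module_quotient R L NL by fact
  interpret M: module_quotient R M NM by fact
  interpret N: module_quotient R N NN by fact
  define F where "F X = (\<Union>x\<in>X. NM +>\<^bsub>M\<^esub> f x)" for X
  define G where "G X = (\<Union>x\<in>X. NN +>\<^bsub>N\<^esub> g x)" for X
  note fD = module_homD[OF f(1)] and gD = module_homD[OF g(1)]
  have f_coset: "F (NL +>\<^bsub>L\<^esub> x) = NM +>\<^bsub>M\<^esub> f x" if "x \<in> carrier L" for x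
    unfolding F_def
  proof (rule L.union_over_coset[OF that])
    fix k assume "k \<in> NL"
    then have "k \<in> carrier L" "f k \<in> NM" using L.submodule_facts(1) f(2) by auto
    then show "NM +>\<^bsub>M\<^esub> f (k \<oplus>\<^bsub>L\<^esub> x) = NM +>\<^bsub>M\<^esub> f x" using fD that M.coset_eq by simp
  qed
  have g_coset: "G (NM +>\<^bsub>M\<^esub> x) = NN +>\<^bsub>N\<^esub> g x" if "x \<in> carrier M" for x
    unfolding G_def
  proof (rule M.union_over_coset[OF that])
    fix k assume "k \<in> NM"
    then have "k \<in> carrier M" "g k \<in> NN" using M.submodule_facts(1) g(2) by auto
    then show "NN +>\<^bsub>N\<^esub> g (k \<oplus>\<^bsub>M\<^esub> x) = NN +>\<^bsub>N\<^esub> g x" using gD that N.coset_eq by simp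
  qed
  have f_hom: "F \<in> module_hom R (quotient_module L NL) (quotient_module M NM)"
    by (rule module_homI)
      (auto simp: L.carrier_quotient M.carrier_quotient f_coset fD L.add_quotient M.add_quotient L.smult_quotient M.smult_quotient)
  have g_hom: "G \<in> module_hom R (quotient_module M NM) (quotient_module N NN)"
    by (rule module_homI)
      (auto simp: M.carrier_quotient N.carrier_quotient g_coset gD M.add_quotient N.add_quotient M.smult_quotient N.smult_quotient)
  have "inj_on F (carrier (quotient_module L NL))"
  proof (rule inj_onI)
    fix X Y assume "X \<in> carrier (quotient_module L NL)" "Y \<in> carrier (quotient_module L NL)" and eq: "F X = F Y"
    then obtain x y where xy: "x \<in> carrier L" "y \<in> carrier L" "X = NL +>\<^bsub>L\<^esub> x" "Y = NL +>\<^bsub>L\<^esub> y"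
      by (auto simp: L.carrier_quotient)
    then have "NM +>\<^bsub>M\<^esub> f x = NM +>\<^bsub>M\<^esub> f y" using eq f_coset by simp
    then obtain k where k: "k \<in> NM" "f x = k \<oplus>\<^bsub>M\<^esub> f y" using M.coset_eq_iff fD(1) xy by blast
    have kc: "k \<in> carrier M" using k(1) M.submodule_facts(1) by blast
    let ?d = "x \<oplus>\<^bsub>L\<^esub> \<ominus>\<^bsub>L\<^esub> y"
    have "f ?d = f x \<oplus>\<^bsub>M\<^esub> \<ominus>\<^bsub>M\<^esub> f y"
      using xy fD module_hom_zero_inv(2)[OF L.module_axioms M.module_axioms f(1)] by simp
    also have "\<dots> = k" using k(2) kc fD(1)[OF xy(2)] by (simp add: M.M.a_assoc M.M.r_neg)
    finally have "?d \<in> NL" using inj[of ?d] k(1) xy by simp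
    moreover have "x = ?d \<oplus>\<^bsub>L\<^esub> y" using xy by (simp add: L.M.a_assoc L.M.l_neg)
    ultimately show "X = Y" using xy L.coset_eq_iff by blast
  qed
  moreover have "F ` carrier (quotient_module L NL) = a_kernel (quotient_module M NM) (quotient_module N NN) G"
  proof (intro equalityI subsetI)
    fix Y assume "Y \<in> F ` carrier (quotient_module L NL)"
    then obtain x where x: "x \<in> carrier L" "Y = NM +>\<^bsub>M\<^esub> f x" by (auto simp: L.carrier_quotient f_coset)
    then have "G Y = NN" using g_coset fD(1) gD(1) zero N.coset_zero_iff by simp
    then show "Y \<in> a_kernel (quotient_module M NM) (quotient_module N NN) G"
      using x fD(1) by (simp add: a_kernel_def' N.zero_quotient M.carrier_quotient)
  next
    fix Y assume "Y \<in> a_kernel (quotient_module M NM) (quotient_module N NN) G"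
    then obtain y where y: "y \<in> carrier M" "Y = NM +>\<^bsub>M\<^esub> y" "G Y = NN"
      by (auto simp: a_kernel_def' N.zero_quotient M.carrier_quotient)
    then have "g y \<in> NN" using g_coset gD(1) N.coset_zero_iff by simp
    then obtain x k where xk: "x \<in> carrier L" "k \<in> NM" "y = k \<oplus>\<^bsub>M\<^esub> f x" using exact y(1) by blast
    then have "Y = F (NL +>\<^bsub>L\<^esub> x)" using y(2) f_coset M.coset_eq fD(1) by simp
    then show "Y \<in> F ` carrier (quotient_module L NL)" using xk(1) by (auto simp: L.carrier_quotient)
  qed
  moreover have "G ` carrier (quotient_module M NM) = carrier (quotient_module N NN)"
  proof -
    have "G ` carrier (quotient_module M NM) = (\<lambda>y. NN +>\<^bsub>N\<^esub> g y) ` carrier M"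
      by (auto simp: M.carrier_quotient g_coset image_image cong: image_cong_simp)
    also have "\<dots> = (\<lambda>z. NN +>\<^bsub>N\<^esub> z) ` g ` carrier M" by (simp only: image_image)
    also have "g ` carrier M = carrier N" using surj gD(1) by (force simp: image_iff)
    finally show ?thesis by (simp add: N.carrier_quotient)
  qed
  ultimately show ?thesis
    using L.quotient_is_module M.quotient_is_module N.quotient_is_module f_hom g_hom
    by (simp add: short_exact_sequence_def flip: F_def G_def)
qed

section \<open>Coefficients in a ring\<close>

lemma coset_update_carrier: "N +>\<^bsub>M\<lparr>carrier := Z\<rparr>\<^esub> x = N +>\<^bsub>M\<^esub> x"
  by (simp add: a_r_coset_def')

definition single :: "'b \<Rightarrow> 'b \<Rightarrow> int" where
  "single S = (\<lambda>S'. if S' = S then 1 else 0)"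

definition linear_op :: "(('b \<Rightarrow> int) \<Rightarrow> 'c \<Rightarrow> int) \<Rightarrow> bool" where
  "linear_op L \<longleftrightarrow> (\<forall>f g S. L (\<lambda>S. f S + g S) S = L f S + L g S) \<and> (\<forall>k f S. L (\<lambda>S. k * f S) S = k * L f S)"

lemma linear_op_sum:
  assumes "linear_op L" "finite I"
  shows "L (\<lambda>S. \<Sum>i\<in>I. a i * g i S) S' = (\<Sum>i\<in>I. a i * L (g i) S')"
  using assms(2)
proof (induction I arbitrary: S' rule: finite_induct)
  case empty
  show ?case
    using assms(1)[unfolded linear_op_def, THEN conjunct2, rule_format, of 0 "\<lambda>_. 0" S'] by simp
next
  case (insert i I)
  then show ?case using assms(1) by (simp add: linear_op_def)
qed

text \<open>
  A linear operator is given by its matrix on finitely supported functions.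
\<close>

lemma linear_op_expand:
  assumes "linear_op L" "finite G" "\<And>S. S \<notin> G \<Longrightarrow> f S = 0"
  shows "L f S' = (\<Sum>S\<in>G. f S * L (single S) S')"
proof -
  have "f S0 = (\<Sum>S\<in>G. f S * single S S0)" for S0
    using assms(2,3) by (cases "S0 \<in> G") (auto simp: single_def if_distrib cong: if_cong)
  then have "f = (\<lambda>S0. \<Sum>S\<in>G. f S * single S S0)" by (rule ext)
  then show ?thesis using linear_op_sum[OF assms(1,2), of f single S'] by simp
qed

lemma (in cring) int_scalar_0: "[(0::int)] \<cdot> x = \<zero>"
  by (simp add: add_pow_def)

lemma (in cring) int_scalar_finsum:
  assumes "finite I" "f \<in> I \<rightarrow> carrier R"
  shows "[(k::int)] \<cdot> (\<Oplus>i\<in>I. f i) = (\<Oplus>i\<in>I. [k] \<cdot> f i)"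
  using assms by (induction I rule: finite_induct) (auto simp: Pi_def add.int_pow_distrib)

lemma (in cring) finsum_int_scalar:
  assumes "finite I" "x \<in> carrier R"
  shows "(\<Oplus>i\<in>I. [(a i :: int)] \<cdot> x) = [(\<Sum>i\<in>I. a i)] \<cdot> x"
  using assms by (induction I rule: finite_induct) (auto simp: add.int_pow_mult int_scalar_0)

lemma (in cring) finsum_swap:
  assumes "finite I" "finite J" "\<And>i j. i \<in> I \<Longrightarrow> j \<in> J \<Longrightarrow> f i j \<in> carrier R"
  shows "(\<Oplus>i\<in>I. \<Oplus>j\<in>J. f i j) = (\<Oplus>j\<in>J. \<Oplus>i\<in>I. f i j)"
  using assms(1,3)
proof (induction I rule: finite_induct)
  case (insert i I)
  have "(\<Oplus>k\<in>insert i I. \<Oplus>j\<in>J. f k j) = (\<Oplus>j\<in>J. f i j) \<oplus> (\<Oplus>j\<in>J. \<Oplus>k\<in>I. f k j)"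
    using insert by (subst finsum_insert) (auto intro!: finsum_closed)
  also have "\<dots> = (\<Oplus>j\<in>J. f i j \<oplus> (\<Oplus>k\<in>I. f k j))"
    using insert by (subst finsum_addf) (auto intro!: finsum_closed)
  also have "\<dots> = (\<Oplus>j\<in>J. \<Oplus>k\<in>insert i I. f k j)"
    using insert by (intro finsum_cong') (auto intro!: finsum_closed)
  finally show ?case .
qed (use assms(2) in simp)

lemma free_module_carrier:
  "f \<in> carrier (free_module R G) \<longleftrightarrow> (\<forall>S\<in>G. f S \<in> carrier R) \<and> (\<forall>S. S \<notin> G \<longrightarrow> f S = \<zero>\<^bsub>R\<^esub>)"
  by (simp add: free_module_def)

context cring
begin

lemma linear_extension_cong:
  assumes "f \<in> carrier (free_module R G)" "\<And>S S'. S \<in> G \<Longrightarrow> S' \<in> G' \<Longrightarrow> q S S' = q' S S'"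
  shows "linear_extension R G G' q f = linear_extension R G G' q' f"
proof
  fix S'
  have "(\<Oplus>S\<in>G. [q S S'] \<cdot> f S) = (\<Oplus>S\<in>G. [q' S S'] \<cdot> f S)" if "S' \<in> G'"
    using assms that by (intro finsum_cong') (auto simp: free_module_carrier)
  then show "linear_extension R G G' q f S' = linear_extension R G G' q' f S'"
    by (simp add: linear_extension_def)
qed

text \<open>
  Products of integer matrices induce compositions of maps over \<open>R\<close>.  This transfers all identities between integer
  chains to coefficients in \<open>R\<close>.
\<close>

lemma linear_extension_comp:
  assumes G: "finite G" "finite G'" and f: "f \<in> carrier (free_module R G)"
  shows "linear_extension R G' G'' q' (linear_extension R G G' q f) =
    linear_extension R G G'' (\<lambda>S S''. \<Sum>S'\<in>G'. q S S' * q' S' S'') f"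
proof
  fix S''
  have fc: "S \<in> G \<Longrightarrow> f S \<in> carrier R" for S using f by (simp add: free_module_carrier)
  have "(\<Oplus>S'\<in>G'. [q' S' S''] \<cdot> (if S' \<in> G' then \<Oplus>S\<in>G. [q S S'] \<cdot> f S else \<zero>)) =
      (\<Oplus>S'\<in>G'. \<Oplus>S\<in>G. [(q S S' * q' S' S'')] \<cdot> f S)"
  proof (intro finsum_cong' refl)
    fix S' assume "S' \<in> G'"
    have "[q' S' S''] \<cdot> (\<Oplus>S\<in>G. [q S S'] \<cdot> f S) = (\<Oplus>S\<in>G. [q' S' S''] \<cdot> ([q S S'] \<cdot> f S))"
      using G fc by (intro int_scalar_finsum) auto
    also have "\<dots> = (\<Oplus>S\<in>G. [(q S S' * q' S' S'')] \<cdot> f S)"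
      using fc by (intro finsum_cong') (auto simp: add.int_pow_pow)
    finally show "[q' S' S''] \<cdot> (if S' \<in> G' then \<Oplus>S\<in>G. [q S S'] \<cdot> f S else \<zero>) = (\<Oplus>S\<in>G. [(q S S' * q' S' S'')] \<cdot> f S)"
      using \<open>S' \<in> G'\<close> by simp
  qed (use fc in \<open>auto intro!: finsum_closed\<close>)
  also have "\<dots> = (\<Oplus>S\<in>G. \<Oplus>S'\<in>G'. [(q S S' * q' S' S'')] \<cdot> f S)"
    using G fc by (intro finsum_swap) auto
  also have "\<dots> = (\<Oplus>S\<in>G. [(\<Sum>S'\<in>G'. q S S' * q' S' S'')] \<cdot> f S)"
    using G fc by (intro finsum_cong') (auto simp: finsum_int_scalar)
  finally show "linear_extension R G' G'' q' (linear_extension R G G' q f) S'' =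
      linear_extension R G G'' (\<lambda>S S''. \<Sum>S'\<in>G'. q S S' * q' S' S'') f S''"
    by (simp add: linear_extension_def)
qed

lemma linear_extension_hom:
  "linear_extension R G G' q \<in> module_hom R (free_module R G) (free_module R G')"
proof (rule module_homI)
  fix f assume f: "f \<in> carrier (free_module R G)"
  then show "linear_extension R G G' q f \<in> carrier (free_module R G')"
    by (auto simp: free_module_carrier linear_extension_def intro!: finsum_closed)
next
  fix f g assume "f \<in> carrier (free_module R G)" "g \<in> carrier (free_module R G)"
  then have fc: "f S \<in> carrier R" "g S \<in> carrier R" if "S \<in> G" for S using that by (auto simp: free_module_carrier)
  have "(\<Oplus>S\<in>G. [q S S'] \<cdot> (f S \<oplus> g S)) = (\<Oplus>S\<in>G. [q S S'] \<cdot> f S) \<oplus> (\<Oplus>S\<in>G. [q S S'] \<cdot> g S)" for S'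
  proof -
    have "(\<Oplus>S\<in>G. [q S S'] \<cdot> (f S \<oplus> g S)) = (\<Oplus>S\<in>G. [q S S'] \<cdot> f S \<oplus> [q S S'] \<cdot> g S)"
      using fc by (intro finsum_cong') (auto simp: add.int_pow_distrib)
    then show ?thesis using fc by (subst (asm) finsum_addf) auto
  qed
  then show "linear_extension R G G' q (f \<oplus>\<^bsub>free_module R G\<^esub> g) =
      linear_extension R G G' q f \<oplus>\<^bsub>free_module R G'\<^esub> linear_extension R G G' q g"
    by (simp add: free_module_def linear_extension_def fun_eq_iff)
next
  fix r f assume r: "r \<in> carrier R" and "f \<in> carrier (free_module R G)"
  then have fc: "f S \<in> carrier R" if "S \<in> G" for S using that by (auto simp: free_module_carrier)
  have "(\<Oplus>S\<in>G. [q S S'] \<cdot> (r \<otimes> f S)) = r \<otimes> (\<Oplus>S\<in>G. [q S S'] \<cdot> f S)" for S'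
  proof (cases "finite G")
    case True
    have "(\<Oplus>S\<in>G. [q S S'] \<cdot> (r \<otimes> f S)) = (\<Oplus>S\<in>G. r \<otimes> ([q S S'] \<cdot> f S))"
      using fc r by (intro finsum_cong') (auto simp: add_pow_rdistr_int)
    then show ?thesis using fc r True by (subst finsum_rdistr) auto
  qed (use r in \<open>simp add: finsum_infinite\<close>)
  then show "linear_extension R G G' q (r \<odot>\<^bsub>free_module R G\<^esub> f) = r \<odot>\<^bsub>free_module R G'\<^esub> linear_extension R G G' q f"
    using r by (simp add: free_module_def linear_extension_def fun_eq_iff)
qed

end

text \<open>
  The map over \<open>R\<close> with the matrix of the operator \<open>L\<close> on integer chains, in one bidegree.
\<close>

definition base_change :: "('r, 'm) ring_scheme \<Rightarrow> 'a diagram \<Rightarrow> int \<Rightarrow> int \<Rightarrow> 'a diagram \<Rightarrow> int \<Rightarrow> int \<Rightarrow>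
    ('a int_chain \<Rightarrow> 'a int_chain) \<Rightarrow> ('a enhanced_state \<Rightarrow> 'r) \<Rightarrow> 'a enhanced_state \<Rightarrow> 'r" where
  "base_change R D1 i1 j1 D2 i2 j2 L =
     linear_extension R (generators D1 i1 j1) (generators D2 i2 j2) (\<lambda>S S'. L (single S) S')"

definition graded_op :: "'a diagram \<Rightarrow> 'a diagram \<Rightarrow> int \<Rightarrow> int \<Rightarrow> ('a int_chain \<Rightarrow> 'a int_chain) \<Rightarrow> bool" where
  "graded_op D1 D2 a b L \<longleftrightarrow> linear_op L \<and> (\<forall>i j f. homogeneous D1 i j f \<longrightarrow> homogeneous D2 (i + a) (j + b) (L f))"

lemma homogeneous_single: "S \<in> generators D i j \<Longrightarrow> homogeneous D i j (single S)"
  by (auto simp: homogeneous_def single_def)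

lemma (in resmoothable) finite_generators: "finite (generators D i j)"
  using finite_enhanced_states by (rule rev_finite_subset) (auto simp: generators_def)

context cring
begin

lemma base_change_cong:
  assumes "f \<in> carrier (chain_module R D1 i1 j1)"
    and "\<And>g. homogeneous D1 i1 j1 g \<Longrightarrow> L g = L' g"
  shows "base_change R D1 i1 j1 D2 i2 j2 L f = base_change R D1 i1 j1 D2 i2 j2 L' f"
  unfolding base_change_def
  by (rule linear_extension_cong)
    (use assms(1) in \<open>simp_all add: chain_module_def assms(2)[OF homogeneous_single]\<close>)

lemma base_change_comp:
  assumes L1: "graded_op D1 D2 a b L1" and L2: "linear_op L2" and deg: "i2 = i1 + a" "j2 = j1 + b"
    and fin: "finite (generators D1 i1 j1)" "finite (generators D2 i2 j2)"
    and f: "f \<in> carrier (chain_module R D1 i1 j1)"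
  shows "base_change R D2 i2 j2 D3 i3 j3 L2 (base_change R D1 i1 j1 D2 i2 j2 L1 f) =
    base_change R D1 i1 j1 D3 i3 j3 (\<lambda>g. L2 (L1 g)) f"
  unfolding base_change_def
proof (subst linear_extension_comp[OF fin f[unfolded chain_module_def]], rule linear_extension_cong[OF f[unfolded chain_module_def]])
  fix S S'' assume S: "S \<in> generators D1 i1 j1"
  have "homogeneous D2 i2 j2 (L1 (single S))"
    using L1 homogeneous_single[OF S] by (simp add: graded_op_def deg)
  then have "\<And>S'. S' \<notin> generators D2 i2 j2 \<Longrightarrow> L1 (single S) S' = 0" unfolding homogeneous_def by blast
  from linear_op_expand[OF L2 fin(2) this]
  show "(\<Sum>S'\<in>generators D2 i2 j2. L1 (single S) S' * L2 (single S') S'') = L2 (L1 (single S)) S''" by simp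
qed

lemma base_change_id:
  assumes "finite (generators D i j)" and f: "f \<in> carrier (chain_module R D i j)"
  shows "base_change R D i j D i j (\<lambda>g. g) f = f"
proof
  fix S'
  have fc: "S \<in> generators D i j \<Longrightarrow> f S \<in> carrier R" "S \<notin> generators D i j \<Longrightarrow> f S = \<zero>" for S
    using f unfolding chain_module_def free_module_carrier by blast+
  have "(\<Oplus>S\<in>generators D i j. [single S S'] \<cdot> f S) = f S'" if S': "S' \<in> generators D i j"
  proof -
    have "(\<Oplus>S\<in>generators D i j. [single S S'] \<cdot> f S) = (\<Oplus>S\<in>generators D i j. if S' = S then f S else \<zero>)"
      using fc by (intro finsum_cong') (auto simp: single_def int_scalar_0)
    also have "\<dots> = f S'" using fc assms(1) S' by (intro finsum_singleton) auto
    finally show ?thesis .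
  qed
  then show "base_change R D i j D i j (\<lambda>g. g) f S' = f S'"
    using fc by (simp add: base_change_def linear_extension_def)
qed

lemma base_change_zero:
  assumes "f \<in> carrier (chain_module R D1 i1 j1)"
  shows "base_change R D1 i1 j1 D2 i2 j2 (\<lambda>g S. 0) f = (\<lambda>_. \<zero>)"
proof -
  have "(\<Oplus>S\<in>generators D1 i1 j1. [(0::int)] \<cdot> f S) = \<zero>"
    by (simp add: int_scalar_0)
  then show ?thesis by (auto simp: base_change_def linear_extension_def)
qed

lemma base_change_add:
  assumes "f \<in> carrier (chain_module R D1 i1 j1)"
  shows "base_change R D1 i1 j1 D2 i2 j2 (\<lambda>g S. L1 g S + L2 g S) f S' =
    base_change R D1 i1 j1 D2 i2 j2 L1 f S' \<oplus> base_change R D1 i1 j1 D2 i2 j2 L2 f S'"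
proof -
  have fc: "S \<in> generators D1 i1 j1 \<Longrightarrow> f S \<in> carrier R" for S
    using assms by (auto simp: chain_module_def free_module_carrier)
  have "(\<Oplus>S\<in>generators D1 i1 j1. [(L1 (single S) S' + L2 (single S) S')] \<cdot> f S) =
      (\<Oplus>S\<in>generators D1 i1 j1. [L1 (single S) S'] \<cdot> f S \<oplus> [L2 (single S) S'] \<cdot> f S)"
    using fc by (intro finsum_cong') (auto simp: add.int_pow_mult)
  also have "\<dots> = (\<Oplus>S\<in>generators D1 i1 j1. [L1 (single S) S'] \<cdot> f S) \<oplus> (\<Oplus>S\<in>generators D1 i1 j1. [L2 (single S) S'] \<cdot> f S)"
    using fc by (intro finsum_addf) auto
  finally show ?thesis by (simp add: base_change_def linear_extension_def)
qed

end

lemma linear_opI: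
  assumes "\<And>f g S. L (\<lambda>S. f S + g S) S = L f S + L g S" "\<And>k f S. L (\<lambda>S. k * f S) S = k * L f S"
  shows "linear_op L"
  using assms by (simp add: linear_op_def)

lemma linear_op_differential: "linear_op (int_differential D)"
  by (rule linear_opI) (simp_all add: int_differential_def algebra_simps sum.distrib sum_distrib_left)

lemma graded_op_differential: "graded_op D D (-2) 0 (int_differential D)"
  using linear_op_differential[of D] homogeneous_differential[of D] by (simp add: graded_op_def)

lemma X_scale: "multiplication_by_X D e (\<lambda>S. k * f S) S' = k * multiplication_by_X D e f S'"
  by (simp add: multiplication_by_X_def split: prod.splits)

lemma alternate_scale: "alternate (\<lambda>S. k * f S) S' = k * alternate f S'"
  by (simp add: alternate_def split: prod.splits)

context hopf
begin

lemma assemble_linear: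
  "(\<And>m1 m2 x S. g m1 m2 x S = g1 m1 m2 x S + g2 m1 m2 x S) \<Longrightarrow> assemble g S' = assemble g1 S' + assemble g2 S'"
  "(\<And>m1 m2 x S. g m1 m2 x S = k * g1 m1 m2 x S) \<Longrightarrow> assemble g S' = k * assemble g1 S'"
  by (simp_all add: assemble_def split: prod.splits)

lemma component_linear_fun:
  "component m1 m2 x (\<lambda>S. f S + g S) = (\<lambda>S. component m1 m2 x f S + component m1 m2 x g S)"
  "component m1 m2 x (\<lambda>S. k * f S) = (\<lambda>S. k * component m1 m2 x f S)"
  by (simp_all add: component_def fun_eq_iff)

lemma graded_ops:
  shows graded_op_alpha: "graded_op D D' (-2) (-4) alpha_int"
    and graded_op_beta: "graded_op D' D (-2) (-4) beta_int"
    and graded_op_gamma: "graded_op D D' 2 4 gamma_int"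
    and graded_op_delta: "graded_op D' D 2 4 delta_int"
    and graded_op_homotopy: "graded_op D' D' 2 0 homotopy_int"
proof -
  have "linear_op alpha_int" unfolding alpha_int_def
    by (rule linear_opI; rule assemble_linear) simp_all
  then show "graded_op D D' (-2) (-4) alpha_int" using homogeneous_alpha by (simp add: graded_op_def)
  have "linear_op beta_int" unfolding beta_int_def
    by (rule linear_opI) (simp_all add: component_linear_fun)
  then show "graded_op D' D (-2) (-4) beta_int" using homogeneous_beta by (simp add: graded_op_def)
  have "linear_op gamma_int" unfolding gamma_int_def
    by (rule linear_opI; rule assemble_linear) (simp_all add: multiplication_by_X_linear X_scale)
  then show "graded_op D D' 2 4 gamma_int" using homogeneous_gamma by (simp add: graded_op_def)
  have "linear_op delta_int" unfolding delta_int_def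
    by (rule linear_opI) (simp_all add: component_linear_fun multiplication_by_X_linear X_scale algebra_simps)
  then show "graded_op D' D 2 4 delta_int" using homogeneous_delta by (simp add: graded_op_def)
  have "linear_op homotopy_int" unfolding homotopy_int_def
    by (rule linear_opI; rule assemble_linear) (simp_all add: component_linear_fun alternate_linear alternate_scale)
  then show "graded_op D' D' 2 0 homotopy_int" using homogeneous_homotopy by (simp add: graded_op_def)
qed

text \<open>
  A chain assembled from the blocks can separate the states of different blocks.
\<close>

lemma hopf_state_inj:
  assumes "S \<in> enhanced_states D" "m1 = m2 \<or> \<not> x" "S2 \<in> enhanced_states D" "k1 = k2 \<or> \<not> y"
  shows "hopf_state m1 m2 x S = hopf_state k1 k2 y S2 \<longleftrightarrow> m1 = k1 \<and> m2 = k2 \<and> x = y \<and> S = S2"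
proof
  assume eq: "hopf_state m1 m2 x S = hopf_state k1 k2 y S2"
  let ?g = "\<lambda>l1 l2 z T. if l1 = m1 \<and> l2 = m2 \<and> z = x \<and> T = S then 1 else 0 :: int"
  have "?g k1 k2 y S2 = 1"
    using assemble_hopf_state[OF assms(1,2), of ?g] assemble_hopf_state[OF assms(3,4), of ?g] eq by simp
  then show "m1 = k1 \<and> m2 = k2 \<and> x = y \<and> S = S2" by (auto split: if_splits)
qed simp

end

context cring
begin

lemma differential_base_change:
  assumes "resmoothable D" "f \<in> carrier (chain_module R D i j)"
  shows "differential R D i j f = base_change R D i j D (i - 2) j (int_differential D) f"
proof -
  interpret D: resmoothable D by fact
  show ?thesis unfolding differential_def base_change_def
  proof (rule linear_extension_cong[OF assms(2)[unfolded chain_module_def]])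
    fix S S' assume S: "S \<in> generators D i j" "S' \<in> generators D (i - 2) j"
    then have enh: "S \<in> enhanced_states D" "S' \<in> enhanced_states D" by (auto simp: generators_def)
    have "int_differential D (single S) S' = incidence_number D S S'"
      using D.finite_enhanced_states enh(1)
      by (simp add: int_differential_def single_def if_distrib cong: if_cong)
    moreover have "state_sigma S' = state_sigma S - 2" "state_tau D S' = state_tau D S + 1"
      using S by (auto simp: generators_def)
    ultimately show "(-1) ^ sign_exponent D S S' * incidence D S S' = int_differential D (single S) S'"
      using enh by (simp add: incidence_number_def)
  qed
qed

lemma chain_module_is_module: "module R (chain_module R D i j)"
  unfolding chain_module_def by (rule free_module_is_module)

lemma base_change_hom: "base_change R D1 i1 j1 D2 i2 j2 L \<in> module_hom R (chain_module R D1 i1 j1) (chain_module R D2 i2 j2)"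
  unfolding chain_module_def base_change_def by (rule linear_extension_hom)

lemma differential_hom: "differential R D i j \<in> module_hom R (chain_module R D i j) (chain_module R D (i - 2) j)"
  unfolding chain_module_def differential_def by (rule linear_extension_hom)

lemma chain_module_zero: "\<zero>\<^bsub>chain_module R D i j\<^esub> = (\<lambda>_. \<zero>)"
  by (simp add: chain_module_def free_module_def)

lemma cycles_iff:
  "z \<in> cycles R D i j \<longleftrightarrow> z \<in> carrier (chain_module R D i j) \<and> differential R D i j z = (\<lambda>_. \<zero>)"
  by (simp add: cycles_def a_kernel_def' chain_module_zero)

lemma boundary_differential:
  assumes "resmoothable D" "f \<in> carrier (chain_module R D i j)"
  shows "differential R D (i - 2) j (differential R D i j f) = (\<lambda>_. \<zero>)"
proof -
  interpret D: resmoothable D by fact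
  have "differential R D i j f \<in> carrier (chain_module R D (i - 2) j)"
    using module_homD(1)[OF differential_hom assms(2)] .
  then have "differential R D (i - 2) j (differential R D i j f) =
      base_change R D (i - 2) j D (i - 2 - 2) j (int_differential D) (base_change R D i j D (i - 2) j (int_differential D) f)"
    using differential_base_change[OF assms(1)] assms(2) by simp
  also have "\<dots> = base_change R D i j D (i - 2 - 2) j (\<lambda>g. int_differential D (int_differential D g)) f"
    by (rule base_change_comp[OF graded_op_differential linear_op_differential]) (simp_all add: D.finite_generators assms(2))
  also have "\<dots> = (\<lambda>_. \<zero>)"
    using base_change_zero[OF assms(2)] by (simp add: D.differential_square)
  finally show ?thesis .
qed

text \<open>
  Boundaries are cycles, so that the homology is a quotient module.
\<close>

lemma homology_quotient:
  assumes "resmoothable D"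
  shows "module_quotient R ((chain_module R D i j)\<lparr>carrier := cycles R D i j\<rparr>) (boundaries R D i j)"
proof -
  have Z: "submodule (cycles R D i j) R (chain_module R D i j)"
    unfolding cycles_def by (rule kernel_submodule[OF chain_module_is_module chain_module_is_module differential_hom])
  have B: "submodule (boundaries R D i j) R (chain_module R D i j)"
    unfolding boundaries_def
    using image_submodule[OF chain_module_is_module chain_module_is_module differential_hom[of D "i + 2" j]] by simp
  have "boundaries R D i j \<subseteq> cycles R D i j"
    using boundary_differential[OF assms, of _ "i + 2" j] module_homD(1)[OF differential_hom[of D "i + 2" j]]
    by (auto simp: boundaries_def cycles_iff)
  then show ?thesis
    unfolding module_quotient_def module_quotient_axioms_def
    using submodule.submodule_is_module[OF Z chain_module_is_module]
      submodule_restrict[OF chain_module_is_module B _ Z] by blast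
qed

end

context hopf
begin

lemma alpha_chain_base_change:
  assumes "cring R" and f: "f \<in> carrier (chain_module R D (i + 2) (j + 4))"
  shows "alpha_chain R D D' i j f = base_change R D (i + 2) (j + 4) D' i j alpha_int f"
proof -
  interpret R: cring R by fact
  show ?thesis unfolding alpha_chain_def base_change_def
  proof (rule R.linear_extension_cong[OF f[unfolded chain_module_def]])
    fix S S' assume "S \<in> generators D (i + 2) (j + 4)" "S' \<in> generators D' i j"
    then have S: "S \<in> enhanced_states D" "S' \<in> enhanced_states D'" by (auto simp: generators_def)
    then obtain m1 m2 x S0 where S': "S0 \<in> enhanced_states D" "m1 = m2 \<or> \<not> x" "S' = hopf_state m1 m2 x S0"
      using enhanced_states_hopf by metis
    show "(if alpha_state D D' S = S' then 1 else 0) = alpha_int (single S) S'"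
      using S(1) S' by (auto simp: alpha_state_eq alpha_int_def assemble_hopf_state hopf_state_inj single_def)
  qed
qed

lemma beta_chain_base_change:
  assumes "cring R" and f: "f \<in> carrier (chain_module R D' i j)"
  shows "beta_chain R D D' i j f = base_change R D' i j D (i - 2) (j - 4) beta_int f"
proof -
  interpret R: cring R by fact
  show ?thesis unfolding beta_chain_def base_change_def
  proof (rule R.linear_extension_cong[OF f[unfolded chain_module_def]])
    fix S' S assume "S' \<in> generators D' i j" "S \<in> generators D (i - 2) (j - 4)"
    then have S: "S \<in> enhanced_states D" "S' \<in> enhanced_states D'" by (auto simp: generators_def)
    then obtain m1 m2 x S0 where S': "S0 \<in> enhanced_states D" "m1 = m2 \<or> \<not> x" "S' = hopf_state m1 m2 x S0"
      using enhanced_states_hopf by metis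
    show "(if beta_state D S' = Some S then 1 else 0) = beta_int (single S') S"
      using S(1) S' by (auto simp: beta_state_eq beta_int_def component_def hopf_state_inj single_def)
  qed
qed

end

section \<open>The short exact sequence\<close>

lemma module_hom_restrict:
  assumes "f \<in> module_hom R M N" "Z \<subseteq> carrier M" "f ` Z \<subseteq> Z'"
  shows "f \<in> module_hom R (M\<lparr>carrier := Z\<rparr>) (N\<lparr>carrier := Z'\<rparr>)"
  by (rule module_homI) (use module_homD[OF assms(1)] assms(2,3) in \<open>auto simp: subset_iff\<close>)

context cring
begin

lemma base_change_commutes:
  assumes D1: "resmoothable D1" and D2: "resmoothable D2" and L: "graded_op D1 D2 a b L"
    and comm: "\<And>g. supported D1 g \<Longrightarrow> int_differential D2 (L g) = L (int_differential D1 g)"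
    and deg: "i2 = i1 + a" "j2 = j1 + b" and f: "f \<in> carrier (chain_module R D1 i1 j1)"
  shows "differential R D2 i2 j2 (base_change R D1 i1 j1 D2 i2 j2 L f) =
    base_change R D1 (i1 - 2) j1 D2 (i2 - 2) j2 L (differential R D1 i1 j1 f)"
proof -
  interpret D1: resmoothable D1 by fact
  interpret D2: resmoothable D2 by fact
  have Lf: "base_change R D1 i1 j1 D2 i2 j2 L f \<in> carrier (chain_module R D2 i2 j2)"
    by (rule module_homD(1)[OF base_change_hom f])
  have lin: "linear_op L" using L by (simp add: graded_op_def)
  have "differential R D2 i2 j2 (base_change R D1 i1 j1 D2 i2 j2 L f) =
      base_change R D1 i1 j1 D2 (i2 - 2) j2 (\<lambda>g. int_differential D2 (L g)) f"
    unfolding differential_base_change[OF D2 Lf]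
    by (rule base_change_comp[OF L linear_op_differential deg D1.finite_generators D2.finite_generators f])
  also have "\<dots> = base_change R D1 i1 j1 D2 (i2 - 2) j2 (\<lambda>g. L (int_differential D1 g)) f"
    by (rule base_change_cong[OF f]) (rule comm[OF homogeneous_supported])
  also have "\<dots> = base_change R D1 (i1 - 2) j1 D2 (i2 - 2) j2 L (differential R D1 i1 j1 f)"
    unfolding differential_base_change[OF D1 f]
    by (rule base_change_comp[OF graded_op_differential lin _ _ D1.finite_generators D1.finite_generators f, symmetric]) simp_all
  finally show ?thesis .
qed

end

context hopf
begin

text \<open>
  Since \<open>\<delta>\<close> and \<open>\<gamma>\<close> are chain maps with \<open>\<delta>\<alpha> = 1\<close> and \<open>\<beta>\<gamma> = 1\<close>, the map \<open>\<alpha>\<close> is injective and \<open>\<beta>\<close> is surjective in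
  homology.  If \<open>y\<close> is a cycle and \<open>\<beta> y = d w\<close>, then the homotopy gives \<open>y = \<alpha> (\<delta> y) + d (\<gamma> w + h y)\<close>.
\<close>

lemma short_exact:
  fixes R :: "('r, 'm) ring_scheme" and i j :: int
  assumes "cring R"
  shows "short_exact_sequence R
           (khovanov_homology R D (i + 2) (j + 4))
           (induced_map R D' i j (alpha_chain R D D' i j))
           (khovanov_homology R D' i j)
           (induced_map R D (i - 2) (j - 4) (beta_chain R D D' i j))
           (khovanov_homology R D (i - 2) (j - 4))"
proof -
  interpret R: cring R by fact
  note res = resmoothable_axioms hopf_resmoothable
  note fin = finite_generators H.finite_generators
  let ?C = "\<lambda>k l. carrier (chain_module R D k l)" and ?C' = "\<lambda>k. carrier (chain_module R D' k j)"
  let ?d = "differential R D" and ?d' = "\<lambda>k. differential R D' k j"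
  define al where "al k = base_change R D (k + 2) (j + 4) D' k j alpha_int" for k
  define be where "be k = base_change R D' k j D (k - 2) (j - 4) beta_int" for k
  define ga where "ga k = base_change R D (k - 2) (j - 4) D' k j gamma_int" for k
  define de where "de k = base_change R D' k j D (k + 2) (j + 4) delta_int" for k
  define ho where "ho k = base_change R D' k j D' (k + 2) j homotopy_int" for k
  note defs = al_def be_def ga_def de_def ho_def
  note hom = R.base_change_hom R.differential_hom
  have carriers: "x \<in> ?C (k + 2) (j + 4) \<Longrightarrow> al k x \<in> ?C' k" "y \<in> ?C' k \<Longrightarrow> be k y \<in> ?C (k - 2) (j - 4)"
    "z \<in> ?C (k - 2) (j - 4) \<Longrightarrow> ga k z \<in> ?C' k" "y \<in> ?C' k \<Longrightarrow> de k y \<in> ?C (k + 2) (j + 4)"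
    "y \<in> ?C' k \<Longrightarrow> ho k y \<in> ?C' (k + 2)" "u \<in> ?C k l \<Longrightarrow> ?d k l u \<in> ?C (k - 2) l" "y \<in> ?C' k \<Longrightarrow> ?d' k y \<in> ?C' (k - 2)"
    for x y z u k l
    unfolding defs by (rule module_homD(1)[OF hom(1)] module_homD(1)[OF hom(2)]; assumption)+
  have zeros: "al k (\<lambda>_. \<zero>\<^bsub>R\<^esub>) = (\<lambda>_. \<zero>\<^bsub>R\<^esub>)" "be k (\<lambda>_. \<zero>\<^bsub>R\<^esub>) = (\<lambda>_. \<zero>\<^bsub>R\<^esub>)" "ga k (\<lambda>_. \<zero>\<^bsub>R\<^esub>) = (\<lambda>_. \<zero>\<^bsub>R\<^esub>)"
    "de k (\<lambda>_. \<zero>\<^bsub>R\<^esub>) = (\<lambda>_. \<zero>\<^bsub>R\<^esub>)" "ho k (\<lambda>_. \<zero>\<^bsub>R\<^esub>) = (\<lambda>_. \<zero>\<^bsub>R\<^esub>)" for k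
    unfolding defs
    using module_hom_zero_inv(1)[OF R.chain_module_is_module R.chain_module_is_module hom(1)]
    by (simp_all add: R.chain_module_zero)
  have al_d: "?d' k (al k x) = al (k - 2) (?d (k + 2) (j + 4) x)" if "x \<in> ?C (k + 2) (j + 4)" for k x
    using R.base_change_commutes[OF res(1,2) graded_op_alpha alpha_int_chain_map _ _ that, of k j] by (simp add: defs)
  have be_d: "?d (k - 2) (j - 4) (be k y) = be (k - 2) (?d' k y)" if "y \<in> ?C' k" for k y
    using R.base_change_commutes[OF res(2,1) graded_op_beta beta_int_chain_map[symmetric] _ _ that, of "k - 2" "j - 4"] by (simp add: defs)
  have ga_d: "?d' k (ga k z) = ga (k - 2) (?d (k - 2) (j - 4) z)" if "z \<in> ?C (k - 2) (j - 4)" for k z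
    using R.base_change_commutes[OF res(1,2) graded_op_gamma gamma_int_chain_map _ _ that, of k j] by (simp add: defs)
  have de_d: "?d (k + 2) (j + 4) (de k y) = de (k - 2) (?d' k y)" if "y \<in> ?C' k" for k y
    using R.base_change_commutes[OF res(2,1) graded_op_delta delta_int_chain_map[symmetric] _ _ that, of "k + 2" "j + 4"] by (simp add: defs)
  have lin: "linear_op alpha_int" "linear_op beta_int" "linear_op gamma_int" "linear_op delta_int" "linear_op homotopy_int"
    using graded_ops by (simp_all add: graded_op_def)
  have de_al: "de k (al k x) = x" if x: "x \<in> ?C (k + 2) (j + 4)" for k x
  proof -
    have "de k (al k x) = base_change R D (k + 2) (j + 4) D (k + 2) (j + 4) (\<lambda>g. delta_int (alpha_int g)) x"
      unfolding defs by (rule R.base_change_comp[OF graded_op_alpha lin(4) _ _ fin(1,2) x]) simp_all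
    also have "\<dots> = base_change R D (k + 2) (j + 4) D (k + 2) (j + 4) (\<lambda>g. g) x"
      by (rule R.base_change_cong[OF x]) (rule delta_alpha[OF homogeneous_supported])
    finally show ?thesis using R.base_change_id[OF fin(1) x] by simp
  qed
  have be_ga: "be k (ga k z) = z" if z: "z \<in> ?C (k - 2) (j - 4)" for k z
  proof -
    have "be k (ga k z) = base_change R D (k - 2) (j - 4) D (k - 2) (j - 4) (\<lambda>g. beta_int (gamma_int g)) z"
      unfolding defs by (rule R.base_change_comp[OF graded_op_gamma lin(2) _ _ fin(1,2) z]) simp_all
    also have "\<dots> = base_change R D (k - 2) (j - 4) D (k - 2) (j - 4) (\<lambda>g. g) z"
      by (rule R.base_change_cong[OF z]) (rule beta_gamma[OF homogeneous_supported])
    finally show ?thesis using R.base_change_id[OF fin(1) z] by simp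
  qed
  have be_al: "be k (al k x) = (\<lambda>_. \<zero>\<^bsub>R\<^esub>)" if x: "x \<in> ?C (k + 2) (j + 4)" for k x
  proof -
    have "be k (al k x) = base_change R D (k + 2) (j + 4) D (k - 2) (j - 4) (\<lambda>g. beta_int (alpha_int g)) x"
      unfolding defs by (rule R.base_change_comp[OF graded_op_alpha lin(2) _ _ fin(1,2) x]) simp_all
    also have "\<dots> = base_change R D (k + 2) (j + 4) D (k - 2) (j - 4) (\<lambda>g S. 0) x"
      by (rule R.base_change_cong[OF x]) (rule beta_alpha[OF homogeneous_supported])
    finally show ?thesis using R.base_change_zero[OF x] by simp
  qed
  have htpy: "y S = ((al k (de k y) S \<oplus>\<^bsub>R\<^esub> ga k (be k y) S) \<oplus>\<^bsub>R\<^esub> ?d' (k + 2) (ho k y) S) \<oplus>\<^bsub>R\<^esub> ho (k - 2) (?d' k y) S"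
    if y: "y \<in> ?C' k" for k y S
  proof -
    let ?b = "base_change R D' k j D' k j"
    have 1: "?b (\<lambda>g. alpha_int (delta_int g)) y = al k (de k y)"
      unfolding defs by (rule R.base_change_comp[OF graded_op_delta lin(1) _ _ fin(2,1) y, symmetric]) simp_all
    have 2: "?b (\<lambda>g. gamma_int (beta_int g)) y = ga k (be k y)"
      unfolding defs by (rule R.base_change_comp[OF graded_op_beta lin(3) _ _ fin(2,1) y, symmetric]) simp_all
    have 3: "?b (\<lambda>g. int_differential D' (homotopy_int g)) y = ?d' (k + 2) (ho k y)"
    proof -
      have "base_change R D' (k + 2) j D' k j (int_differential D') (ho k y) = ?b (\<lambda>g. int_differential D' (homotopy_int g)) y"
        unfolding defs by (rule R.base_change_comp[OF graded_op_homotopy linear_op_differential _ _ fin(2,2) y]) simp_all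
      then show ?thesis using R.differential_base_change[OF res(2) carriers(5)[OF y]] by simp
    qed
    have 4: "?b (\<lambda>g. homotopy_int (int_differential D' g)) y = ho (k - 2) (?d' k y)"
    proof -
      have "base_change R D' (k - 2) j D' k j homotopy_int (base_change R D' k j D' (k - 2) j (int_differential D') y) =
          ?b (\<lambda>g. homotopy_int (int_differential D' g)) y"
        by (rule R.base_change_comp[OF graded_op_differential lin(5) _ _ fin(2,2) y]) simp_all
      then show ?thesis using R.differential_base_change[OF res(2) y] by (simp add: defs)
    qed
    have "y = ?b (\<lambda>g. g) y" using R.base_change_id[OF fin(2) y] by simp
    also have "\<dots> = ?b (\<lambda>g S. alpha_int (delta_int g) S + gamma_int (beta_int g) S +
        int_differential D' (homotopy_int g) S + homotopy_int (int_differential D' g) S) y"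
      by (rule R.base_change_cong[OF y]) (rule homotopy[OF homogeneous_supported])
    finally have "y S = \<dots> S" by (rule fun_cong)
    then show ?thesis by (simp only: R.base_change_add[OF y] 1 2 3 4)
  qed
  have al_eq: "alpha_chain R D D' i j x = al i x" if "x \<in> ?C (i + 2) (j + 4)" for x
    unfolding defs by (rule alpha_chain_base_change[OF assms that])
  have be_eq: "beta_chain R D D' i j y = be i y" if "y \<in> ?C' i" for y
    unfolding defs by (rule beta_chain_base_change[OF assms that])
  have alpha_hom: "alpha_chain R D D' i j \<in> module_hom R (chain_module R D (i + 2) (j + 4)) (chain_module R D' i j)"
    and beta_hom: "beta_chain R D D' i j \<in> module_hom R (chain_module R D' i j) (chain_module R D (i - 2) (j - 4))"
    unfolding alpha_chain_def beta_chain_def chain_module_def by (rule R.linear_extension_hom)+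
  let ?ZL = "cycles R D (i + 2) (j + 4)" and ?ZM = "cycles R D' i j" and ?ZN = "cycles R D (i - 2) (j - 4)"
  let ?BL = "boundaries R D (i + 2) (j + 4)" and ?BM = "boundaries R D' i j" and ?BN = "boundaries R D (i - 2) (j - 4)"
  let ?L = "(chain_module R D (i + 2) (j + 4))\<lparr>carrier := ?ZL\<rparr>" and ?M = "(chain_module R D' i j)\<lparr>carrier := ?ZM\<rparr>"
  let ?N = "(chain_module R D (i - 2) (j - 4))\<lparr>carrier := ?ZN\<rparr>"
  have alpha_cycles: "alpha_chain R D D' i j ` ?ZL \<subseteq> ?ZM"
    using carriers(1) al_eq al_d zeros(1) by (auto simp: R.cycles_iff)
  have beta_cycles: "beta_chain R D D' i j ` ?ZM \<subseteq> ?ZN"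
    using carriers(2) be_eq be_d zeros(2) by (auto simp: R.cycles_iff)
  have "short_exact_sequence R (quotient_module ?L ?BL) (\<lambda>X. \<Union>x\<in>X. ?BM +>\<^bsub>?M\<^esub> alpha_chain R D D' i j x) (quotient_module ?M ?BM)
    (\<lambda>X. \<Union>x\<in>X. ?BN +>\<^bsub>?N\<^esub> beta_chain R D D' i j x) (quotient_module ?N ?BN)"
  proof (rule short_exact_sequence_quotients)
    show "module_quotient R ?L ?BL" "module_quotient R ?M ?BM" "module_quotient R ?N ?BN"
      by (rule R.homology_quotient[OF res(1)] R.homology_quotient[OF res(2)])+
    show "alpha_chain R D D' i j \<in> module_hom R ?L ?M" "beta_chain R D D' i j \<in> module_hom R ?M ?N"
      by (rule module_hom_restrict[OF alpha_hom _ alpha_cycles] module_hom_restrict[OF beta_hom _ beta_cycles];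
          auto simp: R.cycles_iff)+
    show "alpha_chain R D D' i j ` ?BL \<subseteq> ?BM"
    proof
      fix y assume "y \<in> alpha_chain R D D' i j ` ?BL"
      then obtain w where w: "w \<in> ?C (i + 2 + 2) (j + 4)" "y = alpha_chain R D D' i j (?d (i + 2 + 2) (j + 4) w)"
        by (auto simp: boundaries_def)
      then have "y = ?d' (i + 2) (al (i + 2) w)"
        using al_d[OF w(1)] al_eq[OF carriers(6)[OF w(1), unfolded add_diff_cancel_right']] by simp
      then show "y \<in> ?BM" using carriers(1)[OF w(1)] by (auto simp: boundaries_def)
    qed
    show "beta_chain R D D' i j ` ?BM \<subseteq> ?BN"
    proof
      fix z assume "z \<in> beta_chain R D D' i j ` ?BM"
      then obtain w where w: "w \<in> ?C' (i + 2)" "z = beta_chain R D D' i j (?d' (i + 2) w)"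
        by (auto simp: boundaries_def)
      then have "z = ?d (i - 2 + 2) (j - 4) (be (i + 2) w)"
        using be_d[OF w(1)] be_eq[OF carriers(7)[OF w(1), unfolded add_diff_cancel_right']] by simp
      then show "z \<in> ?BN" using carriers(2)[OF w(1)] by (auto simp: boundaries_def)
    qed
  next
    fix x assume "x \<in> carrier ?L" "alpha_chain R D D' i j x \<in> ?BM"
    then obtain w where x: "x \<in> ?C (i + 2) (j + 4)" and w: "w \<in> ?C' (i + 2)" "al i x = ?d' (i + 2) w"
      using al_eq by (auto simp: R.cycles_iff boundaries_def)
    have "x = de i (?d' (i + 2) w)" using de_al[OF x] w(2) by simp
    also have "\<dots> = ?d (i + 2 + 2) (j + 4) (de (i + 2) w)" using de_d[OF w(1)] by simp
    finally show "x \<in> ?BL" using carriers(4)[OF w(1)] by (auto simp: boundaries_def)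
  next
    fix x assume "x \<in> carrier ?L"
    then have x: "x \<in> ?C (i + 2) (j + 4)" by (simp add: R.cycles_iff)
    interpret N: module_quotient R ?N ?BN by (rule R.homology_quotient[OF res(1)])
    have "beta_chain R D D' i j (alpha_chain R D D' i j x) = (\<lambda>_. \<zero>\<^bsub>R\<^esub>)"
      using al_eq[OF x] be_eq[OF carriers(1)[OF x]] be_al[OF x] by simp
    then show "beta_chain R D D' i j (alpha_chain R D D' i j x) \<in> ?BN"
      using N.submodule_facts(2) by (simp add: R.chain_module_zero)
  next
    fix y assume "y \<in> carrier ?M" "beta_chain R D D' i j y \<in> ?BN"
    then obtain w where y: "y \<in> ?C' i" "?d' i y = (\<lambda>_. \<zero>\<^bsub>R\<^esub>)" and w: "w \<in> ?C i (j - 4)" "be i y = ?d i (j - 4) w"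
      using be_eq by (auto simp: R.cycles_iff boundaries_def)
    have w': "w \<in> ?C (i + 2 - 2) (j - 4)" using w(1) by simp
    have ga: "ga i (be i y) = ?d' (i + 2) (ga (i + 2) w)"
      using ga_d[OF w'] w(2) by simp
    let ?u = "ga (i + 2) w \<oplus>\<^bsub>chain_module R D' (i + 2) j\<^esub> ho i y"
    interpret C2: module R "chain_module R D' (i + 2) j" by (rule R.chain_module_is_module)
    have u: "?u \<in> ?C' (i + 2)" using carriers(3)[OF w'] carriers(5)[OF y(1)] by simp
    have du: "?d' (i + 2) ?u = (\<lambda>S. ?d' (i + 2) (ga (i + 2) w) S \<oplus>\<^bsub>R\<^esub> ?d' (i + 2) (ho i y) S)"
      using module_homD(2)[OF R.differential_hom carriers(3)[OF w'] carriers(5)[OF y(1)]]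
      by (simp add: chain_module_def free_module_def)
    have x: "de i y \<in> ?C (i + 2) (j + 4)" by (rule carriers(4)[OF y(1)])
    have "de i y \<in> ?ZL" using x de_d[OF y(1)] y(2) zeros(4) by (simp add: R.cycles_iff)
    moreover have "?d' (i + 2) ?u \<in> ?BM" using u by (auto simp: boundaries_def)
    moreover have "y = ?d' (i + 2) ?u \<oplus>\<^bsub>?M\<^esub> alpha_chain R D D' i j (de i y)"
    proof
      fix S
      have in_R: "f S \<in> carrier R" if "f \<in> ?C' i" for f
        using that R.zero_closed unfolding chain_module_def free_module_carrier by metis
      have c: "al i (de i y) S \<in> carrier R" "?d' (i + 2) (ga (i + 2) w) S \<in> carrier R" "?d' (i + 2) (ho i y) S \<in> carrier R"
        using in_R[OF carriers(1)[OF x]] in_R[OF carriers(7)[OF carriers(3)[OF w'], unfolded add_diff_cancel_right']]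
          in_R[OF carriers(7)[OF carriers(5)[OF y(1)], unfolded add_diff_cancel_right']] by simp_all
      have "y S = al i (de i y) S \<oplus>\<^bsub>R\<^esub> ?d' (i + 2) (ga (i + 2) w) S \<oplus>\<^bsub>R\<^esub> ?d' (i + 2) (ho i y) S"
        using htpy[OF y(1), of S] c by (simp add: ga y(2) zeros(5))
      also have "\<dots> = (?d' (i + 2) (ga (i + 2) w) S \<oplus>\<^bsub>R\<^esub> ?d' (i + 2) (ho i y) S) \<oplus>\<^bsub>R\<^esub> al i (de i y) S"
        using c by (simp add: R.a_ac)
      finally show "y S = (?d' (i + 2) ?u \<oplus>\<^bsub>?M\<^esub> alpha_chain R D D' i j (de i y)) S"
        by (simp add: du al_eq[OF x]) (simp add: chain_module_def free_module_def)
    qed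
    ultimately show "\<exists>x\<in>carrier ?L. \<exists>k\<in>?BM. y = k \<oplus>\<^bsub>?M\<^esub> alpha_chain R D D' i j x"
      by (intro bexI[of _ "de i y"] bexI[of _ "?d' (i + 2) ?u"]) simp_all
  next
    fix z assume "z \<in> carrier ?N"
    then have z: "z \<in> ?C (i - 2) (j - 4)" "?d (i - 2) (j - 4) z = (\<lambda>_. \<zero>\<^bsub>R\<^esub>)" by (auto simp: R.cycles_iff)
    then have "ga i z \<in> ?ZM" using carriers(3) ga_d zeros(3) by (simp add: R.cycles_iff)
    moreover have "beta_chain R D D' i j (ga i z) = z" using be_eq[OF carriers(3)[OF z(1)]] be_ga[OF z(1)] by simp
    ultimately show "\<exists>y\<in>carrier ?M. beta_chain R D D' i j y = z" by auto
  qed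
  then show ?thesis
    by (simp add: khovanov_homology_def induced_map_def[abs_def] coset_update_carrier)
qed

end

lemma hopf_additionE:
  assumes "link_diagram D" "hopf_addition D D'"
  shows "\<exists>e r m t b xs swapped. hopf D D' e r m t b xs swapped"
proof -
  obtain e r m t b xs where cut: "cut_arc D e r xs" and new: "distinct [m, t, b]" "{m, t, b} \<inter> insert r (arcs D) = {}"
    "arcs D' = arcs D \<union> {r, m, t, b}"
    and cr: "crossings D' = [e, b, m, t] # [b, r, t, m] # xs \<or> crossings D' = [b, r, t, m] # [e, b, m, t] # xs"
    using assms(2) unfolding hopf_addition_def by (elim exE conjE) metis
  interpret resmoothable D by (rule link_diagram_resmoothable[OF assms(1)])
  have "e \<in> arcs D \<and> (r = e \<or> r \<notin> arcs D) \<and> length xs = n \<and> (\<forall>c<n. length (xs ! c) = 4 \<and>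
      (\<forall>k<4. xs ! c ! k = crossings D ! c ! k \<or> xs ! c ! k = r \<and> crossings D ! c ! k = e))"
    using cut
  proof cases
    case (at_crossing c k)
    have ck: "c < n" "k < 4" "crossings D ! c ! k = e" using at_crossing by (auto simp: edge_ends_def label_def)
    then have "e \<in> arcs D" using crossing_nth[of c] by (metis nth_mem subsetD)
    moreover have "length (xs ! d) = 4 \<and> (\<forall>l<4. xs ! d ! l = crossings D ! d ! l \<or> xs ! d ! l = r \<and> crossings D ! d ! l = e)"
      if "d < n" for d
      using at_crossing(1) ck crossing_nth[OF that] crossing_nth[OF ck(1)] by (auto simp: nth_list_update)
    ultimately show ?thesis using at_crossing by simp
  next
    case crossingless
    then show ?thesis using crossing_nth by simp
  qed
  then have "hopf_axioms D D' e r m t b xs (crossings D' \<noteq> [e, b, m, t] # [b, r, t, m] # xs)"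
    unfolding hopf_axioms_def using new cr by auto
  then show ?thesis using resmoothable_axioms unfolding hopf_def by blast
qed

theorem theorem6p1:
  fixes R :: "('r, 'm) ring_scheme" and D D' :: "'a diagram" and i j :: int
  assumes "cring R"
    and "link_diagram D"
    and "hopf_addition D D'"
  shows "short_exact_sequence R
           (khovanov_homology R D (i + 2) (j + 4))
           (induced_map R D' i j (alpha_chain R D D' i j))
           (khovanov_homology R D' i j)
           (induced_map R D (i - 2) (j - 4) (beta_chain R D D' i j))
           (khovanov_homology R D (i - 2) (j - 4))"
proof -
  obtain e r m t b xs swapped where "hopf D D' e r m t b xs swapped"
    using hopf_additionE[OF assms(2,3)] by (elim exE)
  then show ?thesis by (rule hopf.short_exact[OF _ assms(1)])
qed

end
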